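(* Let $A\in\mathbb{R}^{n\times d}$, $B\in\mathbb{R}^{n\times d'}$, $\lambda_1,\lambda_2\ge0$, $\epsilon\in(0,1]$. If $S\in\mathbb{R}^{m\times n}$ is a sparse embedding matrix with $m=\Omega(\max(\mathrm{sd}_{\lambda_1}(A),\mathrm{sd}_{\lambda_2}(B))^2/\epsilon^2)$ rows (with a sufficiently large implied constant), then with high probability the $(\lambda_1,\lambda_2)$ canonical correlations and canonical weights of $(SA,SB)$ form an $\epsilon$-approximate $(\lambda_1,\lambda_2)$ regularized CCA of $(A,B)$.
   Context: $\mathrm{sd}_\lambda(M)=\sum_i 1/(1+\lambda/\sigma_i^2)$, summing over the nonzero singular values $\sigma_i$ of $M$. A sparse embedding (CountSketch) matrix has in each column exactly one nonzero entry, a uniformly random sign placed in a uniformly random row, independently across columns. Regularized CCA: let $q=\min(\mathrm{rank}(A^\top A+\lambda_1I_d),\mathrm{rank}(B^\top B+\lambda_2I_{d'}))$. The $(\lambda_1,\lambda_2)$ canonical correlations $\sigma_1\ge\dots\ge\sigma_q$ and canonical weights $u_1,\dots,u_q\in\mathbb{R}^d$, $v_1,\dots,v_q\in\mathbb{R}^{d'}$ are ones that maximize $\mathrm{tr}(U^\top A^\top BV)$, where $U=[u_1,\dots,u_q]\in\mathbb{R}^{d\times q}$, $V=[v_1,\dots,v_q]\in\mathbb{R}^{d'\times q}$, subject to $U^\top(A^\top A+\lambda_1I_d)U=I_q$, $V^\top(B^\top B+\lambda_2I_{d'})V=I_q$, and $U^\top A^\top BV=\mathrm{diag}(\sigma_1,\dots,\sigma_q)$.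 For $0\le\eta\le1$, an $\eta$-approximate $(\lambda_1,\lambda_2)$ regularized CCA of $(A,B)$ is a set of positive numbers $\hat\sigma_1\ge\dots\ge\hat\sigma_q$ and vectors $\hat u_1,\dots,\hat u_q\in\mathbb{R}^d$, $\hat v_1,\dots,\hat v_q\in\mathbb{R}^{d'}$ such that: (a) $|\hat\sigma_i-\sigma_i|\le\eta$ for every $i$; (b) with $\hat U=[\hat u_1,\dots,\hat u_q]$, $\hat V=[\hat v_1,\dots,\hat v_q]$, every entry of $\hat U^\top(A^\top A+\lambda_1I_d)\hat U-I_q$ and of $\hat V^\top(B^\top B+\lambda_2I_{d'})\hat V-I_q$ has absolute value at most $\eta$; (c) $|\hat u_i^\top A^\top B\hat v_i-\sigma_i|\le\eta$ for every $i$. Here $\sigma_i$ are the $(\lambda_1,\lambda_2)$ canonical correlations of $(A,B)$.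
   Formalization: In the definition of an approximate regularized CCA, the "positive numbers" σ̂_i are only required to be nonnegative, since with strict positivity the claim fails (for example A=0, B=1, λ₁=λ₂=1 gives σ̂₁=0). *)

theory Defs
  imports
    "HOL-Probability.Product_PMF"
    "Jordan_Normal_Form.DL_Rank"
    "Jordan_Normal_Form.Char_Poly"
begin

text \<open>
  Matrices are those of \<open>Jordan_Normal_Form\<close>, so that all dimensions are ordinary natural numbers
  that can be quantified after the implied constant of the bound on the number of rows.
\<close>

section \<open>Statistical dimension\<close>

text \<open>
  The singular values of \<open>M\<close> are the square roots of the eigenvalues of \<open>M\<^sup>T M\<close>, with multiplicity.
  For an \<open>n \<times> d\<close> matrix this lists \<open>d\<close> values; the nonzero ones do not depend on whether one
  lists \<open>d\<close> or \<open>min n d\<close> of them.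
\<close>
definition singular_values :: "real mat \<Rightarrow> real multiset" where
  "singular_values M = image_mset sqrt (proots (char_poly (transpose_mat M * M)))"

definition stat_dim :: "real \<Rightarrow> real mat \<Rightarrow> real" where
  "stat_dim lam M =
     (\<Sum>\<sigma> \<in># filter_mset (\<lambda>\<sigma>. \<sigma> \<noteq> 0) (singular_values M). 1 / (1 + lam / \<sigma>\<^sup>2))"

section \<open>Sparse embedding matrices\<close>

text \<open>
  The law of a random \<open>m \<times> n\<close> CountSketch matrix: \<open>f j\<close> is the pair (row, sign) of the single
  nonzero entry of column \<open>j\<close>. The pairs are independent and uniform. This is meaningful only for
  \<open>m > 0\<close>, as otherwise there is no row to choose.
\<close>
definition sparse_embedding_pmf :: "nat \<Rightarrow> nat \<Rightarrow> real mat pmf" where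
  "sparse_embedding_pmf m n =
     map_pmf (\<lambda>f. Matrix.mat m n (\<lambda>(i, j). if i = fst (f j) then snd (f j) else 0))
       (Pi_pmf {..<n} (0, 1) (\<lambda>_. pmf_of_set ({..<m} \<times> {-1, 1})))"

section \<open>Regularized canonical correlation analysis\<close>

definition mat_rank :: "real mat \<Rightarrow> nat" where
  "mat_rank M = vec_space.rank (dim_row M) M"

definition mat_trace :: "real mat \<Rightarrow> real" where
  "mat_trace M = (\<Sum>i<dim_row M. M $$ (i, i))"

definition reg_gram :: "real \<Rightarrow> real mat \<Rightarrow> real mat" where
  "reg_gram lam A = transpose_mat A * A + lam \<cdot>\<^sub>m 1\<^sub>m (dim_col A)"

definition cca_dim :: "real \<Rightarrow> real \<Rightarrow> real mat \<Rightarrow> real mat \<Rightarrow> nat" where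
  "cca_dim lam1 lam2 A B = min (mat_rank (reg_gram lam1 A)) (mat_rank (reg_gram lam2 B))"

definition nonincreasing :: "real Matrix.vec \<Rightarrow> bool" where
  "nonincreasing s \<longleftrightarrow> (\<forall>i j. i \<le> j \<longrightarrow> j < dim_vec s \<longrightarrow> s $ j \<le> s $ i)"

text \<open>The numbers are \<open>s\<close>; the columns of \<open>U\<close> and \<open>V\<close> are the weights.\<close>
definition cca_feasible ::
    "real \<Rightarrow> real \<Rightarrow> real mat \<Rightarrow> real mat \<Rightarrow> real Matrix.vec \<Rightarrow> real mat \<Rightarrow> real mat \<Rightarrow> bool" where
  "cca_feasible lam1 lam2 A B s U V \<longleftrightarrow>
     (let q = cca_dim lam1 lam2 A B in
        s \<in> carrier_vec q \<and> nonincreasing s \<and>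
        U \<in> carrier_mat (dim_col A) q \<and> V \<in> carrier_mat (dim_col B) q \<and>
        transpose_mat U * reg_gram lam1 A * U = 1\<^sub>m q \<and>
        transpose_mat V * reg_gram lam2 B * V = 1\<^sub>m q \<and>
        transpose_mat U * (transpose_mat A * B) * V = mat_diag q (\<lambda>i. s $ i))"

definition is_cca ::
    "real \<Rightarrow> real \<Rightarrow> real mat \<Rightarrow> real mat \<Rightarrow> real Matrix.vec \<Rightarrow> real mat \<Rightarrow> real mat \<Rightarrow> bool" where
  "is_cca lam1 lam2 A B s U V \<longleftrightarrow>
     cca_feasible lam1 lam2 A B s U V \<and>
     (\<forall>s' U' V'. cca_feasible lam1 lam2 A B s' U' V' \<longrightarrow>
        mat_trace (transpose_mat U' * (transpose_mat A * B) * V')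
          \<le> mat_trace (transpose_mat U * (transpose_mat A * B) * V))"

definition is_canonical_correlations ::
    "real \<Rightarrow> real \<Rightarrow> real mat \<Rightarrow> real mat \<Rightarrow> real Matrix.vec \<Rightarrow> bool" where
  "is_canonical_correlations lam1 lam2 A B s \<longleftrightarrow> (\<exists>U V. is_cca lam1 lam2 A B s U V)"

text \<open>
  The approximate correlations \<open>s'\<close> are required to be nonnegative rather than strictly positive:
  exact canonical correlations may vanish (for instance if \<open>A\<^sup>T B = 0\<close>), and an exact regularized
  CCA is meant to be an approximate one. The canonical correlations of \<open>(A, B)\<close> are required to
  exist, and the bounds to hold for whichever are taken, so that nothing hinges on their uniqueness.
\<close>
definition is_approx_cca ::
    "real \<Rightarrow> real \<Rightarrow> real \<Rightarrow> real mat \<Rightarrow> real mat \<Rightarrow>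
     real Matrix.vec \<Rightarrow> real mat \<Rightarrow> real mat \<Rightarrow> bool" where
  "is_approx_cca \<eta> lam1 lam2 A B s' U V \<longleftrightarrow>
     (let q = cca_dim lam1 lam2 A B in
        s' \<in> carrier_vec q \<and> nonincreasing s' \<and> (\<forall>i<q. 0 \<le> s' $ i) \<and>
        U \<in> carrier_mat (dim_col A) q \<and> V \<in> carrier_mat (dim_col B) q \<and>
        (\<forall>i<q. \<forall>j<q. \<bar>(transpose_mat U * reg_gram lam1 A * U - 1\<^sub>m q) $$ (i, j)\<bar> \<le> \<eta>) \<and>
        (\<forall>i<q. \<forall>j<q. \<bar>(transpose_mat V * reg_gram lam2 B * V - 1\<^sub>m q) $$ (i, j)\<bar> \<le> \<eta>) \<and>
        (\<exists>s. is_canonical_correlations lam1 lam2 A B s) \<and>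
        (\<forall>s. is_canonical_correlations lam1 lam2 A B s \<longrightarrow>
           (\<forall>i<q. \<bar>s' $ i - s $ i\<bar> \<le> \<eta> \<and>
                  \<bar>Matrix.col U i \<bullet> ((transpose_mat A * B) *\<^sub>v Matrix.col V i) - s $ i\<bar> \<le> \<eta>)))"

end

theory Submission
  imports Defs "Jordan_Normal_Form.Spectral_Radius"
begin

unbundle no vec_syntax and no inner_syntax

text \<open>
  Write \<open>P = A\<^sup>T A + \<lambda>\<^sub>1 I\<close>, \<open>P' = B\<^sup>T B + \<lambda>\<^sub>2 I\<close> and \<open>C = A\<^sup>T B\<close>. The spectral theorem for \<open>A\<^sup>T A\<close> gives
  \<open>W\<close> with \<open>W\<^sup>T P W = I\<close>, \<open>A W W\<^sup>T P = A\<close> and squared Frobenius norm of \<open>A W\<close> equal to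
  the statistical dimension, and likewise \<open>W'\<close> for \<open>B\<close>. A second moment bound for approximate matrix
  multiplication with CountSketch and Markov's inequality show that, with high probability, sketching
  changes the Gram matrices of the columns of \<open>A W\<close> and \<open>B W'\<close> by at most \<open>\<epsilon> / 4\<close> in Frobenius
  norm, so that the forms \<open>P\<close>, \<open>P'\<close> and \<open>C\<close> change by at most \<open>\<epsilon> / 4\<close> relative to \<open>P\<close> and \<open>P'\<close>.
  The maximizers of the CCA problem are exactly the feasible triples with
  \<open>C = P U diag(s) V\<^sup>T P'\<close> and \<open>s \<ge> 0\<close>, by the equality case of Bessel's and Cauchy's inequalities, and
  for these a Weyl-type argument compares the correlations of the two problems.
\<close>

section \<open>Spectral theorem\<close>

text \<open>A zero regularization parameter may leave \<open>P\<close> singular, and this shapes the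
  proof. \<open>W\<close> has only rank many columns, and \<open>A W W^T P = A\<close> replaces
  invertibility; equality in Bessel identifies vectors only after \<open>P\<close> is applied. The
  sketched problem must also be shown to have the same number of weights, which holds because
  comparable forms vanish on the same vectors. The claim concerns every maximizer of the sketched
  problem, and maximizers are not unique. Building one from a singular value decomposition is
  therefore not enough: the equality case must show that all of them have this structure. Whitening
  comes before sketching because the second moment of the error is bounded by a product of squared
  Frobenius norms. For \<open>A W\<close> and \<open>B W'\<close> these are statistical dimensions,
  so \<open>n\<close>, \<open>d\<close> and \<open>d'\<close> do not enter. The tolerance
  \<epsilon>/4 comes from the final error budget. Renormalizing from one form to the other costs at
  most a factor 4/3, so correlations move by at most 2\<epsilon>/3, exchanging \<open>A^T B\<close>
  for its sketch costs \<epsilon>/3, and the sum is \<epsilon>.\<close>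

lemma scalar_prod_self: "x \<bullet> x = (\<Sum>i<dim_vec x. (x $ i)\<^sup>2)" for x :: "real Matrix.vec"
  by (simp add: scalar_prod_def power2_eq_square lessThan_atLeast0)

lemma scalar_prod_self_nonneg [simp]: "0 \<le> x \<bullet> x" for x :: "real Matrix.vec"
  by (simp add: scalar_prod_self sum_nonneg)

lemma scalar_prod_self_eq_0:
  fixes x :: "real Matrix.vec"
  assumes "x \<in> carrier_vec n"
  shows "x \<bullet> x = 0 \<longleftrightarrow> x = 0\<^sub>v n"
  using assms by (auto simp: scalar_prod_self sum_nonneg_eq_0_iff intro!: eq_vecI)

lemma scalar_prod_self_diff:
  fixes x y :: "real Matrix.vec"
  assumes "x \<in> carrier_vec n" "y \<in> carrier_vec n"
  shows "(x - y) \<bullet> (x - y) = x \<bullet> x - 2 * (x \<bullet> y) + y \<bullet> y"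
  using assms comm_scalar_prod[OF assms]
  by (simp add: minus_scalar_prod_distrib[of _ n] scalar_prod_minus_distrib[of _ n])

lemma scalar_prod_le_mean:
  fixes x y :: "real Matrix.vec"
  assumes "x \<in> carrier_vec n" "y \<in> carrier_vec n"
  shows "x \<bullet> y \<le> (x \<bullet> x + y \<bullet> y) / 2"
  using scalar_prod_self_nonneg[of "x - y"] unfolding scalar_prod_self_diff[OF assms] by simp

text \<open>Padding with zero rows gives a square matrix whose last row vanishes because
  \<open>k < n\<close>. Its transpose kills a unit vector, so the determinant is 0 and there is a
  kernel vector. The dimension counts below rest on this.\<close>

lemma homogeneous_system_nontrivial:
  fixes M :: "'a::field mat"
  assumes M: "M \<in> carrier_mat k n" and "k < n"
  shows "\<exists>c\<in>carrier_vec n. c \<noteq> 0\<^sub>v n \<and> M *\<^sub>v c = 0\<^sub>v k"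
proof -
  define N where "N = Matrix.mat n n (\<lambda>(i, j). if i < k then M $$ (i, j) else 0)"
  have N: "N \<in> carrier_mat n n" by (simp add: N_def)
  have "transpose_mat N *\<^sub>v unit_vec n (n - 1) = 0\<^sub>v n"
  proof (rule eq_vecI)
    fix i assume "i < dim_vec (0\<^sub>v n :: 'a Matrix.vec)"
    then have i: "i < n" by simp
    have "(transpose_mat N *\<^sub>v unit_vec n (n - 1)) $ i = col N i \<bullet> unit_vec n (n - 1)"
      using i N by simp
    also have "\<dots> = 0" using i \<open>k < n\<close> N by (simp add: N_def)
    finally show "(transpose_mat N *\<^sub>v unit_vec n (n - 1)) $ i = (0\<^sub>v n :: 'a Matrix.vec) $ i" using i by simp
  qed (use N in auto)
  moreover have "unit_vec n (n - 1) \<noteq> (0\<^sub>v n :: 'a Matrix.vec)"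
    using \<open>k < n\<close> by (auto dest!: arg_cong[where f = "\<lambda>v. v $ (n - 1)"])
  ultimately have "Determinant.det (transpose_mat N) = 0"
    by (subst det_0_iff_vec_prod_zero_field[of _ n])
       (use N in \<open>auto intro!: exI[of _ "unit_vec n (n - 1)"]\<close>)
  then have "Determinant.det N = 0" using det_transpose[OF N] by simp
  then obtain c where c: "c \<in> carrier_vec n" "c \<noteq> 0\<^sub>v n" "N *\<^sub>v c = 0\<^sub>v n"
    using det_0_iff_vec_prod_zero_field[OF N] by auto
  have "M *\<^sub>v c = 0\<^sub>v k"
  proof (rule eq_vecI)
    fix i assume "i < dim_vec (0\<^sub>v k :: 'a Matrix.vec)"
    then have i: "i < k" "i < n" using \<open>k < n\<close> by auto
    have "Matrix.row M i = Matrix.row N i"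
      using i M by (auto simp: N_def intro!: eq_vecI)
    then have "(M *\<^sub>v c) $ i = (N *\<^sub>v c) $ i" using i M N by simp
    then show "(M *\<^sub>v c) $ i = (0\<^sub>v k :: 'a Matrix.vec) $ i" using c i by simp
  qed (use M in auto)
  then show ?thesis using c by blast
qed

text \<open>Only the values below \<open>k\<close> matter, so a family grows by function update and
  is shortened by decreasing \<open>k\<close>.\<close>

definition orthonormal :: "nat \<Rightarrow> nat \<Rightarrow> (nat \<Rightarrow> real Matrix.vec) \<Rightarrow> bool" where
  "orthonormal n k f \<longleftrightarrow>
     (\<forall>i<k. f i \<in> carrier_vec n) \<and> (\<forall>i<k. \<forall>j<k. f i \<bullet> f j = (if i = j then 1 else 0))"

text \<open>The \<open>k\<close> orthogonality conditions are fewer equations than the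
  \<open>n\<close> unknowns; a nonzero solution is normalized.\<close>

lemma exists_unit_vec_orthogonal:
  assumes f: "\<And>i. i < k \<Longrightarrow> f i \<in> carrier_vec n" and "k < n"
  shows "\<exists>x\<in>carrier_vec n. x \<bullet> x = (1::real) \<and> (\<forall>i<k. f i \<bullet> x = 0)"
proof -
  define M where "M = mat_of_rows n (map f [0..<k])"
  have M: "M \<in> carrier_mat k n" unfolding M_def by (intro carrier_matI) auto
  obtain c where c: "c \<in> carrier_vec n" "c \<noteq> 0\<^sub>v n" "M *\<^sub>v c = 0\<^sub>v k"
    using homogeneous_system_nontrivial[OF M \<open>k < n\<close>] by blast
  have orth: "f i \<bullet> c = 0" if "i < k" for i
  proof -
    have "f i \<bullet> c = (M *\<^sub>v c) $ i" using that M f by (simp add: M_def)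
    then show ?thesis using c(3) that by simp
  qed
  define x where "x = (1 / sqrt (c \<bullet> c)) \<cdot>\<^sub>v c"
  have "c \<bullet> c > 0" using scalar_prod_self_eq_0[OF c(1)] c(2) scalar_prod_self_nonneg[of c] by linarith
  then have "x \<bullet> x = 1" using c(1) by (simp add: x_def)
  moreover have "f i \<bullet> x = 0" if "i < k" for i
    using orth[OF that] c(1) f[OF that] by (simp add: x_def)
  moreover have "x \<in> carrier_vec n" using c(1) by (simp add: x_def)
  ultimately show ?thesis by blast
qed

lemma orthonormal_Suc:
  assumes "orthonormal n k f" "x \<in> carrier_vec n" "x \<bullet> x = 1" "\<And>i. i < k \<Longrightarrow> f i \<bullet> x = 0"
  shows "orthonormal n (Suc k) (f(k := x))"
proof -
  have "x \<bullet> f i = 0" if "i < k" for i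
    using assms that comm_scalar_prod[of x n "f i"] by (simp add: orthonormal_def)
  then show ?thesis using assms by (auto simp: orthonormal_def less_Suc_eq)
qed

text \<open>The induction runs downwards from \<open>n\<close>: an incomplete family gains a unit
  vector orthogonal to it.\<close>

lemma orthonormal_extend:
  assumes "orthonormal n k f" "k \<le> n"
  shows "\<exists>g. (\<forall>i<k. g i = f i) \<and> orthonormal n n g"
  using assms(2,1)
proof (induction k arbitrary: f rule: inc_induct)
  case base
  then show ?case by blast
next
  case (step k)
  obtain x where x: "x \<in> carrier_vec n" "x \<bullet> x = 1" "\<forall>i<k. f i \<bullet> x = 0"
    using exists_unit_vec_orthogonal[of k f n] step by (auto simp: orthonormal_def)
  have "orthonormal n (Suc k) (f(k := x))" using orthonormal_Suc[OF step.prems x(1,2)] x(3) by blast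
  from step.IH[OF this] obtain g where "\<forall>i<Suc k. g i = (f(k := x)) i" "orthonormal n n g" by blast
  then show ?case by (intro exI[of _ g]) auto
qed

lemma orthonormal_mat_of_cols:
  assumes "orthonormal n k f"
  defines "Q \<equiv> mat_of_cols n (map f [0..<k])"
  shows "Q \<in> carrier_mat n k" "\<And>i. i < k \<Longrightarrow> col Q i = f i" "transpose_mat Q * Q = 1\<^sub>m k"
proof -
  show Q: "Q \<in> carrier_mat n k" unfolding Q_def by (intro carrier_matI) auto
  show c: "col Q i = f i" if "i < k" for i
    unfolding Q_def using that assms(1) by (subst col_mat_of_cols) (auto simp: orthonormal_def)
  show "transpose_mat Q * Q = 1\<^sub>m k"
    by (rule eq_matI) (use Q assms(1) in \<open>auto simp: c orthonormal_def\<close>)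
qed

text \<open>The transpose of a square matrix with orthonormal columns is also its right inverse, so
  a vector is recovered from its coordinates.\<close>

lemma orthonormal_basis_eq_0:
  assumes "orthonormal n n f" "x \<in> carrier_vec n" "\<And>i. i < n \<Longrightarrow> f i \<bullet> x = 0"
  shows "x = 0\<^sub>v n"
proof -
  define Q where "Q = mat_of_cols n (map f [0..<n])"
  note Q = orthonormal_mat_of_cols[OF assms(1), folded Q_def]
  have "transpose_mat Q *\<^sub>v x = 0\<^sub>v n"
    by (rule eq_vecI) (use Q assms in auto)
  moreover have "Q * transpose_mat Q = 1\<^sub>m n"
    using mat_mult_left_right_inverse[of "transpose_mat Q" n Q] Q by simp
  ultimately have "x = Q *\<^sub>v 0\<^sub>v n"
    using assoc_mult_mat_vec[of Q n n "transpose_mat Q" n x] Q(1) assms(2) by simp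
  then show ?thesis using Q(1) by (auto intro!: eq_vecI)
qed

lemma orthonormal_basis_eqI:
  assumes "orthonormal n n f" "x \<in> carrier_vec n" "y \<in> carrier_vec n"
    and "\<And>i. i < n \<Longrightarrow> f i \<bullet> x = f i \<bullet> y"
  shows "x = y"
proof -
  have "x - y = 0\<^sub>v n"
    by (rule orthonormal_basis_eq_0[OF assms(1)])
       (use assms in \<open>auto simp: scalar_prod_minus_distrib orthonormal_def\<close>)
  then show ?thesis using assms(2,3)
    by (intro eq_vecI) (auto dest!: arg_cong[where f = "\<lambda>v. v $ _"] simp: vec_eq_iff)
qed

lemma symmetric_form_commute:
  fixes P :: "real mat"
  assumes "P \<in> carrier_mat n n" "transpose_mat P = P" "x \<in> carrier_vec n" "y \<in> carrier_vec n"
  shows "x \<bullet> (P *\<^sub>v y) = y \<bullet> (P *\<^sub>v x)"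
  using transpose_vec_mult_scalar[OF assms(1,4,3)] assms comm_scalar_prod[of y n "P *\<^sub>v x"] by simp

text \<open>Over the complex numbers an eigenvalue exists. It is real because the matrix is real and
  symmetric, and since the characteristic polynomial is the same over both fields, it is an
  eigenvalue over the reals.\<close>

lemma symmetric_real_eigenvalue:
  fixes P :: "real mat"
  assumes P: "P \<in> carrier_mat n n" and sym: "transpose_mat P = P" and "0 < n"
  shows "\<exists>e. eigenvalue P e"
proof -
  define Q where "Q = map_mat complex_of_real P"
  have Q: "Q \<in> carrier_mat n n" using P by (simp add: Q_def)
  have Qsym: "transpose_mat Q = Q" using sym by (simp add: Q_def map_mat_transpose)
  obtain z where z: "eigenvalue Q z" using spectrum_non_empty[OF Q \<open>0 < n\<close>] by (auto simp: spectrum_def)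
  then obtain w where w: "w \<in> carrier_vec n" "w \<noteq> 0\<^sub>v n" "Q *\<^sub>v w = z \<cdot>\<^sub>v w"
    using Q by (auto simp: eigenvalue_def eigenvector_def)
  have cw: "conjugate w \<in> carrier_vec n" using w by simp
  have conj: "Q *\<^sub>v conjugate w = cnj z \<cdot>\<^sub>v conjugate w"
  proof -
    have "(Q *\<^sub>v conjugate w) $ i = cnj ((Q *\<^sub>v w) $ i)" if "i < n" for i
      using that P w(1) by (simp add: scalar_prod_def Q_def)
    then have "Q *\<^sub>v conjugate w = conjugate (Q *\<^sub>v w)"
      by (intro eq_vecI) (use Q w(1) in \<open>auto simp del: index_mult_mat_vec\<close>)
    then show ?thesis using w by (simp add: conjugate_smult_vec)
  qed
  \<comment> \<open>Letting the symmetric \<open>Q\<close> act on either factor of this product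
    yields the conjugate of \<open>z\<close> and \<open>z\<close> as multipliers of the same nonzero
    number.\<close>
  have "cnj z * (w \<bullet>c w) = w \<bullet> (Q *\<^sub>v conjugate w)" using w cw by (simp add: conj)
  also have "\<dots> = (Q *\<^sub>v w) \<bullet> conjugate w"
    using transpose_vec_mult_scalar[OF Q cw w(1)] Qsym by simp
  also have "\<dots> = z * (w \<bullet>c w)" using w cw by simp
  finally have "cnj z = z" using w conjugate_square_eq_0_vec[of w n] by simp
  then have zr: "z = complex_of_real (Re z)" by (simp add: complex_eq_iff)
  have "poly (map_poly complex_of_real (char_poly P)) (complex_of_real (Re z)) = 0"
    unfolding zr[symmetric]
    using z eigenvalue_root_char_poly[OF Q] by (simp add: Q_def of_real_hom.char_poly_hom[OF P])
  then have "poly (char_poly P) (Re z) = 0" by simp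
  then show ?thesis using eigenvalue_root_char_poly[OF P] by blast
qed

text \<open>Deflation: the eigenvectors found so far are completed to a basis, \<open>P\<close> is
  compressed by \<open>Z\<close> to the complement, and an eigenvector \<open>y\<close> of the
  smaller symmetric matrix \<open>R\<close> is lifted to \<open>Z *\<^sub>v y\<close>.\<close>

lemma real_symmetric_eigenvectors:
  fixes P :: "real mat"
  assumes P: "P \<in> carrier_mat n n" and sym: "transpose_mat P = P" and "k \<le> n"
  shows "\<exists>f e. orthonormal n k f \<and> (\<forall>i<k. P *\<^sub>v f i = e i \<cdot>\<^sub>v f i)"
  using \<open>k \<le> n\<close>
proof (induction k)
  case 0
  then show ?case by (auto simp: orthonormal_def)
next
  case (Suc k)
  then obtain f e where f: "orthonormal n k f" and Pf: "\<And>i. i < k \<Longrightarrow> P *\<^sub>v f i = e i \<cdot>\<^sub>v f i" by auto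
  obtain g where gf: "\<And>i. i < k \<Longrightarrow> g i = f i" and g: "orthonormal n n g"
    using orthonormal_extend[OF f] Suc.prems by auto
  define h where "h i = g (k + i)" for i
  define l where "l = n - k"
  have h: "orthonormal n l h" using g Suc.prems by (auto simp: orthonormal_def h_def l_def)
  define Z where "Z = mat_of_cols n (map h [0..<l])"
  note Z = orthonormal_mat_of_cols[OF h, folded Z_def]
  define R where "R = transpose_mat Z * P * Z"
  have R: "R \<in> carrier_mat l l" using Z P by (simp add: R_def)
  have "transpose_mat R = R"
    using Z(1) P sym transpose_mult[OF P Z(1)] transpose_mult[of "transpose_mat Z" l n "P * Z" l]
    by (simp add: R_def assoc_mult_mat[of _ l n _ n _ l])
  moreover have "0 < l" using Suc.prems by (simp add: l_def)
  ultimately obtain t y where y: "y \<in> carrier_vec l" "y \<noteq> 0\<^sub>v l" "R *\<^sub>v y = t \<cdot>\<^sub>v y"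
    using symmetric_real_eigenvalue[OF R] R by (auto simp: eigenvalue_def eigenvector_def)
  define x where "x = (1 / sqrt (y \<bullet> y)) \<cdot>\<^sub>v (Z *\<^sub>v y)"
  have x: "x \<in> carrier_vec n" using Z y by (simp add: x_def)
  have yy: "y \<bullet> y > 0" using scalar_prod_self_eq_0[OF y(1)] y(2) scalar_prod_self_nonneg[of y] by linarith
  have Zy: "Z *\<^sub>v y \<in> carrier_vec n" using Z y by simp
  have ZZy: "transpose_mat Z *\<^sub>v (Z *\<^sub>v y) = y"
    using Z y assoc_mult_mat_vec[of "transpose_mat Z" l n Z l y] by simp
  have "(Z *\<^sub>v y) \<bullet> (Z *\<^sub>v y) = y \<bullet> y"
    using transpose_vec_mult_scalar[OF Z(1) y(1) Zy] ZZy by simp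
  then have xx: "x \<bullet> x = 1" using yy Zy by (simp add: x_def)
  have gZy1: "g i \<bullet> (Z *\<^sub>v y) = 0" if "i < k" for i
  proof -
    have gi: "g i \<in> carrier_vec n" using that g Suc.prems by (simp add: orthonormal_def)
    have "transpose_mat Z *\<^sub>v g i = 0\<^sub>v l"
      by (rule eq_vecI) (use that Z g Suc.prems in \<open>auto simp: h_def orthonormal_def l_def\<close>)
    then show ?thesis using transpose_vec_mult_scalar[OF Z(1) y(1) gi] y by simp
  qed
  \<comment> \<open>Both sides are tested against the basis. Against the old eigenvectors they
    vanish, because a symmetric matrix preserves the complement of an invariant subspace; against
    the remaining directions the equation is the one for \<open>R\<close>.\<close>
  have PZy: "P *\<^sub>v (Z *\<^sub>v y) = t \<cdot>\<^sub>v (Z *\<^sub>v y)"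
  proof (rule orthonormal_basis_eqI[OF g])
    fix i assume i: "i < n"
    have gi: "g i \<in> carrier_vec n" using i g by (simp add: orthonormal_def)
    show "g i \<bullet> (P *\<^sub>v (Z *\<^sub>v y)) = g i \<bullet> (t \<cdot>\<^sub>v (Z *\<^sub>v y))"
    proof (cases "i < k")
      case True
      then have "g i \<bullet> (P *\<^sub>v (Z *\<^sub>v y)) = (Z *\<^sub>v y) \<bullet> (e i \<cdot>\<^sub>v g i)"
        using symmetric_form_commute[OF P sym gi Zy] Pf[OF True] gf[OF True] by simp
      also have "\<dots> = 0" using gZy1[OF True] comm_scalar_prod[OF gi Zy] gi Zy by simp
      finally show ?thesis using gZy1[OF True] gi Zy by simp
    next
      case False
      define j where "j = i - k"
      have j: "j < l" "g i = col Z j" using False i Z by (auto simp: j_def l_def h_def)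
      have *: "g i \<bullet> v = (transpose_mat Z *\<^sub>v v) $ j" for v using j Z(1) by simp
      have "transpose_mat Z *\<^sub>v (P *\<^sub>v (Z *\<^sub>v y)) = R *\<^sub>v y"
        using Z(1) P y(1) by (simp add: R_def assoc_mult_mat_vec[of _ l n _ l] assoc_mult_mat_vec[of _ l n _ n])
      moreover have "transpose_mat Z *\<^sub>v (t \<cdot>\<^sub>v (Z *\<^sub>v y)) = t \<cdot>\<^sub>v y"
        using Z(1) Zy ZZy by (simp add: mult_mat_vec[of _ l n])
      ultimately show ?thesis unfolding * using y by simp
    qed
  qed (use P Zy in auto)
  have Px: "P *\<^sub>v x = t \<cdot>\<^sub>v x"
    using P Zy PZy by (simp add: x_def mult_mat_vec[of _ n n] smult_smult_assoc mult.commute)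
  have "orthonormal n (Suc k) (f(k := x))"
    by (rule orthonormal_Suc[OF f x xx])
       (use gZy1 gf f Zy in \<open>auto simp: x_def orthonormal_def\<close>)
  moreover have "\<forall>i<Suc k. P *\<^sub>v (f(k := x)) i = (e(k := t)) i \<cdot>\<^sub>v (f(k := x)) i"
    using Pf Px by (auto simp: less_Suc_eq)
  ultimately show ?case by blast
qed

section \<open>Ordered eigenbases and the statistical dimension\<close>

lemma exists_sorting_bij:
  fixes e :: "nat \<Rightarrow> real"
  shows "\<exists>p. bij_betw p {..<n} {..<n} \<and> (\<forall>i j. i \<le> j \<longrightarrow> j < n \<longrightarrow> e (p j) \<le> e (p i))"
proof -
  define xs where "xs = sort_key (\<lambda>i. - e i) [0..<n]"
  have xs: "distinct xs" "length xs = n" "set xs = {..<n}" by (auto simp: xs_def)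
  have "bij_betw ((!) xs) {..<n} {..<n}" using bij_betw_nth[OF xs(1)] xs by simp
  moreover have "sorted (map (\<lambda>i. - e i) xs)" by (simp add: xs_def)
  then have "e (xs ! j) \<le> e (xs ! i)" if "i \<le> j" "j < n" for i j
    using that xs(2) by (auto simp: sorted_iff_nth_mono)
  ultimately show ?thesis by blast
qed

lemma real_symmetric_eigenbasis:
  fixes P :: "real mat"
  assumes P: "P \<in> carrier_mat n n" and sym: "transpose_mat P = P"
  obtains f e where "orthonormal n n f" "\<And>i. i < n \<Longrightarrow> P *\<^sub>v f i = e i \<cdot>\<^sub>v f i"
    "\<And>i j. i \<le> j \<Longrightarrow> j < n \<Longrightarrow> e j \<le> e i"
proof -
  obtain f e where f: "orthonormal n n f" "\<And>i. i < n \<Longrightarrow> P *\<^sub>v f i = e i \<cdot>\<^sub>v f i"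
    using real_symmetric_eigenvectors[OF P sym order.refl] by auto
  obtain p where p: "bij_betw p {..<n} {..<n}" "\<And>i j. i \<le> j \<Longrightarrow> j < n \<Longrightarrow> e (p j) \<le> e (p i)"
    using exists_sorting_bij[of n e] by blast
  have lt: "p i < n" if "i < n" for i using p(1) that by (auto simp: bij_betw_def)
  have inj: "p i = p j \<longleftrightarrow> i = j" if "i < n" "j < n" for i j
    using p(1) that by (auto simp: bij_betw_def dest: inj_onD)
  have "orthonormal n n (f \<circ> p)" using f(1) lt inj by (auto simp: orthonormal_def)
  then show thesis using f(2) p(2) lt by (intro that[of "f \<circ> p" "e \<circ> p"]) auto
qed

text \<open>\<open>singular_values\<close> is defined by roots of a characteristic polynomial.
  Similarity to a diagonal matrix identifies these roots, with multiplicity, with the eigenvalues of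
  an orthonormal eigenbasis.\<close>

lemma char_poly_eigenbasis:
  assumes P: "P \<in> carrier_mat n n" and f: "orthonormal n n f"
    and e: "\<And>i. i < n \<Longrightarrow> P *\<^sub>v f i = e i \<cdot>\<^sub>v f i"
  shows "char_poly P = (\<Prod>i\<leftarrow>[0..<n]. [:- e i, 1:])"
proof -
  define Q where "Q = mat_of_cols n (map f [0..<n])"
  note Q = orthonormal_mat_of_cols[OF f, folded Q_def]
  define D where "D = mat_diag n e"
  have D: "D \<in> carrier_mat n n" by (simp add: D_def mat_diag_dim)
  have PQ: "P * Q = Q * D"
  proof (rule eq_matI)
    fix i j assume "i < dim_row (Q * D)" "j < dim_col (Q * D)"
    then have ij: "i < n" "j < n" using Q D by auto
    have "(P * Q) $$ (i, j) = (P *\<^sub>v f j) $ i" using ij P Q by simp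
    also have "\<dots> = e j * f j $ i"
      using f ij by (subst e[OF ij(2)]) (auto simp: orthonormal_def)
    also have "f j $ i = Q $$ (i, j)" using Q(1) Q(2)[OF ij(2)] ij by (metis carrier_matD index_col)
    finally show "(P * Q) $$ (i, j) = (Q * D) $$ (i, j)"
      using ij Q(1) by (simp add: D_def mat_diag_mult_right)
  qed (use P Q D in auto)
  have QQ: "Q * transpose_mat Q = 1\<^sub>m n"
    using mat_mult_left_right_inverse[of "transpose_mat Q" n Q] Q by simp
  have "P = P * (Q * transpose_mat Q)" using P QQ by simp
  also have "\<dots> = Q * D * transpose_mat Q"
    using P Q D PQ assoc_mult_mat[of P n n Q n "transpose_mat Q" n] by simp
  finally have "similar_mat_wit P D Q (transpose_mat Q)"
    using P Q D QQ by (intro similar_mat_witI[of _ _ n]) auto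
  then have "similar_mat P D" unfolding similar_mat_def by blast
  then have "char_poly P = char_poly D" by (rule char_poly_similar)
  also have "\<dots> = (\<Prod>a\<leftarrow>diag_mat D. [:- a, 1:])"
    by (rule char_poly_upper_triangular[OF D]) (auto simp: D_def mat_diag_def)
  also have "diag_mat D = map e [0..<n]"
    by (auto simp: diag_mat_def D_def mat_diag_def intro!: map_cong)
  finally show ?thesis by (simp add: o_def)
qed

text \<open>With \<open>e i\<close> the squared singular value, \<open>1 / (1 + lam / e i)\<close>
  equals \<open>e i / (e i + lam)\<close>. In the second form a vanishing singular value contributes
  0, even if \<open>lam = 0\<close>, where the quotient is 0 by the convention for division by
  zero.\<close>

lemma stat_dim_eigenbasis:
  assumes A: "A \<in> carrier_mat k n" and f: "orthonormal n n f"
    and e: "\<And>i. i < n \<Longrightarrow> (transpose_mat A * A) *\<^sub>v f i = e i \<cdot>\<^sub>v f i"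
    and pos: "\<And>i. i < n \<Longrightarrow> 0 \<le> e i" and "0 \<le> lam"
  shows "stat_dim lam A = (\<Sum>i<n. e i / (e i + lam))"
proof -
  have P: "transpose_mat A * A \<in> carrier_mat n n" using A by simp
  have cp: "char_poly (transpose_mat A * A) = (\<Prod>i\<leftarrow>[0..<n]. [:- e i, 1:])"
    by (rule char_poly_eigenbasis[OF P f]) (use e in auto)
  have "proots (char_poly (transpose_mat A * A)) = (\<Sum>i\<leftarrow>[0..<n]. {#e i#})"
    unfolding cp
  proof (induction n)
    case (Suc n)
    have "(\<Prod>i\<leftarrow>[0..<n]. [:- e i, 1:]) \<noteq> 0" by (auto simp: prod_list_zero_iff)
    moreover have "(\<Prod>i\<leftarrow>[0..<Suc n]. [:- e i, 1:]) = (\<Prod>i\<leftarrow>[0..<n]. [:- e i, 1:]) * [:- e n, 1:]"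
      by (simp del: mult_pCons_right)
    moreover have "proots ((\<Prod>i\<leftarrow>[0..<n]. [:- e i, 1:]) * [:- e n, 1:])
        = proots (\<Prod>i\<leftarrow>[0..<n]. [:- e i, 1:]) + {#e n#}"
      using calculation(1) by (subst proots_mult) (auto simp: proots_linear_factor)
    ultimately show ?case using Suc by simp
  qed simp
  also have "\<dots> = mset (map e [0..<n])" by (induction n) auto
  finally have sv: "singular_values A = mset (map (\<lambda>i. sqrt (e i)) [0..<n])"
    by (simp add: singular_values_def mset_map[symmetric] o_def del: mset_map)
  have "stat_dim lam A = (\<Sum>i\<leftarrow>[0..<n]. if sqrt (e i) \<noteq> 0 then 1 / (1 + lam / (sqrt (e i))\<^sup>2) else 0)"
    unfolding stat_dim_def sv mset_filter[symmetric] sum_mset_sum_list[symmetric]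
    by (simp add: sum_list_map_filter' filter_map o_def sum_mset_sum_list mset_map[symmetric] del: mset_map)
  also have "\<dots> = (\<Sum>i<n. if sqrt (e i) \<noteq> 0 then 1 / (1 + lam / (sqrt (e i))\<^sup>2) else 0)"
    by (simp add: sum_list_distinct_conv_sum_set lessThan_atLeast0)
  also have "\<dots> = (\<Sum>i<n. e i / (e i + lam))"
    by (rule sum.cong) (use pos \<open>0 \<le> lam\<close> in \<open>auto simp: field_simps\<close>)
  finally show ?thesis .
qed

section \<open>Rank, whitening and singular values\<close>

lemma mat_mult_vec_zero_iff_cols:
  fixes K :: "real mat"
  assumes "K \<in> carrier_mat n k"
  shows "transpose_mat K *\<^sub>v x = 0\<^sub>v k \<longleftrightarrow> (\<forall>v\<in>set (cols K). v \<bullet> x = 0)"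
proof -
  have "transpose_mat K *\<^sub>v x = 0\<^sub>v k \<longleftrightarrow> (\<forall>j<k. col K j \<bullet> x = 0)"
    using assms by (auto simp: vec_eq_iff)
  then show ?thesis using assms by (auto simp: cols_def)
qed

text \<open>A maximal independent set of columns forms a matrix with trivial kernel whose columns
  impose the same orthogonality conditions as all columns of \<open>A\<close>. This turns rank
  computations into counts of equations and unknowns.\<close>

lemma mat_rank_spanning_cols:
  assumes A: "A \<in> carrier_mat n nc"
  shows "\<exists>K\<in>carrier_mat n (mat_rank A).
           (\<forall>c\<in>carrier_vec (mat_rank A). K *\<^sub>v c = 0\<^sub>v n \<longrightarrow> c = 0\<^sub>v (mat_rank A)) \<and>
           set (cols K) \<subseteq> set (cols A) \<and>
           (\<forall>x\<in>carrier_vec n. (\<forall>v\<in>set (cols K). v \<bullet> x = 0) \<longrightarrow> (\<forall>v\<in>set (cols A). v \<bullet> x = 0))"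
proof -
  interpret vec_space "TYPE(real)" n .
  have "\<exists>S. finite S \<and> maximal S (\<lambda>T. T \<subseteq> set (cols A) \<and> lin_indpt T) \<and> {} \<subseteq> S"
    by (rule maximal_exists_superset[of "set (cols A)"]) (auto simp: lin_dep_def)
  then obtain S where S: "finite S" "maximal S (\<lambda>T. T \<subseteq> set (cols A) \<and> lin_indpt T)" by blast
  have Sc: "S \<subseteq> set (cols A)" and Si: "lin_indpt S" using S(2) by (auto simp: maximal_def)
  have Ac: "set (cols A) \<subseteq> carrier_vec n" using A cols_dim by blast
  have SV: "S \<subseteq> carrier_vec n" using Sc Ac by auto
  have rk: "mat_rank A = card S" using rank_card_indpt[OF A S(2)] A by (simp add: mat_rank_def)
  obtain vs where vs: "distinct vs" "set vs = S" using finite_distinct_list[OF S(1)] by blast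
  have len: "length vs = mat_rank A" using vs rk distinct_card by fastforce
  define K where "K = mat_of_cols n vs"
  have K: "K \<in> carrier_mat n (mat_rank A)" unfolding K_def using len by (intro carrier_matI) auto
  have colsK: "cols K = vs" unfolding K_def using vs Sc Ac by (intro cols_mat_of_cols) auto
  have inj: "c = 0\<^sub>v (mat_rank A)" if "c \<in> carrier_vec (mat_rank A)" "K *\<^sub>v c = 0\<^sub>v n" for c
    using lin_depI[OF K that(1) _ that(2)] Si colsK vs by auto
  have span: "v \<bullet> x = 0"
    if x: "x \<in> carrier_vec n" "\<forall>v\<in>set (cols K). v \<bullet> x = 0" and v: "v \<in> set (cols A)" for x v
  proof -
    have "v \<in> span S"
    proof (rule ccontr)
      assume nv: "v \<notin> span S"
      then have "v \<notin> S" using span_mem[OF SV] by blast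
      moreover have "lin_indpt (S \<union> {v})"
        using lin_dep_iff_in_span[OF SV Si _ \<open>v \<notin> S\<close>] nv Ac v by auto
      moreover have "S \<union> {v} \<subseteq> set (cols A)" "S \<subseteq> S \<union> {v}" using v Sc by auto
      ultimately show False using S(2) unfolding maximal_def by blast
    qed
    then obtain a where "v = lincomb a S" using finite_in_span[OF S(1)] Sc Ac by auto
    then have "v = K *\<^sub>v Matrix.vec (mat_rank A) (\<lambda>i. a (col K i))"
      using mat_mult_eq_lincomb[OF K, of a] colsK vs by simp
    moreover have "transpose_mat K *\<^sub>v x = 0\<^sub>v (mat_rank A)"
      using mat_mult_vec_zero_iff_cols[OF K] x by blast
    ultimately show ?thesis
      using transpose_vec_mult_scalar[OF K, of "Matrix.vec (mat_rank A) (\<lambda>i. a (col K i))" x] x(1) K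
        comm_scalar_prod[of x n v] by simp
  qed
  show ?thesis using K inj colsK vs(2) Sc span by blast
qed

text \<open>Both strict inequalities fail by a dimension count. If \<open>r < k\<close>, a
  nontrivial combination of the independent columns is orthogonal to the first \<open>r\<close>
  eigenvectors, and to the others because \<open>P\<close> kills them, so it is 0. If
  \<open>k < r\<close>, a nonzero combination of the first \<open>r\<close> eigenvectors lies in the
  kernel of \<open>P\<close>.\<close>

lemma mat_rank_eigenbasis:
  fixes P :: "real mat"
  assumes P: "P \<in> carrier_mat n n" and sym: "transpose_mat P = P" and f: "orthonormal n n f"
    and e: "\<And>i. i < n \<Longrightarrow> P *\<^sub>v f i = e i \<cdot>\<^sub>v f i" and "r \<le> n"
    and nz: "\<And>i. i < r \<Longrightarrow> e i \<noteq> 0" and z: "\<And>i. r \<le> i \<Longrightarrow> i < n \<Longrightarrow> e i = 0"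
  shows "mat_rank P = r"
proof -
  define k where "k = mat_rank P"
  obtain K where K: "K \<in> carrier_mat n k"
    and inj: "\<And>c. c \<in> carrier_vec k \<Longrightarrow> K *\<^sub>v c = 0\<^sub>v n \<Longrightarrow> c = 0\<^sub>v k"
    and sub: "set (cols K) \<subseteq> set (cols P)"
    and span: "\<And>x. x \<in> carrier_vec n \<Longrightarrow> (\<forall>v\<in>set (cols K). v \<bullet> x = 0) \<Longrightarrow> (\<forall>v\<in>set (cols P). v \<bullet> x = 0)"
    using mat_rank_spanning_cols[OF P, folded k_def] by blast
  have fr: "orthonormal n r f" using f \<open>r \<le> n\<close> by (auto simp: orthonormal_def)
  have fc: "f i \<in> carrier_vec n" if "i < n" for i using f that by (simp add: orthonormal_def)
  define F where "F = mat_of_cols n (map f [0..<r])"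
  note F = orthonormal_mat_of_cols[OF fr, folded F_def]
  have "\<not> r < k"
  proof
    assume "r < k"
    then obtain c where c: "c \<in> carrier_vec k" "c \<noteq> 0\<^sub>v k" "(transpose_mat F * K) *\<^sub>v c = 0\<^sub>v r"
      using homogeneous_system_nontrivial[of "transpose_mat F * K" r k] F K by auto
    have Kc: "K *\<^sub>v c \<in> carrier_vec n" using K c by simp
    have "K *\<^sub>v c = 0\<^sub>v n"
    proof (rule orthonormal_basis_eq_0[OF f Kc])
      fix i assume i: "i < n"
      show "f i \<bullet> (K *\<^sub>v c) = 0"
      proof (cases "i < r")
        case True
        have "transpose_mat F *\<^sub>v (K *\<^sub>v c) = 0\<^sub>v r"
          using c F(1) K assoc_mult_mat_vec[of "transpose_mat F" r n K k c] by simp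
        then have "(transpose_mat F *\<^sub>v (K *\<^sub>v c)) $ i = 0" using True by simp
        then show ?thesis using True F(1,2) by simp
      next
        case False
        have "transpose_mat P *\<^sub>v f i = 0\<^sub>v n" using e[OF i] z[of i] False i sym fc[OF i] by auto
        then have "\<forall>v\<in>set (cols K). v \<bullet> f i = 0" using mat_mult_vec_zero_iff_cols[OF P] sub by blast
        then have "transpose_mat K *\<^sub>v f i = 0\<^sub>v k" using mat_mult_vec_zero_iff_cols[OF K] by blast
        then show ?thesis using transpose_vec_mult_scalar[OF K c(1) fc[OF i]] c(1) by simp
      qed
    qed
    then show False using inj c by blast
  qed
  moreover have "\<not> k < r"
  proof
    assume "k < r"
    then obtain c where c: "c \<in> carrier_vec r" "c \<noteq> 0\<^sub>v r" "(transpose_mat K * F) *\<^sub>v c = 0\<^sub>v k"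
      using homogeneous_system_nontrivial[of "transpose_mat K * F" k r] F K by auto
    define x where "x = F *\<^sub>v c"
    have x: "x \<in> carrier_vec n" using F c by (simp add: x_def)
    have "transpose_mat K *\<^sub>v x = 0\<^sub>v k"
      using c F(1) K assoc_mult_mat_vec[of "transpose_mat K" k n F r c] by (simp add: x_def)
    then have "transpose_mat P *\<^sub>v x = 0\<^sub>v n"
      using span[OF x] mat_mult_vec_zero_iff_cols[OF K] mat_mult_vec_zero_iff_cols[OF P] by blast
    then have Px: "P *\<^sub>v x = 0\<^sub>v n" using sym by simp
    have "f i \<bullet> x = 0" if "i < r" for i
    proof -
      have i: "i < n" using that \<open>r \<le> n\<close> by simp
      have "e i * (x \<bullet> f i) = x \<bullet> (P *\<^sub>v f i)" using e[OF i] x fc[OF i] by simp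
      also have "\<dots> = 0" using symmetric_form_commute[OF P sym x fc[OF i]] Px fc[OF i] by simp
      finally show ?thesis using nz[OF that] comm_scalar_prod[OF x fc[OF i]] by simp
    qed
    then have "transpose_mat F *\<^sub>v x = 0\<^sub>v r" using F(1,2) by (intro eq_vecI) auto
    moreover have "transpose_mat F *\<^sub>v x = c"
      using F c assoc_mult_mat_vec[of "transpose_mat F" r n F r c] by (simp add: x_def)
    ultimately show False using c by simp
  qed
  ultimately show ?thesis by (simp add: k_def)
qed

section \<open>Whitening of a regularized Gram matrix\<close>

lemma antimono_nonneg_cutoff:
  fixes e :: "nat \<Rightarrow> real"
  assumes "\<And>i j. i \<le> j \<Longrightarrow> j < n \<Longrightarrow> e j \<le> e i" "\<And>i. i < n \<Longrightarrow> 0 \<le> e i"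
  obtains r where "r \<le> n" "\<And>i. i < r \<Longrightarrow> 0 < e i" "\<And>i. r \<le> i \<Longrightarrow> i < n \<Longrightarrow> e i = 0"
proof -
  \<comment> \<open>The disjunct \<open>n \<le> i\<close> makes \<open>n\<close> the cutoff when no
    value below \<open>n\<close> vanishes.\<close>
  define r where "r = (LEAST i. n \<le> i \<or> e i = 0)"
  have r: "n \<le> r \<or> e r = 0" unfolding r_def by (rule LeastI[of _ n]) simp
  have "r \<le> n" unfolding r_def by (rule Least_le) simp
  moreover have "0 < e i" if "i < r" for i
    using not_less_Least[of i "\<lambda>i. n \<le> i \<or> e i = 0"] that assms(2)[of i] \<open>r \<le> n\<close> by (auto simp: r_def)
  moreover have "e i = 0" if "r \<le> i" "i < n" for i
    using r assms(1)[OF that] assms(2)[OF that(2)] that by auto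
  ultimately show thesis by (rule that)
qed

lemma mat_eqI_orthonormal_basis:
  fixes X :: "real mat"
  assumes f: "orthonormal n n f" and X: "X \<in> carrier_mat k n" "Y \<in> carrier_mat k n"
    and eq: "\<And>i. i < n \<Longrightarrow> X *\<^sub>v f i = Y *\<^sub>v f i"
  shows "X = Y"
proof -
  define Q where "Q = mat_of_cols n (map f [0..<n])"
  note Q = orthonormal_mat_of_cols[OF f, folded Q_def]
  have "X * Q = Y * Q"
  proof (rule eq_matI)
    fix i j assume "i < dim_row (Y * Q)" "j < dim_col (Y * Q)"
    then have ij: "i < k" "j < n" using X Q by auto
    have "(X * Q) $$ (i, j) = (X *\<^sub>v f j) $ i" using ij X Q by simp
    also have "\<dots> = (Y * Q) $$ (i, j)" unfolding eq[OF ij(2)] using ij X Q by simp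
    finally show "(X * Q) $$ (i, j) = (Y * Q) $$ (i, j)" .
  qed (use X in auto)
  then have "X * Q * transpose_mat Q = Y * Q * transpose_mat Q" by simp
  moreover have "Q * transpose_mat Q = 1\<^sub>m n"
    using mat_mult_left_right_inverse[of "transpose_mat Q" n Q] Q by simp
  ultimately show ?thesis using X Q(1) by (simp add: assoc_mult_mat[of _ k n Q n _ n])
qed

lemma reg_gram_carrier [simp]: "A \<in> carrier_mat n d \<Longrightarrow> reg_gram lam A \<in> carrier_mat d d"
  by (simp add: reg_gram_def)

lemma reg_gram_symmetric: "transpose_mat (reg_gram lam A) = reg_gram lam A"
  by (rule eq_matI) (auto simp: reg_gram_def intro!: comm_scalar_prod[of _ "dim_row A"])

lemma reg_gram_mult_vec:
  assumes A: "A \<in> carrier_mat n d" and x: "x \<in> carrier_vec d"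
  shows "reg_gram lam A *\<^sub>v x = transpose_mat A *\<^sub>v (A *\<^sub>v x) + lam \<cdot>\<^sub>v x"
proof -
  have "(lam \<cdot>\<^sub>m 1\<^sub>m d) *\<^sub>v x = lam \<cdot>\<^sub>v x" using x by (intro eq_vecI) auto
  moreover have "transpose_mat A * A \<in> carrier_mat d d" using A by simp
  ultimately show ?thesis
    using A x add_mult_distrib_mat_vec[of "transpose_mat A * A" d d "lam \<cdot>\<^sub>m 1\<^sub>m d" x]
      assoc_mult_mat_vec[of "transpose_mat A" d n A d x]
    by (simp add: reg_gram_def)
qed

lemma reg_gram_form:
  assumes A: "A \<in> carrier_mat n d" and x: "x \<in> carrier_vec d" and y: "y \<in> carrier_vec d"
  shows "x \<bullet> (reg_gram lam A *\<^sub>v y) = (A *\<^sub>v x) \<bullet> (A *\<^sub>v y) + lam * (x \<bullet> y)"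
proof -
  have "x \<bullet> (transpose_mat A *\<^sub>v (A *\<^sub>v y)) = (A *\<^sub>v y) \<bullet> (A *\<^sub>v x)"
    using transpose_vec_mult_scalar[OF A x, of "A *\<^sub>v y"] comm_scalar_prod[of x d] A x y by simp
  then show ?thesis using assms comm_scalar_prod[of "A *\<^sub>v x" n "A *\<^sub>v y"]
    by (simp add: reg_gram_mult_vec scalar_prod_add_distrib[of _ d])
qed

lemma mat_mult_unit_vec:
  fixes W :: "'a::semiring_1 mat"
  assumes "W \<in> carrier_mat n k" "i < k"
  shows "W *\<^sub>v unit_vec k i = col W i"
  using assms by (intro eq_vecI) auto

text \<open>\<open>W\<close> is a pseudoinverse square root of \<open>P\<close>: its columns are the
  eigenvectors with positive eigenvalue, scaled by \<open>1 / sqrt (e i)\<close>. Hence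
  \<open>W * (transpose_mat W * P)\<close> is the orthogonal projection onto their span. It changes
  neither \<open>A\<close> nor \<open>P\<close>, since both kill the discarded eigenvectors.\<close>

lemma whitening:
  assumes A: "A \<in> carrier_mat n d" and lam: "0 \<le> lam"
  defines "P \<equiv> reg_gram lam A"
  obtains W where "W \<in> carrier_mat d (mat_rank P)" "transpose_mat W * P * W = 1\<^sub>m (mat_rank P)"
    "A * (W * (transpose_mat W * P)) = A" "P * (W * (transpose_mat W * P)) = P"
    "(\<Sum>i<n. \<Sum>j<mat_rank P. ((A * W) $$ (i, j))\<^sup>2) = stat_dim lam A"
proof -
  have P: "P \<in> carrier_mat d d" and sym: "transpose_mat P = P"
    using A by (simp_all add: P_def reg_gram_symmetric)
  define B where "B = transpose_mat A * A"
  have B: "B \<in> carrier_mat d d" "transpose_mat B = B"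
    using A transpose_mult[of "transpose_mat A" d n A d] by (auto simp: B_def)
  obtain f \<mu> where f: "orthonormal d d f" and Bf: "\<And>i. i < d \<Longrightarrow> B *\<^sub>v f i = \<mu> i \<cdot>\<^sub>v f i"
    and mono: "\<And>i j. i \<le> j \<Longrightarrow> j < d \<Longrightarrow> \<mu> j \<le> \<mu> i"
    using real_symmetric_eigenbasis[OF B] by blast
  have fc: "f i \<in> carrier_vec d" and ff: "f i \<bullet> f i = 1" if "i < d" for i
    using f that by (auto simp: orthonormal_def)
  have Af: "(A *\<^sub>v f i) \<bullet> (A *\<^sub>v f i) = \<mu> i" if "i < d" for i
  proof -
    have "(A *\<^sub>v f i) \<bullet> (A *\<^sub>v f i) = (transpose_mat A *\<^sub>v (A *\<^sub>v f i)) \<bullet> f i"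
      using transpose_vec_mult_scalar[OF A fc[OF that], of "A *\<^sub>v f i"] A fc[OF that] by simp
    also have "transpose_mat A *\<^sub>v (A *\<^sub>v f i) = \<mu> i \<cdot>\<^sub>v f i"
      using Bf[OF that] assoc_mult_mat_vec[of "transpose_mat A" d n A d "f i"] A fc[OF that] by (simp add: B_def)
    finally show ?thesis using fc[OF that] ff[OF that] by simp
  qed
  have mu: "0 \<le> \<mu> i" if "i < d" for i using Af[OF that] scalar_prod_self_nonneg[of "A *\<^sub>v f i"] by simp
  \<comment> \<open>Regularizing shifts the eigenvalues of the Gram matrix and keeps its
    eigenvectors.\<close>
  define e where "e i = \<mu> i + lam" for i
  have Pf: "P *\<^sub>v f i = e i \<cdot>\<^sub>v f i" if "i < d" for i
    using Bf[OF that] A fc[OF that] assoc_mult_mat_vec[of "transpose_mat A" d n A d "f i"]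
    by (simp add: P_def reg_gram_mult_vec e_def B_def add_smult_distrib_vec)
  obtain r where r: "r \<le> d" "\<And>i. i < r \<Longrightarrow> 0 < e i" "\<And>i. r \<le> i \<Longrightarrow> i < d \<Longrightarrow> e i = 0"
    using antimono_nonneg_cutoff[of d e] mono mu lam by (auto simp: e_def)
  have rk: "mat_rank P = r" by (rule mat_rank_eigenbasis[OF P sym f Pf r(1)]) (use r in force)+
  define w where "w i = (1 / sqrt (e i)) \<cdot>\<^sub>v f i" for i
  define W where "W = mat_of_cols d (map w [0..<r])"
  have W: "W \<in> carrier_mat d r" unfolding W_def by (intro carrier_matI) auto
  have wc: "w i \<in> carrier_vec d" if "i < r" for i using fc[of i] that r(1) by (simp add: w_def)
  have colW: "col W i = w i" if "i < r" for i
    unfolding W_def using that wc by (subst col_mat_of_cols) auto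
  have wf: "w i \<bullet> f j = (if i = j then 1 / sqrt (e i) else 0)" if "i < r" "j < d" for i j
    using f that r(1) smult_scalar_prod_distrib[OF fc fc, of i j "1 / sqrt (e i)"]
    by (auto simp: w_def orthonormal_def)
  have WP: "transpose_mat W *\<^sub>v (P *\<^sub>v f i) = (if i < r then sqrt (e i) \<cdot>\<^sub>v unit_vec r i else 0\<^sub>v r)"
    if i: "i < d" for i
  proof (rule eq_vecI)
    fix j assume "j < dim_vec (if i < r then sqrt (e i) \<cdot>\<^sub>v unit_vec r i else 0\<^sub>v r)"
    then have j: "j < r" by (auto split: if_splits)
    have "(transpose_mat W *\<^sub>v (P *\<^sub>v f i)) $ j = w j \<bullet> (e i \<cdot>\<^sub>v f i)" using j W i by (simp add: Pf colW)
    also have "\<dots> = e i * (w j \<bullet> f i)" using wc[OF j] fc[OF i] by simp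
    also have "\<dots> = (if i < r then sqrt (e i) \<cdot>\<^sub>v unit_vec r i else 0\<^sub>v r) $ j"
      using j i r(2)[of i] r(3)[of i] wf[OF j i] by (auto simp: real_div_sqrt)
    finally show "(transpose_mat W *\<^sub>v (P *\<^sub>v f i)) $ j = \<dots>" .
  qed (use W in auto)
  define G where "G = W * (transpose_mat W * P)"
  have G: "G \<in> carrier_mat d d" using W P by (simp add: G_def)
  have Gf: "G *\<^sub>v f i = (if i < r then f i else 0\<^sub>v d)" if i: "i < d" for i
  proof -
    have "G *\<^sub>v f i = W *\<^sub>v (transpose_mat W *\<^sub>v (P *\<^sub>v f i))"
      using W P fc[OF i]
      by (simp add: G_def assoc_mult_mat_vec[of W d r _ d] assoc_mult_mat_vec[of _ r d P d])
    also have "\<dots> = (if i < r then f i else 0\<^sub>v d)"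
    proof (cases "i < r")
      case True
      then have "W *\<^sub>v (sqrt (e i) \<cdot>\<^sub>v unit_vec r i) = sqrt (e i) \<cdot>\<^sub>v w i"
        using W by (simp add: mat_mult_unit_vec[OF W True] colW[OF True] mult_mat_vec[of W d r])
      also have "\<dots> = f i" using r(2)[OF True] fc[OF i] by (simp add: w_def smult_smult_assoc)
      finally show ?thesis using True i by (simp add: WP)
    qed (use W i in \<open>auto simp: WP\<close>)
    finally show ?thesis .
  qed
  \<comment> \<open>\<open>e i = 0\<close> is a sum of two nonnegative terms, so
    \<open>\<mu> i\<close>, which is the squared length of \<open>A *\<^sub>v f i\<close>,
    vanishes.\<close>
  have Af0: "A *\<^sub>v f i = 0\<^sub>v n" if "r \<le> i" "i < d" for i
  proof -
    have "\<mu> i = 0" using r(3)[OF that] mu[OF that(2)] lam by (simp add: e_def)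
    then show ?thesis using Af[OF that(2)] scalar_prod_self_eq_0[of "A *\<^sub>v f i" n] A fc[OF that(2)] by simp
  qed
  have AG: "A * G = A"
  proof (rule mat_eqI_orthonormal_basis[OF f])
    fix i assume i: "i < d"
    have "(A * G) *\<^sub>v f i = A *\<^sub>v (G *\<^sub>v f i)" using A G fc[OF i] by simp
    then show "(A * G) *\<^sub>v f i = A *\<^sub>v f i" using Gf[OF i] Af0[of i] i A by auto
  qed (use A G in auto)
  have PG: "P * G = P"
  proof (rule mat_eqI_orthonormal_basis[OF f])
    fix i assume i: "i < d"
    have "(P * G) *\<^sub>v f i = P *\<^sub>v (G *\<^sub>v f i)" using P G fc[OF i] by simp
    then show "(P * G) *\<^sub>v f i = P *\<^sub>v f i" using Gf[OF i] Pf[OF i] r(3)[of i] i P fc[OF i] by auto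
  qed (use P G in auto)
  have WPW: "transpose_mat W * P * W = 1\<^sub>m r"
  proof (rule eq_matI)
    fix i j assume "i < dim_row (1\<^sub>m r :: real mat)" "j < dim_col (1\<^sub>m r :: real mat)"
    then have ij: "i < r" "j < r" "j < d" using r(1) by auto
    have "(transpose_mat W * P * W) $$ (i, j) = (transpose_mat W * (P * W)) $$ (i, j)"
      using W P by (simp add: assoc_mult_mat[of _ r d P d W r])
    also have "\<dots> = w i \<bullet> (P *\<^sub>v w j)"
      using ij W P colW by (simp add: mult_mat_vec_def)
    also have "P *\<^sub>v w j = sqrt (e j) \<cdot>\<^sub>v f j"
      using P fc[OF ij(3)] r(2)[OF ij(2)] Pf[OF ij(3)]
      by (simp add: w_def mult_mat_vec[of P d d] smult_smult_assoc real_div_sqrt)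
    also have "w i \<bullet> (sqrt (e j) \<cdot>\<^sub>v f j) = 1\<^sub>m r $$ (i, j)"
      using wf[OF ij(1,3)] wc[OF ij(1)] fc[OF ij(3)] ij r(2)[of j] by auto
    finally show "(transpose_mat W * P * W) $$ (i, j) = 1\<^sub>m r $$ (i, j)" .
  qed (use W in auto)
  have "(\<Sum>i<n. \<Sum>j<r. ((A * W) $$ (i, j))\<^sup>2) = (\<Sum>j<r. \<Sum>i<n. ((A *\<^sub>v w j) $ i)\<^sup>2)"
    using A W colW by (subst sum.swap) (auto intro!: sum.cong)
  also have "\<dots> = (\<Sum>j<r. (A *\<^sub>v w j) \<bullet> (A *\<^sub>v w j))" using A by (simp add: scalar_prod_self)
  also have "\<dots> = (\<Sum>j<r. \<mu> j / (\<mu> j + lam))"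
  proof (rule sum.cong[OF refl])
    fix j assume "j \<in> {..<r}"
    then have j: "j < r" "j < d" using r(1) by auto
    have "A *\<^sub>v w j = (1 / sqrt (e j)) \<cdot>\<^sub>v (A *\<^sub>v f j)" using A fc[OF j(2)] by (simp add: w_def mult_mat_vec[of A n d])
    then show "(A *\<^sub>v w j) \<bullet> (A *\<^sub>v w j) = \<mu> j / (\<mu> j + lam)"
      using Af[OF j(2)] A fc[OF j(2)] r(2)[OF j(1)] by (simp add: e_def)
  qed
  \<comment> \<open>For \<open>r \<le> j\<close> the denominator is 0, so the added terms are 0 by
    the convention for division by zero.\<close>
  also have "\<dots> = (\<Sum>j<d. \<mu> j / (\<mu> j + lam))"
    by (rule sum.mono_neutral_left) (use r in \<open>auto simp: e_def\<close>)
  also have "\<dots> = stat_dim lam A"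
    by (rule stat_dim_eigenbasis[OF A f, symmetric]) (use Bf mu lam in \<open>auto simp: B_def\<close>)
  finally show thesis using that[of W] W WPW AG PG by (simp add: rk G_def)
qed

section \<open>Singular value decomposition\<close>

lemma transpose_mat_diag: "transpose_mat (mat_diag k f) = mat_diag k f"
  by (auto simp: mat_diag_def intro!: eq_matI)

text \<open>The eigenvectors of \<open>M * transpose_mat M\<close> serve as left singular vectors.
  Their images under the transpose are orthogonal with squared lengths \<open>e i\<close>, and the
  nonzero ones normalize to right singular vectors.\<close>

lemma singular_value_decomposition_wide:
  fixes M :: "real mat"
  assumes M: "M \<in> carrier_mat k l" and "k \<le> l"
  shows "\<exists>X Y s. X \<in> carrier_mat k k \<and> Y \<in> carrier_mat l k \<and> s \<in> carrier_vec k \<and>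
           transpose_mat X * X = 1\<^sub>m k \<and> transpose_mat Y * Y = 1\<^sub>m k \<and>
           nonincreasing s \<and> (\<forall>i<k. 0 \<le> s $ i) \<and> M = X * mat_diag k (\<lambda>i. s $ i) * transpose_mat Y"
proof -
  define N where "N = M * transpose_mat M"
  have N: "N \<in> carrier_mat k k" "transpose_mat N = N"
    using M transpose_mult[of M k l "transpose_mat M" k] by (auto simp: N_def)
  obtain f e where f: "orthonormal k k f" and Nf: "\<And>i. i < k \<Longrightarrow> N *\<^sub>v f i = e i \<cdot>\<^sub>v f i"
    and mono: "\<And>i j. i \<le> j \<Longrightarrow> j < k \<Longrightarrow> e j \<le> e i"
    using real_symmetric_eigenbasis[OF N] by blast
  have fc: "f i \<in> carrier_vec k" if "i < k" for i using f that by (auto simp: orthonormal_def)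
  define h where "h i = transpose_mat M *\<^sub>v f i" for i
  have hc: "h i \<in> carrier_vec l" if "i < k" for i using M fc[OF that] by (simp add: h_def)
  have hh: "h i \<bullet> h j = (if i = j then e j else 0)" if "i < k" "j < k" for i j
  proof -
    have "h i \<bullet> h j = f i \<bullet> (M *\<^sub>v h j)"
      using transpose_vec_mult_scalar[OF M hc[OF that(2)] fc[OF that(1)]] by (simp add: h_def)
    also have "M *\<^sub>v h j = e j \<cdot>\<^sub>v f j"
      using Nf[OF that(2)] M fc[OF that(2)] by (simp add: h_def N_def)
    finally show ?thesis using f fc[OF that(1)] fc[OF that(2)] that by (auto simp: orthonormal_def)
  qed
  have e0: "0 \<le> e i" if "i < k" for i using hh[OF that that] scalar_prod_self_nonneg[of "h i"] by simp
  obtain r where r: "r \<le> k" "\<And>i. i < r \<Longrightarrow> 0 < e i" "\<And>i. r \<le> i \<Longrightarrow> i < k \<Longrightarrow> e i = 0"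
    using antimono_nonneg_cutoff[of k e] mono e0 by blast
  have "orthonormal l r (\<lambda>i. (1 / sqrt (e i)) \<cdot>\<^sub>v h i)"
  proof -
    have "((1 / sqrt (e i)) \<cdot>\<^sub>v h i) \<bullet> ((1 / sqrt (e j)) \<cdot>\<^sub>v h j) = (if i = j then 1 else 0)"
      if "i < r" "j < r" for i j
    proof -
      have "i < k" "j < k" using that r(1) by auto
      then show ?thesis using hh[of i j] hc[of i] hc[of j] r(2)[OF that(2)]
          smult_scalar_prod_distrib[OF hc smult_carrier_vec[THEN iffD2, OF hc], of i j "1 / sqrt (e i)"]
        by (auto simp: field_simps)
    qed
    then show ?thesis using hc r(1) by (simp add: orthonormal_def)
  qed
  \<comment> \<open>Zero singular values leave their right singular vectors free. Completing the
    family supplies them, and \<open>k \<le> l\<close> ensures that there are enough.\<close>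
  then obtain g where gh: "\<And>i. i < r \<Longrightarrow> g i = (1 / sqrt (e i)) \<cdot>\<^sub>v h i" and g: "orthonormal l l g"
    using orthonormal_extend[of l r] r(1) \<open>k \<le> l\<close> by auto
  have gk: "orthonormal l k g" using g \<open>k \<le> l\<close> by (auto simp: orthonormal_def)
  have hg: "h i = sqrt (e i) \<cdot>\<^sub>v g i" if "i < k" for i
  proof (cases "i < r")
    case True
    then show ?thesis using r(2)[OF True] hc[OF that] by (simp add: gh smult_smult_assoc)
  next
    case False
    then have "h i = 0\<^sub>v l" using r(3)[of i] that hh[OF that that] scalar_prod_self_eq_0[OF hc[OF that]] by simp
    moreover have "g i \<in> carrier_vec l" using that gk by (simp add: orthonormal_def)
    ultimately show ?thesis using False r(3)[of i] that by (auto intro!: eq_vecI)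
  qed
  define X where "X = mat_of_cols k (map f [0..<k])"
  define Y where "Y = mat_of_cols l (map g [0..<k])"
  note X = orthonormal_mat_of_cols[OF f, folded X_def] and Y = orthonormal_mat_of_cols[OF gk, folded Y_def]
  define s where "s = Matrix.vec k (\<lambda>i. sqrt (e i))"
  define D where "D = mat_diag k (\<lambda>i. s $ i)"
  have D: "D \<in> carrier_mat k k" by (simp add: D_def mat_diag_dim)
  have "transpose_mat M * X = Y * D"
  proof (rule eq_matI)
    fix i j assume "i < dim_row (Y * D)" "j < dim_col (Y * D)"
    then have ij: "i < l" "j < k" using Y D by auto
    have gj: "g j \<in> carrier_vec l" using gk ij by (simp add: orthonormal_def)
    have "(transpose_mat M * X) $$ (i, j) = h j $ i" using ij M X by (simp add: h_def)
    also have "\<dots> = sqrt (e j) * g j $ i" using hg[OF ij(2)] gj ij by simp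
    also have "g j $ i = Y $$ (i, j)" using Y(1) Y(2)[OF ij(2)] ij by (metis carrier_matD index_col)
    finally show "(transpose_mat M * X) $$ (i, j) = (Y * D) $$ (i, j)"
      using ij Y(1) by (simp add: D_def s_def mat_diag_mult_right)
  qed (use M X Y D in auto)
  have MX: "transpose_mat X * M = D * transpose_mat Y"
  proof -
    from \<open>transpose_mat M * X = Y * D\<close> have "transpose_mat (transpose_mat M * X) = transpose_mat (Y * D)" by simp
    also have "transpose_mat (transpose_mat M * X) = transpose_mat X * M"
      using M X(1) transpose_mult[of "transpose_mat M" l k X k] by simp
    also have "transpose_mat (Y * D) = D * transpose_mat Y"
      using Y(1) D transpose_mult[of Y l k D k] by (simp add: D_def transpose_mat_diag)
    finally show ?thesis .
  qed
  have XX: "X * transpose_mat X = 1\<^sub>m k"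
    using mat_mult_left_right_inverse[of "transpose_mat X" k X] X by simp
  have "M = X * (transpose_mat X * M)"
    using XX M X(1) assoc_mult_mat[of X k k "transpose_mat X" k M l] by simp
  then have MD: "M = X * D * transpose_mat Y" using MX X(1) Y(1) D assoc_mult_mat[of X k k D k "transpose_mat Y" l] by simp
  have "nonincreasing s" using mono by (auto simp: nonincreasing_def s_def)
  moreover have "s \<in> carrier_vec k" "\<forall>i<k. 0 \<le> s $ i" using e0 by (auto simp: s_def)
  ultimately show ?thesis using X Y MD unfolding D_def by blast
qed

lemma singular_value_decomposition:
  fixes M :: "real mat"
  assumes M: "M \<in> carrier_mat k l"
  defines "q \<equiv> min k l"
  shows "\<exists>X Y s. X \<in> carrier_mat k q \<and> Y \<in> carrier_mat l q \<and> s \<in> carrier_vec q \<and>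
           transpose_mat X * X = 1\<^sub>m q \<and> transpose_mat Y * Y = 1\<^sub>m q \<and>
           nonincreasing s \<and> (\<forall>i<q. 0 \<le> s $ i) \<and> M = X * mat_diag q (\<lambda>i. s $ i) * transpose_mat Y"
proof (cases "k \<le> l")
  case True
  then show ?thesis using singular_value_decomposition_wide[OF M True] by (simp add: q_def)
next
  case False
  then have q: "q = l" and "l \<le> k" by (auto simp: q_def)
  have "transpose_mat M \<in> carrier_mat l k" using M by simp
  from singular_value_decomposition_wide[OF this \<open>l \<le> k\<close>]
  obtain X Y s where XY: "X \<in> carrier_mat l l" "Y \<in> carrier_mat k l" "s \<in> carrier_vec l"
      "transpose_mat X * X = 1\<^sub>m l" "transpose_mat Y * Y = 1\<^sub>m l"
      "nonincreasing s" "\<forall>i<l. 0 \<le> s $ i"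
    and Mt: "transpose_mat M = X * mat_diag l (\<lambda>i. s $ i) * transpose_mat Y" by blast
  define D where "D = mat_diag l (\<lambda>i. s $ i)"
  have D: "D \<in> carrier_mat l l" "transpose_mat D = D" by (simp_all add: D_def mat_diag_dim transpose_mat_diag)
  have "M = transpose_mat (X * D * transpose_mat Y)" unfolding D_def Mt[symmetric] by simp
  also have "\<dots> = Y * D * transpose_mat X"
    using XY(1,2) D transpose_mult[of "X * D" l l "transpose_mat Y" k] transpose_mult[of X l l D l]
    by (simp add: assoc_mult_mat[of Y k l D l _ l])
  finally show ?thesis using XY unfolding q D_def by blast
qed

section \<open>Positive semidefinite forms\<close>

definition psd :: "nat \<Rightarrow> real mat \<Rightarrow> bool" where
  "psd n P \<longleftrightarrow> P \<in> carrier_mat n n \<and> transpose_mat P = P \<and> (\<forall>x\<in>carrier_vec n. 0 \<le> x \<bullet> (P *\<^sub>v x))"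

lemma psd_reg_gram:
  assumes "A \<in> carrier_mat n d" "0 \<le> lam"
  shows "psd d (reg_gram lam A)"
  using assms by (simp add: psd_def reg_gram_symmetric reg_gram_form)

lemma form_mult_mat:
  fixes C :: "real mat"
  assumes "C \<in> carrier_mat n k" "U \<in> carrier_mat n p" "V \<in> carrier_mat k r"
    and "a \<in> carrier_vec p" "b \<in> carrier_vec r"
  shows "(U *\<^sub>v a) \<bullet> (C *\<^sub>v (V *\<^sub>v b)) = a \<bullet> ((transpose_mat U * C * V) *\<^sub>v b)"
proof -
  have "(transpose_mat U * C * V) *\<^sub>v b = transpose_mat U *\<^sub>v (C *\<^sub>v (V *\<^sub>v b))"
  proof -
    have "(transpose_mat U * C * V) *\<^sub>v b = (transpose_mat U * C) *\<^sub>v (V *\<^sub>v b)"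
      by (rule assoc_mult_mat_vec) (use assms in auto)
    also have "\<dots> = transpose_mat U *\<^sub>v (C *\<^sub>v (V *\<^sub>v b))"
      by (rule assoc_mult_mat_vec) (use assms in auto)
    finally show ?thesis .
  qed
  moreover have "(transpose_mat U *\<^sub>v (C *\<^sub>v (V *\<^sub>v b))) \<bullet> a = (C *\<^sub>v (V *\<^sub>v b)) \<bullet> (U *\<^sub>v a)"
    using assms by (intro transpose_vec_mult_scalar) auto
  ultimately show ?thesis
    using assms comm_scalar_prod[of "U *\<^sub>v a" n "C *\<^sub>v (V *\<^sub>v b)"]
      comm_scalar_prod[of a p "transpose_mat U *\<^sub>v (C *\<^sub>v (V *\<^sub>v b))"] by simp
qed

lemma psd_form_diff:
  assumes P: "psd n P" and x: "x \<in> carrier_vec n" and y: "y \<in> carrier_vec n"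
  shows "(x - y) \<bullet> (P *\<^sub>v (x - y)) = x \<bullet> (P *\<^sub>v x) - 2 * (y \<bullet> (P *\<^sub>v x)) + y \<bullet> (P *\<^sub>v y)"
proof -
  have Pc: "P \<in> carrier_mat n n" and sym: "transpose_mat P = P" using P by (auto simp: psd_def)
  have "x \<bullet> (P *\<^sub>v y) = y \<bullet> (P *\<^sub>v x)" by (rule symmetric_form_commute[OF Pc sym x y])
  then show ?thesis using Pc x y
    by (simp add: mult_minus_distrib_mat_vec[of P n n] minus_scalar_prod_distrib[of _ n] scalar_prod_minus_distrib[of _ n])
qed

text \<open>\<open>a\<close> lists the coordinates of \<open>x\<close> in a system that is
  orthonormal for the form \<open>P\<close>, and the first claim is Pythagoras for the residual. The
  exact identity serves the equality case of the trace bound.\<close>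

lemma bessel:
  assumes P: "psd n P" and U: "U \<in> carrier_mat n q" and UPU: "transpose_mat U * P * U = 1\<^sub>m q"
    and x: "x \<in> carrier_vec n"
  defines "a \<equiv> transpose_mat U *\<^sub>v (P *\<^sub>v x)"
  shows "(x - U *\<^sub>v a) \<bullet> (P *\<^sub>v (x - U *\<^sub>v a)) = x \<bullet> (P *\<^sub>v x) - a \<bullet> a"
    and "a \<bullet> a \<le> x \<bullet> (P *\<^sub>v x)"
proof -
  have Pc: "P \<in> carrier_mat n n" using P by (simp add: psd_def)
  have a: "a \<in> carrier_vec q" using U Pc x by (simp add: a_def)
  have "(U *\<^sub>v a) \<bullet> (P *\<^sub>v (U *\<^sub>v a)) = a \<bullet> a"
    using form_mult_mat[OF Pc U U a a] UPU a by simp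
  moreover have "(U *\<^sub>v a) \<bullet> (P *\<^sub>v x) = a \<bullet> a"
    using transpose_vec_mult_scalar[OF U a, of "P *\<^sub>v x"] comm_scalar_prod[of "U *\<^sub>v a" n "P *\<^sub>v x"] Pc U a x
    by (simp add: a_def)
  ultimately show eq: "(x - U *\<^sub>v a) \<bullet> (P *\<^sub>v (x - U *\<^sub>v a)) = x \<bullet> (P *\<^sub>v x) - a \<bullet> a"
    using psd_form_diff[OF P x, of "U *\<^sub>v a"] U a by simp
  have "x - U *\<^sub>v a \<in> carrier_vec n" using U a x by simp
  then show "a \<bullet> a \<le> x \<bullet> (P *\<^sub>v x)" using P eq unfolding psd_def by fastforce
qed

lemma linear_bounded_by_quadratic:
  fixes a b :: real
  assumes "\<And>t. 0 \<le> t * t * a + 2 * t * b" "0 \<le> a"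
  shows "b = 0"
proof (rule ccontr)
  assume "b \<noteq> 0"
  have *: "0 \<le> t * (t * a + 2 * b)" for t using assms(1)[of t] by (simp add: algebra_simps)
  \<comment> \<open>The quadratic has its minimum at \<open>- b / a\<close>; the added 1 also covers
    \<open>a = 0\<close>.\<close>
  define t where "t = - b / (a + 1)"
  have "t * a + 2 * b = b * (a + 2) / (a + 1)" using assms(2) by (simp add: t_def field_simps)
  then have "t * (t * a + 2 * b) = - (b\<^sup>2 * (a + 2) / (a + 1)\<^sup>2)" by (simp add: t_def power2_eq_square)
  moreover have "b\<^sup>2 * (a + 2) / (a + 1)\<^sup>2 > 0" using \<open>b \<noteq> 0\<close> assms(2) by simp
  ultimately show False using *[of t] by simp
qed

text \<open>Along \<open>x - t \<cdot>\<^sub>v y\<close> with \<open>y = P *\<^sub>v x\<close>, the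
  form is a nonnegative polynomial in \<open>t\<close> without constant term, so its linear
  coefficient, a multiple of \<open>y \<bullet> y\<close>, vanishes. As \<open>P\<close> may be
  singular, \<open>x\<close> itself can be nonzero.\<close>

lemma psd_form_0_imp_mult_0:
  assumes P: "psd n P" and x: "x \<in> carrier_vec n" and "x \<bullet> (P *\<^sub>v x) = 0"
  shows "P *\<^sub>v x = 0\<^sub>v n"
proof -
  have Pc: "P \<in> carrier_mat n n" using P by (simp add: psd_def)
  define y where "y = P *\<^sub>v x"
  have y: "y \<in> carrier_vec n" using Pc x by (simp add: y_def)
  have "0 \<le> t * t * (y \<bullet> (P *\<^sub>v y)) + 2 * t * - (y \<bullet> y)" for t
  proof -
    have "0 \<le> (x - t \<cdot>\<^sub>v y) \<bullet> (P *\<^sub>v (x - t \<cdot>\<^sub>v y))" using P x y by (simp add: psd_def)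
    also have "\<dots> = t * t * (y \<bullet> (P *\<^sub>v y)) - 2 * t * (y \<bullet> y)"
      using psd_form_diff[OF P x, of "t \<cdot>\<^sub>v y"] Pc x y assms(3)
      by (simp add: mult_mat_vec[of P n n] y_def[symmetric])
    finally show ?thesis by simp
  qed
  then have "- (y \<bullet> y) = 0" by (rule linear_bounded_by_quadratic) (use P y in \<open>auto simp: psd_def\<close>)
  then show ?thesis using scalar_prod_self_eq_0[OF y] by (simp add: y_def)
qed

text \<open>If the rank dropped, some nonzero combination \<open>x\<close> of the columns of
  \<open>W\<close>, where the form of \<open>P\<close> is positive, would satisfy
  \<open>P' *\<^sub>v x = 0\<close>. Used in both directions, this shows that the sketched problem
  has the same number of weights.\<close>

lemma mat_rank_le_of_form_zero:
  assumes A: "A \<in> carrier_mat n d" "0 \<le> lam" and A': "A' \<in> carrier_mat n' d" "0 \<le> lam'"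
    and zero: "\<And>x. x \<in> carrier_vec d \<Longrightarrow> x \<bullet> (reg_gram lam' A' *\<^sub>v x) = 0 \<Longrightarrow> x \<bullet> (reg_gram lam A *\<^sub>v x) = 0"
  shows "mat_rank (reg_gram lam A) \<le> mat_rank (reg_gram lam' A')"
proof (rule ccontr)
  define P where "P = reg_gram lam A"
  define P' where "P' = reg_gram lam' A'"
  define r where "r = mat_rank P"
  define r' where "r' = mat_rank P'"
  assume "\<not> ?thesis"
  then have "r' < r" by (simp add: r_def r'_def P_def P'_def)
  have P: "P \<in> carrier_mat d d" "P' \<in> carrier_mat d d" using A A' by (auto simp: P_def P'_def)
  obtain W where W: "W \<in> carrier_mat d r" "transpose_mat W * P * W = 1\<^sub>m r"
    using whitening[OF A] by (metis P_def r_def)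
  obtain W' where W': "W' \<in> carrier_mat d r'" "P' * (W' * (transpose_mat W' * P')) = P'"
    using whitening[OF A'] by (metis P'_def r'_def)
  obtain c where c: "c \<in> carrier_vec r" "c \<noteq> 0\<^sub>v r" "(transpose_mat W' * P' * W) *\<^sub>v c = 0\<^sub>v r'"
    using homogeneous_system_nontrivial[of "transpose_mat W' * P' * W" r' r] W W' P \<open>r' < r\<close> by auto
  define x where "x = W *\<^sub>v c"
  have x: "x \<in> carrier_vec d" using W c by (simp add: x_def)
  have WPx: "(transpose_mat W' * P') *\<^sub>v x = 0\<^sub>v r'"
    using c W(1) W'(1) P assoc_mult_mat_vec[of "transpose_mat W' * P'" r' d W r c] by (simp add: x_def)
  have "P' *\<^sub>v x = P' *\<^sub>v (W' *\<^sub>v ((transpose_mat W' * P') *\<^sub>v x))"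
    using W' P x assoc_mult_mat_vec[of P' d d "W' * (transpose_mat W' * P')" d x]
      assoc_mult_mat_vec[of W' d r' "transpose_mat W' * P'" d x] by simp
  also have "\<dots> = 0\<^sub>v d" 
  proof -
    have "W' *\<^sub>v 0\<^sub>v r' = 0\<^sub>v d" "P' *\<^sub>v 0\<^sub>v d = 0\<^sub>v d" using W'(1) P(2) by (auto intro!: eq_vecI)
    then show ?thesis unfolding WPx by simp
  qed
  finally have "x \<bullet> (P' *\<^sub>v x) = 0" using x by simp
  then have "x \<bullet> (P *\<^sub>v x) = 0" using zero[OF x] by (simp add: P_def P'_def)
  then have "c \<bullet> c = 0" using form_mult_mat[OF P(1) W(1) W(1) c(1) c(1)] W(2) c(1) by (simp add: x_def)
  then show False using scalar_prod_self_eq_0[OF c(1)] c(2) by simp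
qed

section \<open>Trace inequality and its equality case\<close>

lemma mat_trace_eq_sum: "M \<in> carrier_mat q q \<Longrightarrow> mat_trace M = (\<Sum>i<q. M $$ (i, i))"
  by (simp add: mat_trace_def)

lemma mat_diag_mult_vec: "c \<in> carrier_vec q \<Longrightarrow> mat_diag q f *\<^sub>v c = Matrix.vec q (\<lambda>i. f i * c $ i)"
  for c :: "real Matrix.vec"
  by (intro eq_vecI) (auto simp: mat_diag_def scalar_prod_def if_distrib[of "\<lambda>x. x * _"] sum.delta cong: if_cong)

text \<open>Optimality conditions for CCA: a singular value decomposition of \<open>C\<close> relative to the forms \<open>P\<close>, \<open>P'\<close>.\<close>
definition cca_svd ::
    "nat \<Rightarrow> nat \<Rightarrow> nat \<Rightarrow> real mat \<Rightarrow> real mat \<Rightarrow> real mat \<Rightarrow> real Matrix.vec \<Rightarrow> real mat \<Rightarrow> real mat \<Rightarrow> bool" where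
  "cca_svd d d' q P P' C s U V \<longleftrightarrow>
     U \<in> carrier_mat d q \<and> V \<in> carrier_mat d' q \<and> s \<in> carrier_vec q \<and>
     transpose_mat U * P * U = 1\<^sub>m q \<and> transpose_mat V * P' * V = 1\<^sub>m q \<and>
     (\<forall>i<q. 0 \<le> s $ i) \<and> C = P * U * mat_diag q (\<lambda>i. s $ i) * (transpose_mat V * P')"

text \<open>A trace inequality of von Neumann type. \<open>a\<close> and \<open>b\<close> hold the
  inner products of the new weights with the reference systems \<open>U0\<close> and
  \<open>V0\<close>. The trace becomes a combination of inner products of their rows with
  coefficients \<open>s0\<close>, and Bessel's inequality bounds the rows.\<close>

lemma cca_svd_trace_le:
  assumes P: "psd d P" and P': "psd d' P'" and svd: "cca_svd d d' q P P' C s0 U0 V0"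
    and U: "U \<in> carrier_mat d q" and V: "V \<in> carrier_mat d' q"
    and UPU: "transpose_mat U * P * U = 1\<^sub>m q" and VPV: "transpose_mat V * P' * V = 1\<^sub>m q"
  defines "a \<equiv> transpose_mat U0 * P * U" and "b \<equiv> transpose_mat V0 * P' * V"
  shows "transpose_mat U * C * V = transpose_mat a * mat_diag q (\<lambda>i. s0 $ i) * b"
    and "mat_trace (transpose_mat U * C * V) = (\<Sum>i<q. s0 $ i * (Matrix.row a i \<bullet> Matrix.row b i))"
    and "\<And>i. i < q \<Longrightarrow> Matrix.row a i \<bullet> Matrix.row a i \<le> 1"
    and "\<And>i. i < q \<Longrightarrow> Matrix.row b i \<bullet> Matrix.row b i \<le> 1"
proof -
  have Pc: "P \<in> carrier_mat d d" "P' \<in> carrier_mat d' d'" and sym: "transpose_mat P = P" "transpose_mat P' = P'"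
    using P P' by (auto simp: psd_def)
  have U0: "U0 \<in> carrier_mat d q" and V0: "V0 \<in> carrier_mat d' q" and s0: "s0 \<in> carrier_vec q"
    and UPU0: "transpose_mat U0 * P * U0 = 1\<^sub>m q" and VPV0: "transpose_mat V0 * P' * V0 = 1\<^sub>m q"
    and C: "C = P * U0 * mat_diag q (\<lambda>i. s0 $ i) * (transpose_mat V0 * P')"
    using svd by (auto simp: cca_svd_def)
  define D where "D = mat_diag q (\<lambda>i. s0 $ i)"
  have D: "D \<in> carrier_mat q q" by (simp add: D_def mat_diag_dim)
  have a: "a \<in> carrier_mat q q" and b: "b \<in> carrier_mat q q" using U0 V0 U V Pc by (auto simp: a_def b_def)
  have ta: "transpose_mat a = transpose_mat U * (P * U0)"
    using U0 U Pc sym transpose_mult[of "transpose_mat U0 * P" q d U q] transpose_mult[of "transpose_mat U0" q d P d]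
    by (simp add: a_def)
  show UCV: "transpose_mat U * C * V = transpose_mat a * mat_diag q (\<lambda>i. s0 $ i) * b"
  proof -
    define E where "E = transpose_mat V0 * P'"
    define F where "F = P * U0"
    have EF: "E \<in> carrier_mat q d'" "F \<in> carrier_mat d q" using U0 V0 Pc by (auto simp: E_def F_def)
    have "transpose_mat U * C * V = transpose_mat U * (F * D * E) * V"
      by (simp add: C D_def E_def F_def)
    also have "\<dots> = transpose_mat U * F * D * (E * V)"
      using U V D EF assoc_mult_mat[of "transpose_mat U" q d "F * D" q E d'] assoc_mult_mat[of "transpose_mat U" q d F q D q]
        assoc_mult_mat[of "transpose_mat U * F * D" q q E d' V q]
      by (simp del: assoc_mult_mat)
    finally show ?thesis by (simp add: ta b_def D_def E_def F_def)
  qed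
  show "mat_trace (transpose_mat U * C * V) = (\<Sum>i<q. s0 $ i * (Matrix.row a i \<bullet> Matrix.row b i))"
  proof -
    have "mat_trace (transpose_mat U * C * V) = (\<Sum>j<q. \<Sum>i<q. a $$ (i, j) * s0 $ i * b $$ (i, j))"
      unfolding UCV using a b
      by (subst mat_trace_eq_sum[of _ q])
         (auto simp: mat_diag_dim mat_diag_mult_right scalar_prod_def lessThan_atLeast0 intro!: sum.cong)
    also have "\<dots> = (\<Sum>i<q. \<Sum>j<q. a $$ (i, j) * s0 $ i * b $$ (i, j))" by (rule sum.swap)
    also have "\<dots> = (\<Sum>i<q. s0 $ i * (Matrix.row a i \<bullet> Matrix.row b i))"
      using a b by (auto simp: scalar_prod_def sum_distrib_left lessThan_atLeast0 mult_ac intro!: sum.cong)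
    finally show ?thesis .
  qed
  \<comment> \<open>The coefficients \<open>s0\<close> belong to rows, so Bessel is applied to the
    new system: row \<open>i\<close> holds the coordinates of \<open>col X0 i\<close> in the system
    \<open>X\<close>.\<close>
  have gen: "Matrix.row (transpose_mat X0 * R * X) i \<bullet> Matrix.row (transpose_mat X0 * R * X) i \<le> 1"
    if R: "psd n R" and X: "X \<in> carrier_mat n q" "X0 \<in> carrier_mat n q"
      and XRX: "transpose_mat X * R * X = 1\<^sub>m q" "transpose_mat X0 * R * X0 = 1\<^sub>m q" and i: "i < q" for n R X X0 i
  proof -
    have Rc: "R \<in> carrier_mat n n" "transpose_mat R = R" using R by (auto simp: psd_def)
    have ci: "col X0 i \<in> carrier_vec n" using X by (simp add: carrier_vecI)
    have "Matrix.row (transpose_mat X0 * R * X) i = transpose_mat X *\<^sub>v (R *\<^sub>v col X0 i)"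
    proof (rule eq_vecI)
      fix j assume "j < dim_vec (transpose_mat X *\<^sub>v (R *\<^sub>v col X0 i))"
      then have j: "j < q" using X by simp
      have cj: "col X j \<in> carrier_vec n" using X by (simp add: carrier_vecI)
      have "Matrix.row (transpose_mat X0 * R * X) i $ j = (transpose_mat X0 * (R * X)) $$ (i, j)"
        using i j X Rc by (simp add: assoc_mult_mat[of _ q n R n X q])
      also have "\<dots> = col X0 i \<bullet> (R *\<^sub>v col X j)" using i j X Rc by (simp add: mult_mat_vec_def)
      also have "\<dots> = col X j \<bullet> (R *\<^sub>v col X0 i)" by (rule symmetric_form_commute[OF Rc ci cj])
      finally show "Matrix.row (transpose_mat X0 * R * X) i $ j = (transpose_mat X *\<^sub>v (R *\<^sub>v col X0 i)) $ j"
        using j X by simp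
    qed (use X in auto)
    moreover have "col X0 i \<bullet> (R *\<^sub>v col X0 i) = 1"
    proof -
      have "col X0 i \<bullet> (R *\<^sub>v col X0 i) = (transpose_mat X0 * (R * X0)) $$ (i, i)"
        using i X Rc by (simp add: mult_mat_vec_def)
      also have "transpose_mat X0 * (R * X0) = 1\<^sub>m q" using XRX X Rc by (simp add: assoc_mult_mat[of _ q n R n X0 q])
      finally show ?thesis using i by simp
    qed
    ultimately show ?thesis using bessel(2)[OF R X(1) XRX(1) ci] by simp
  qed
  show "Matrix.row a i \<bullet> Matrix.row a i \<le> 1" if "i < q" for i
    using gen[OF P U U0 UPU UPU0 that] by (simp add: a_def)
  show "Matrix.row b i \<bullet> Matrix.row b i \<le> 1" if "i < q" for i
    using gen[OF P' V V0 VPV VPV0 that] by (simp add: b_def)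
qed

lemma mult_mat_entry:
  assumes "A \<in> carrier_mat n k" "B \<in> carrier_mat k l" "i < n" "j < l"
  shows "(A * B) $$ (i, j) = (A *\<^sub>v col B j) $ i"
  using assms by simp

text \<open>Reaching the sum of \<open>s0\<close> forces row \<open>i\<close> of \<open>a\<close>
  and row \<open>i\<close> of \<open>b\<close> to be the same unit vector wherever
  \<open>s0 $ i > 0\<close>. Equality in Bessel then says that \<open>P\<close> and
  \<open>P'\<close> do not distinguish these columns of \<open>U0\<close> and \<open>V0\<close> from
  their expansions in \<open>U\<close> and \<open>V\<close>, so the given decomposition of
  \<open>C\<close> can be rewritten in the new weights.\<close>

lemma cca_svdI_maximal:
  assumes P: "psd d P" and P': "psd d' P'" and svd: "cca_svd d d' q P P' C s0 U0 V0"
    and U: "U \<in> carrier_mat d q" and V: "V \<in> carrier_mat d' q" and s: "s \<in> carrier_vec q"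
    and UPU: "transpose_mat U * P * U = 1\<^sub>m q" and VPV: "transpose_mat V * P' * V = 1\<^sub>m q"
    and UCV: "transpose_mat U * C * V = mat_diag q (\<lambda>i. s $ i)"
    and max: "(\<Sum>i<q. s0 $ i) \<le> mat_trace (transpose_mat U * C * V)"
  shows "cca_svd d d' q P P' C s U V"
proof -
  have Pc: "P \<in> carrier_mat d d" "P' \<in> carrier_mat d' d'" and sym: "transpose_mat P = P" "transpose_mat P' = P'"
    using P P' by (auto simp: psd_def)
  have U0: "U0 \<in> carrier_mat d q" and V0: "V0 \<in> carrier_mat d' q" and s0: "s0 \<in> carrier_vec q"
    and UPU0: "transpose_mat U0 * P * U0 = 1\<^sub>m q" and VPV0: "transpose_mat V0 * P' * V0 = 1\<^sub>m q"
    and s0_nonneg: "\<And>i. i < q \<Longrightarrow> 0 \<le> s0 $ i"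
    and C: "C = P * U0 * mat_diag q (\<lambda>i. s0 $ i) * (transpose_mat V0 * P')"
    using svd by (auto simp: cca_svd_def)
  define D where "D = mat_diag q (\<lambda>i. s0 $ i)"
  have D: "D \<in> carrier_mat q q" by (simp add: D_def mat_diag_dim)
  define a where "a = transpose_mat U0 * P * U"
  define b where "b = transpose_mat V0 * P' * V"
  have a: "a \<in> carrier_mat q q" and b: "b \<in> carrier_mat q q" using U0 V0 U V Pc by (auto simp: a_def b_def)
  note tr = cca_svd_trace_le[OF P P' svd U V UPU VPV, folded a_def b_def]
  \<comment> \<open>The inner product is at most the mean of two squared lengths that are at most 1;
    equality makes the difference of the rows vanish.\<close>
  have rows: "Matrix.row a i \<bullet> Matrix.row b i \<le> 1"
      "Matrix.row a i \<bullet> Matrix.row b i = 1 \<Longrightarrow> Matrix.row a i \<bullet> Matrix.row a i = 1 \<and> Matrix.row b i \<bullet> Matrix.row b i = 1 \<and> Matrix.row a i = Matrix.row b i"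
    if i: "i < q" for i
  proof -
    have c: "Matrix.row a i \<in> carrier_vec q" "Matrix.row b i \<in> carrier_vec q" using a b by (auto intro: carrier_vecI)
    have *: "(Matrix.row a i - Matrix.row b i) \<bullet> (Matrix.row a i - Matrix.row b i)
        = Matrix.row a i \<bullet> Matrix.row a i - 2 * (Matrix.row a i \<bullet> Matrix.row b i) + Matrix.row b i \<bullet> Matrix.row b i"
      by (rule scalar_prod_self_diff[OF c])
    show "Matrix.row a i \<bullet> Matrix.row b i \<le> 1"
      using * tr(3,4)[OF i] scalar_prod_self_nonneg[of "Matrix.row a i - Matrix.row b i"] by linarith
    assume 1: "Matrix.row a i \<bullet> Matrix.row b i = 1"
    then have "(Matrix.row a i - Matrix.row b i) \<bullet> (Matrix.row a i - Matrix.row b i) = 0"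
      "Matrix.row a i \<bullet> Matrix.row a i = 1" "Matrix.row b i \<bullet> Matrix.row b i = 1"
      using * tr(3,4)[OF i] scalar_prod_self_nonneg[of "Matrix.row a i - Matrix.row b i"] by linarith+
    moreover from this have "Matrix.row a i - Matrix.row b i = 0\<^sub>v q"
      using scalar_prod_self_eq_0[of "Matrix.row a i - Matrix.row b i" q] c by simp
    then have "Matrix.row a i = Matrix.row b i"
      using c a b by (intro eq_vecI) (auto dest!: arg_cong[where f = "\<lambda>v. v $ _"] simp: vec_eq_iff)
    ultimately show "Matrix.row a i \<bullet> Matrix.row a i = 1 \<and> Matrix.row b i \<bullet> Matrix.row b i = 1 \<and> Matrix.row a i = Matrix.row b i"
      by blast
  qed
  have eq1: "Matrix.row a i \<bullet> Matrix.row b i = 1" if i: "i < q" "0 < s0 $ i" for i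
  proof (rule ccontr)
    assume "Matrix.row a i \<bullet> Matrix.row b i \<noteq> 1"
    then have "s0 $ i * (Matrix.row a i \<bullet> Matrix.row b i) < s0 $ i" using rows(1)[OF i(1)] i(2) by simp
    then have "(\<Sum>i<q. s0 $ i * (Matrix.row a i \<bullet> Matrix.row b i)) < (\<Sum>i<q. s0 $ i)"
      using i rows(1) s0_nonneg by (intro sum_strict_mono_ex1) (auto intro!: mult_left_le bexI[of _ i])
    then show False using max tr(2) by simp
  qed
  \<comment> \<open>The factor \<open>D\<close> stays on both sides because only columns with
    positive \<open>s0\<close> are controlled; it annihilates the others.\<close>
  have proj: "R * X0 * D = R * X * transpose_mat (transpose_mat X0 * R * X) * D"
    if R: "psd n R" and X: "X \<in> carrier_mat n q" "X0 \<in> carrier_mat n q"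
      and XRX: "transpose_mat X * R * X = 1\<^sub>m q" "transpose_mat X0 * R * X0 = 1\<^sub>m q"
      and one: "\<And>i. i < q \<Longrightarrow> 0 < s0 $ i \<Longrightarrow>
        Matrix.row (transpose_mat X0 * R * X) i \<bullet> Matrix.row (transpose_mat X0 * R * X) i = 1" for n R X X0
  proof -
    have Rc: "R \<in> carrier_mat n n" "transpose_mat R = R" using R by (auto simp: psd_def)
    define z where "z = transpose_mat X0 * R * X"
    have z: "z \<in> carrier_mat q q" using X Rc by (simp add: z_def)
    have tz: "transpose_mat z = transpose_mat X * (R * X0)"
      using X Rc transpose_mult[of "transpose_mat X0 * R" q n X q] transpose_mult[of "transpose_mat X0" q n R n]
      by (simp add: z_def)
    have col: "R *\<^sub>v col X0 i = R *\<^sub>v (X *\<^sub>v Matrix.row z i)" if i: "i < q" "0 < s0 $ i" for i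
    proof -
      have ci: "col X0 i \<in> carrier_vec n" using X by (simp add: carrier_vecI)
      have zi: "Matrix.row z i = transpose_mat X *\<^sub>v (R *\<^sub>v col X0 i)"
      proof -
        have "Matrix.row z i = col (transpose_mat X * (R * X0)) i" using z i by (simp flip: tz)
        also have "\<dots> = transpose_mat X *\<^sub>v col (R * X0) i"
          using i X Rc by (intro eq_vecI) auto
        also have "col (R * X0) i = R *\<^sub>v col X0 i"
          using i X Rc by (intro eq_vecI) auto
        finally show ?thesis .
      qed
      have "col X0 i \<bullet> (R *\<^sub>v col X0 i) = (transpose_mat X0 * (R * X0)) $$ (i, i)"
        using i X Rc by (simp add: mult_mat_vec_def)
      also have "transpose_mat X0 * (R * X0) = 1\<^sub>m q" using XRX X Rc by simp
      finally have "col X0 i \<bullet> (R *\<^sub>v col X0 i) = 1" using i by simp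
      then have "(col X0 i - X *\<^sub>v Matrix.row z i) \<bullet> (R *\<^sub>v (col X0 i - X *\<^sub>v Matrix.row z i)) = 0"
        using bessel(1)[OF R X(1) XRX(1) ci] one[OF i] by (simp add: zi[symmetric] z_def[symmetric])
      moreover have zc: "X *\<^sub>v Matrix.row z i \<in> carrier_vec n"
        by (rule mult_mat_vec_carrier[OF X(1)]) (use z i in auto)
      ultimately have "R *\<^sub>v (col X0 i - X *\<^sub>v Matrix.row z i) = 0\<^sub>v n"
        using psd_form_0_imp_mult_0[OF R] ci by simp
      then have "R *\<^sub>v col X0 i - R *\<^sub>v (X *\<^sub>v Matrix.row z i) = 0\<^sub>v n"
        using Rc ci zc by (simp add: mult_minus_distrib_mat_vec[of R n n])
      then show ?thesis
        using Rc ci zc by (intro eq_vecI) (auto dest!: arg_cong[where f = "\<lambda>v. v $ _"] simp: vec_eq_iff)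
    qed
    have RX0: "R * X0 \<in> carrier_mat n q" and RXz: "R * X * transpose_mat z \<in> carrier_mat n q" using Rc X z by auto
    have "R * X0 * D = R * X * transpose_mat z * D"
    proof (rule eq_matI)
      fix i j assume "i < dim_row (R * X * transpose_mat z * D)" "j < dim_col (R * X * transpose_mat z * D)"
      then have ij: "i < n" "j < q" using Rc D by auto
      have "(R * X0) $$ (i, j) * s0 $ j = (R * X * transpose_mat z) $$ (i, j) * s0 $ j"
      proof (cases "s0 $ j = 0")
        case False
        then have "0 < s0 $ j" using s0_nonneg[OF ij(2)] by simp
        have "(R * X0) $$ (i, j) = (R *\<^sub>v col X0 j) $ i" using ij Rc X by simp
        also have "\<dots> = (R *\<^sub>v (X *\<^sub>v Matrix.row z j)) $ i" unfolding col[OF ij(2) \<open>0 < s0 $ j\<close>] ..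
        also have "R *\<^sub>v (X *\<^sub>v Matrix.row z j) = (R * X) *\<^sub>v col (transpose_mat z) j"
        proof -
          have "Matrix.row z j \<in> carrier_vec q" "col (transpose_mat z) j = Matrix.row z j"
            using z ij by auto
          then show ?thesis using assoc_mult_mat_vec[OF Rc(1) X(1)] by simp
        qed
        also have "\<dots> $ i = (R * X * transpose_mat z) $$ (i, j)"
          by (rule mult_mat_entry[symmetric]) (use Rc X z ij in auto)
        finally show ?thesis by simp
      qed simp
      then show "(R * X0 * D) $$ (i, j) = (R * X * transpose_mat z * D) $$ (i, j)"
        unfolding D_def mat_diag_mult_right[OF RX0] mat_diag_mult_right[OF RXz] using ij by simp
    qed (use Rc X D in auto)
    then show ?thesis by (simp add: z_def)
  qed
  have PU: "P * U0 * D = P * U * transpose_mat a * D"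
    unfolding a_def by (rule proj[OF P U U0 UPU UPU0]) (use rows(2) eq1 in \<open>simp add: a_def\<close>)
  have PV: "P' * V0 * D = P' * V * transpose_mat b * D"
    unfolding b_def by (rule proj[OF P' V V0 VPV VPV0]) (use rows(2) eq1 in \<open>simp add: b_def\<close>)
  define E0 where "E0 = transpose_mat V0 * P'"
  define E where "E = transpose_mat V * P'"
  define F where "F = P * U"
  have EF: "E0 \<in> carrier_mat q d'" "E \<in> carrier_mat q d'" "F \<in> carrier_mat d q"
    using U V V0 Pc by (auto simp: E0_def E_def F_def)
  have DE: "D * E0 = D * b * E"
  proof -
    have Dt: "transpose_mat D = D" by (simp add: D_def transpose_mat_diag)
    have "transpose_mat (P' * V0 * D) = D * E0"
      using Pc V0 D sym Dt transpose_mult[of "P' * V0" d' q D q] transpose_mult[of P' d' d' V0 q] by (simp add: E0_def)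
    moreover have "transpose_mat (P' * V * transpose_mat b * D) = D * (b * E)"
      using Pc V D b sym Dt transpose_mult[of "P' * V * transpose_mat b" d' q D q]
        transpose_mult[of "P' * V" d' q "transpose_mat b" q] transpose_mult[of P' d' d' V q] by (simp add: E_def)
    ultimately show ?thesis using PV D b EF by simp
  qed
  have cs: "F * transpose_mat a \<in> carrier_mat d q" "transpose_mat a \<in> carrier_mat q q" "D * E0 \<in> carrier_mat q d'"
    "transpose_mat a * D \<in> carrier_mat q q" "transpose_mat a * D * b \<in> carrier_mat q q" "b * E \<in> carrier_mat q d'"
    using EF a b D by auto
  have "C = P * U0 * D * E0" by (simp add: C D_def E0_def)
  also have "\<dots> = F * transpose_mat a * D * E0" unfolding PU F_def ..
  also have "\<dots> = F * (transpose_mat a * (D * E0))"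
    by (simp only: assoc_mult_mat[OF cs(1) D EF(1)] assoc_mult_mat[OF EF(3) cs(2,3)])
  also have "\<dots> = F * (transpose_mat a * (D * b * E))" unfolding DE ..
  also have "\<dots> = F * (transpose_mat a * D * b) * E"
    by (simp only: assoc_mult_mat[OF D b EF(2)] assoc_mult_mat[OF EF(3) cs(5) EF(2)] assoc_mult_mat[OF cs(4) b EF(2)]
        assoc_mult_mat[OF cs(2) D cs(6)])
  also have "transpose_mat a * D * b = mat_diag q (\<lambda>i. s $ i)" using tr(1) UCV by (simp add: D_def)
  finally have C': "C = P * U * mat_diag q (\<lambda>i. s $ i) * (transpose_mat V * P')" by (simp add: F_def E_def)
  \<comment> \<open>Feasibility alone allows negative \<open>s\<close>. For a maximizer the rows of
    \<open>a\<close> and \<open>b\<close> agree where \<open>s0\<close> is positive, so each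
    diagonal entry is a nonnegatively weighted sum of squares.\<close>
  have "0 \<le> s $ j" if j: "j < q" for j
  proof -
    have ab: "s0 $ i * (a $$ (i, j) * b $$ (i, j)) = s0 $ i * (a $$ (i, j))\<^sup>2" if i: "i < q" for i
    proof (cases "s0 $ i = 0")
      case False
      then have "Matrix.row a i = Matrix.row b i" using rows(2)[OF i eq1[OF i]] s0_nonneg[OF i] by simp
      then have "Matrix.row a i $ j = Matrix.row b i $ j" by simp
      then show ?thesis using a b i j by (simp add: power2_eq_square)
    qed simp
    have "s $ j = (transpose_mat a * D * b) $$ (j, j)"
      using \<open>transpose_mat a * D * b = mat_diag q (\<lambda>i. s $ i)\<close> j by (simp add: mat_diag_def)
    also have "\<dots> = (\<Sum>i<q. s0 $ i * (a $$ (i, j) * b $$ (i, j)))"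
      using a b j by (auto simp: D_def mat_diag_dim mat_diag_mult_right scalar_prod_def lessThan_atLeast0 mult_ac intro!: sum.cong)
    also have "\<dots> = (\<Sum>i<q. s0 $ i * (a $$ (i, j))\<^sup>2)"
      by (rule sum.cong[OF refl], rule ab) simp
    also have "\<dots> \<ge> 0" using s0_nonneg by (auto intro!: sum_nonneg)
    finally show ?thesis .
  qed
  then show ?thesis using U V s UPU VPV C' by (simp add: cca_svd_def)
qed

section \<open>Comparison of the correlations of two problems\<close>

lemma cca_svd_form:
  assumes Pc: "P \<in> carrier_mat d d" "transpose_mat P = P" and P': "P' \<in> carrier_mat d' d'"
    and svd: "cca_svd d d' q P P' C s U V" and x: "x \<in> carrier_vec d" and y: "y \<in> carrier_vec d'"
  shows "x \<bullet> (C *\<^sub>v y) = (\<Sum>i<q. s $ i * ((transpose_mat U *\<^sub>v (P *\<^sub>v x)) $ i * (transpose_mat V *\<^sub>v (P' *\<^sub>v y)) $ i))"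
proof -
  have U: "U \<in> carrier_mat d q" and V: "V \<in> carrier_mat d' q" and s: "s \<in> carrier_vec q"
    and C: "C = P * U * mat_diag q (\<lambda>i. s $ i) * (transpose_mat V * P')"
    using svd by (auto simp: cca_svd_def)
  define a where "a = transpose_mat U *\<^sub>v (P *\<^sub>v x)"
  define b where "b = transpose_mat V *\<^sub>v (P' *\<^sub>v y)"
  define D where "D = mat_diag q (\<lambda>i. s $ i)"
  have D: "D \<in> carrier_mat q q" by (simp add: D_def mat_diag_dim)
  have a: "a \<in> carrier_vec q" and b: "b \<in> carrier_vec q" using U V Pc P' x y by (auto simp: a_def b_def)
  have VP: "transpose_mat V * P' \<in> carrier_mat q d'" using V P' by simp
  have "C *\<^sub>v y = (P * U * D) *\<^sub>v b"
  proof -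
    have PUD: "P * U * D \<in> carrier_mat d q" using Pc U D by simp
    have "(transpose_mat V * P') *\<^sub>v y = b" using V P' y by (simp add: b_def)
    then show ?thesis using assoc_mult_mat_vec[OF PUD VP y] C by (simp only: D_def)
  qed
  also have "\<dots> = P *\<^sub>v (U *\<^sub>v (D *\<^sub>v b))"
    using assoc_mult_mat_vec[of "P * U" d q D q b] assoc_mult_mat_vec[of P d d U q "D *\<^sub>v b"] Pc U D b by simp
  finally have "x \<bullet> (C *\<^sub>v y) = (U *\<^sub>v (D *\<^sub>v b)) \<bullet> (P *\<^sub>v x)"
    using symmetric_form_commute[OF Pc x, of "U *\<^sub>v (D *\<^sub>v b)"] U D b by simp
  also have "\<dots> = a \<bullet> (D *\<^sub>v b)"
    using transpose_vec_mult_scalar[of U d q "D *\<^sub>v b" "P *\<^sub>v x"] U D b Pc x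
      comm_scalar_prod[of "U *\<^sub>v (D *\<^sub>v b)" d "P *\<^sub>v x"] by (simp add: a_def)
  also have "\<dots> = (\<Sum>i<q. s $ i * (a $ i * b $ i))"
    unfolding D_def mat_diag_mult_vec[OF b] by (simp add: scalar_prod_def lessThan_atLeast0 mult_ac)
  finally show ?thesis by (simp add: a_def b_def)
qed

text \<open>The \<open>k\<close> conditions from \<open>N\<close> and the \<open>q - 1 - k\<close>
  vanishing coordinates are one equation fewer than the unknowns.\<close>

lemma exists_leading_combination:
  fixes N :: "real mat"
  assumes N: "N \<in> carrier_mat q q" and k: "k < q"
  obtains c where "c \<in> carrier_vec q" "c \<noteq> 0\<^sub>v q" "\<And>i. k < i \<Longrightarrow> i < q \<Longrightarrow> c $ i = 0"
    "\<And>i. i < k \<Longrightarrow> (N *\<^sub>v c) $ i = 0"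
proof -
  \<comment> \<open>Row \<open>i\<close> with \<open>k \<le> i\<close> is the unit vector at
    \<open>Suc i\<close>, so these rows make the coordinates \<open>k + 1\<close> to
    \<open>q - 1\<close> vanish.\<close>
  define M where "M = Matrix.mat (q - 1) q (\<lambda>(i, j). if i < k then N $$ (i, j) else if j = Suc i then 1 else 0)"
  have M: "M \<in> carrier_mat (q - 1) q" by (simp add: M_def)
  obtain c where c: "c \<in> carrier_vec q" "c \<noteq> 0\<^sub>v q" "M *\<^sub>v c = 0\<^sub>v (q - 1)"
    using homogeneous_system_nontrivial[OF M] k by auto
  have row: "Matrix.row M i \<bullet> c = 0" if "i < q - 1" for i
    using arg_cong[OF c(3), of "\<lambda>v. v $ i"] that M by simp
  have "c $ i = 0" if "k < i" "i < q" for i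
  proof -
    have "Matrix.row M (i - 1) = unit_vec q i"
      using that by (intro eq_vecI) (auto simp: M_def unit_vec_def)
    then show ?thesis using row[of "i - 1"] that c(1) by simp
  qed
  moreover have "(N *\<^sub>v c) $ i = 0" if "i < k" for i
  proof -
    have "Matrix.row M i = Matrix.row N i" using that k N by (intro eq_vecI) (auto simp: M_def)
    then show ?thesis using row[of i] that k N by simp
  qed
  ultimately show thesis using that c by blast
qed

text \<open>
  The test vectors lie in the span of the first \<open>k + 1\<close> weights of the second problem
  and are orthogonal to the first \<open>k\<close> weights of the first one.
\<close>
lemma cca_weyl:
  assumes P: "psd d P" and P': "psd d' P'" and svd: "cca_svd d d' q P P' C s U V" and mono: "nonincreasing s"
    and Q: "Q \<in> carrier_mat d d" "Q' \<in> carrier_mat d' d'" "C2 \<in> carrier_mat d d'"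
    and U2: "U2 \<in> carrier_mat d q" and V2: "V2 \<in> carrier_mat d' q" and s2: "s2 \<in> carrier_vec q"
    and UQU: "transpose_mat U2 * Q * U2 = 1\<^sub>m q" and VQV: "transpose_mat V2 * Q' * V2 = 1\<^sub>m q"
    and UCV: "transpose_mat U2 * C2 * V2 = mat_diag q (\<lambda>i. s2 $ i)" and mono2: "nonincreasing s2"
    and K: "0 \<le> K" and PQ: "\<And>x. x \<in> carrier_vec d \<Longrightarrow> x \<bullet> (P *\<^sub>v x) \<le> K * (x \<bullet> (Q *\<^sub>v x))"
    and PQ': "\<And>y. y \<in> carrier_vec d' \<Longrightarrow> y \<bullet> (P' *\<^sub>v y) \<le> K * (y \<bullet> (Q' *\<^sub>v y))"
    and CC: "\<And>x y. x \<in> carrier_vec d \<Longrightarrow> y \<in> carrier_vec d' \<Longrightarrow>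
       x \<bullet> (C2 *\<^sub>v y) \<le> x \<bullet> (C *\<^sub>v y) + e * sqrt (x \<bullet> (Q *\<^sub>v x)) * sqrt (y \<bullet> (Q' *\<^sub>v y))"
    and k: "k < q"
  shows "s2 $ k \<le> K * s $ k + e"
proof -
  have Pc: "P \<in> carrier_mat d d" "P' \<in> carrier_mat d' d'" and sym: "transpose_mat P = P"
    using P P' by (auto simp: psd_def)
  have U: "U \<in> carrier_mat d q" and V: "V \<in> carrier_mat d' q" and s: "s \<in> carrier_vec q"
    and UPU: "transpose_mat U * P * U = 1\<^sub>m q" and VPV: "transpose_mat V * P' * V = 1\<^sub>m q"
    and s0: "\<And>i. i < q \<Longrightarrow> 0 \<le> s $ i"
    using svd by (auto simp: cca_svd_def)
  \<comment> \<open>Only the coordinates of \<open>y\<close> below \<open>k\<close> are made zero.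
    Each term of the bilinear form has such a coordinate as a factor, so treating one side suffices
    and costs \<open>k\<close> conditions instead of \<open>2 * k\<close>.\<close>
  define N where "N = transpose_mat V * P' * V2"
  have N: "N \<in> carrier_mat q q" using V V2 Pc by (simp add: N_def)
  obtain c where c: "c \<in> carrier_vec q" "c \<noteq> 0\<^sub>v q" and c_late: "\<And>i. k < i \<Longrightarrow> i < q \<Longrightarrow> c $ i = 0"
    and Nc: "\<And>i. i < k \<Longrightarrow> (N *\<^sub>v c) $ i = 0"
    using exists_leading_combination[OF N k] by blast
  define x where "x = U2 *\<^sub>v c"
  define y where "y = V2 *\<^sub>v c"
  have x: "x \<in> carrier_vec d" and y: "y \<in> carrier_vec d'" using U2 V2 c by (auto simp: x_def y_def)
  have xQx: "x \<bullet> (Q *\<^sub>v x) = c \<bullet> c" and yQy: "y \<bullet> (Q' *\<^sub>v y) = c \<bullet> c"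
    using form_mult_mat[OF Q(1) U2 U2 c(1) c(1)] form_mult_mat[OF Q(2) V2 V2 c(1) c(1)] UQU VQV c(1)
    by (simp_all add: x_def y_def)
  have cc: "0 < c \<bullet> c" using scalar_prod_self_eq_0[OF c(1)] c(2) scalar_prod_self_nonneg[of c] by linarith
  define a where "a = transpose_mat U *\<^sub>v (P *\<^sub>v x)"
  define b where "b = transpose_mat V *\<^sub>v (P' *\<^sub>v y)"
  have a: "a \<in> carrier_vec q" and b: "b \<in> carrier_vec q" using U V Pc x y by (auto simp: a_def b_def)
  have bN: "b = N *\<^sub>v c"
    using V V2 Pc c y assoc_mult_mat_vec[of "transpose_mat V * P'" q d' V2 q c]
      assoc_mult_mat_vec[of "transpose_mat V" q d' P' d' y] by (simp add: b_def N_def y_def)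
  have aa: "a \<bullet> a \<le> K * (c \<bullet> c)" using bessel(2)[OF P U UPU x] PQ[OF x] xQx by (simp add: a_def)
  have bb: "b \<bullet> b \<le> K * (c \<bullet> c)" using bessel(2)[OF P' V VPV y] PQ'[OF y] yQy by (simp add: b_def)
  have sum_sq: "v \<bullet> v = (\<Sum>i<q. (v $ i)\<^sup>2)" if "v \<in> carrier_vec q" for v :: "real Matrix.vec"
    using that scalar_prod_self[of v] by simp
  have "x \<bullet> (C *\<^sub>v y) = (\<Sum>i<q. s $ i * (a $ i * b $ i))"
    unfolding a_def b_def by (rule cca_svd_form[OF Pc(1) sym Pc(2) svd x y])
  \<comment> \<open>For \<open>k \<le> i\<close> the product of coordinates may be negative. It is
    therefore first replaced by the mean of the squares, and only then \<open>s $ i\<close> by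
    \<open>s $ k\<close>.\<close>
  also have "\<dots> \<le> (\<Sum>i<q. s $ k * (((a $ i)\<^sup>2 + (b $ i)\<^sup>2) / 2))"
  proof (rule sum_mono)
    fix i assume "i \<in> {..<q}"
    then have i: "i < q" by simp
    have amgm: "a $ i * b $ i \<le> ((a $ i)\<^sup>2 + (b $ i)\<^sup>2) / 2"
      using sum_squares_bound[of "a $ i" "b $ i"] by simp
    show "s $ i * (a $ i * b $ i) \<le> s $ k * (((a $ i)\<^sup>2 + (b $ i)\<^sup>2) / 2)"
    proof (cases "i < k")
      case True
      then show ?thesis using Nc[OF True] bN s0[OF k] by simp
    next
      case False
      then have "s $ i \<le> s $ k" using mono i s by (simp add: nonincreasing_def)
      then show ?thesis
        using mult_left_mono[OF amgm s0[OF i]] mult_right_mono[of "s $ i" "s $ k" "((a $ i)\<^sup>2 + (b $ i)\<^sup>2) / 2"]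
        by fastforce
    qed
  qed
  also have "\<dots> = s $ k * ((a \<bullet> a + b \<bullet> b) / 2)"
    by (simp add: sum_sq[OF a] sum_sq[OF b] sum_distrib_left sum.distrib add_divide_distrib distrib_left sum_divide_distrib)
  also have "\<dots> \<le> s $ k * (K * (c \<bullet> c))"
    using aa bb s0[OF k] by (intro mult_left_mono) auto
  finally have upper: "x \<bullet> (C *\<^sub>v y) \<le> s $ k * (K * (c \<bullet> c))" .
  have "s2 $ k * (c \<bullet> c) = (\<Sum>i<q. s2 $ k * (c $ i)\<^sup>2)" by (simp add: sum_sq[OF c(1)] sum_distrib_left)
  \<comment> \<open>\<open>c\<close> is supported on the indices up to \<open>k\<close>, where
    \<open>s2 $ i\<close> is at least \<open>s2 $ k\<close>.\<close>
  also have "\<dots> \<le> (\<Sum>i<q. c $ i * (s2 $ i * c $ i))"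
  proof (rule sum_mono)
    fix i assume "i \<in> {..<q}"
    then have i: "i < q" by simp
    show "s2 $ k * (c $ i)\<^sup>2 \<le> c $ i * (s2 $ i * c $ i)"
    proof (cases "k < i")
      case True
      then show ?thesis using c_late[OF True i] by simp
    next
      case False
      then have "s2 $ k \<le> s2 $ i" using mono2 k s2 by (simp add: nonincreasing_def)
      then show ?thesis using mult_right_mono[of "s2 $ k" "s2 $ i" "(c $ i)\<^sup>2"] by (simp add: power2_eq_square mult_ac)
    qed
  qed
  also have "\<dots> = c \<bullet> (mat_diag q (\<lambda>i. s2 $ i) *\<^sub>v c)"
    unfolding mat_diag_mult_vec[OF c(1)] by (simp add: scalar_prod_def lessThan_atLeast0)
  also have "\<dots> = x \<bullet> (C2 *\<^sub>v y)" using form_mult_mat[OF Q(3) U2 V2 c(1) c(1)] UCV by (simp add: x_def y_def)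
  also have "\<dots> \<le> x \<bullet> (C *\<^sub>v y) + e * (c \<bullet> c)" using CC[OF x y] cc by (simp add: xQx yQy mult.assoc)
  finally have "s2 $ k * (c \<bullet> c) \<le> (K * s $ k + e) * (c \<bullet> c)" using upper by (simp add: algebra_simps)
  then show ?thesis using cc by simp
qed

section \<open>Existence and characterization of maximizers\<close>

text \<open>The weights are whitened singular vectors of
  \<open>M = transpose_mat W * C * W'\<close>. The whitening identities for \<open>A\<close> and
  \<open>B\<close> recover \<open>C\<close> from \<open>M\<close>, also when the regularized Gram
  matrices are singular.\<close>

lemma cca_svd_exists:
  assumes A: "A \<in> carrier_mat n d" and B: "B \<in> carrier_mat n d'" and lam: "0 \<le> lam1" "0 \<le> lam2"
  obtains s U V where
    "cca_svd d d' (cca_dim lam1 lam2 A B) (reg_gram lam1 A) (reg_gram lam2 B) (transpose_mat A * B) s U V"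
    "nonincreasing s"
proof -
  define P where "P = reg_gram lam1 A"
  define P' where "P' = reg_gram lam2 B"
  define r where "r = mat_rank P"
  define r' where "r' = mat_rank P'"
  define q where "q = min r r'"
  define C where "C = transpose_mat A * B"
  have P: "P \<in> carrier_mat d d" "P' \<in> carrier_mat d' d'" and sym: "transpose_mat P = P" "transpose_mat P' = P'"
    using A B by (auto simp: P_def P'_def reg_gram_symmetric)
  have C: "C \<in> carrier_mat d d'" using A B by (simp add: C_def)
  obtain W where W: "W \<in> carrier_mat d r" "transpose_mat W * P * W = 1\<^sub>m r" "A * (W * (transpose_mat W * P)) = A"
    using whitening[OF A lam(1)] by (metis P_def r_def)
  obtain W' where W': "W' \<in> carrier_mat d' r'" "transpose_mat W' * P' * W' = 1\<^sub>m r'" "B * (W' * (transpose_mat W' * P')) = B"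
    using whitening[OF B lam(2)] by (metis P'_def r'_def)
  define M where "M = transpose_mat W * C * W'"
  have M: "M \<in> carrier_mat r r'" using W W' C by (simp add: M_def)
  obtain X Y s where X: "X \<in> carrier_mat r q" "transpose_mat X * X = 1\<^sub>m q"
    and Y: "Y \<in> carrier_mat r' q" "transpose_mat Y * Y = 1\<^sub>m q"
    and s: "s \<in> carrier_vec q" "nonincreasing s" "\<forall>i<q. 0 \<le> s $ i"
    and MXY: "M = X * mat_diag q (\<lambda>i. s $ i) * transpose_mat Y"
    using singular_value_decomposition[OF M] unfolding q_def by blast
  define D where "D = mat_diag q (\<lambda>i. s $ i)"
  have D: "D \<in> carrier_mat q q" by (simp add: D_def mat_diag_dim)
  define U where "U = W * X"
  define V where "V = W' * Y"
  have U: "U \<in> carrier_mat d q" and V: "V \<in> carrier_mat d' q" using W W' X Y by (auto simp: U_def V_def)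
  have gram: "transpose_mat (W0 * X0) * R * (W0 * X0) = 1\<^sub>m q"
    if "W0 \<in> carrier_mat k l" "X0 \<in> carrier_mat l q" "R \<in> carrier_mat k k"
      "transpose_mat W0 * R * W0 = 1\<^sub>m l" "transpose_mat X0 * X0 = 1\<^sub>m q" for W0 X0 R :: "real mat" and k l
  proof -
    have "transpose_mat (W0 * X0) * R * (W0 * X0) = transpose_mat X0 * (transpose_mat W0 * R * W0) * X0"
    proof -
      have c: "transpose_mat X0 \<in> carrier_mat q l" "transpose_mat W0 \<in> carrier_mat l k"
        "transpose_mat W0 * R \<in> carrier_mat l k" "W0 * X0 \<in> carrier_mat k q"
        "transpose_mat W0 * R * W0 \<in> carrier_mat l l" using that(1-3) by auto
      show ?thesis
        by (simp only: transpose_mult[OF that(1,2)] assoc_mult_mat[OF c(1,2) that(3)]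
            assoc_mult_mat[OF c(1,3,4)] assoc_mult_mat[OF c(3) that(1,2)] assoc_mult_mat[OF c(1,5) that(2)])
    qed
    then show ?thesis using that by simp
  qed
  have UPU: "transpose_mat U * P * U = 1\<^sub>m q" unfolding U_def by (rule gram) (use W X P in auto)
  have VPV: "transpose_mat V * P' * V = 1\<^sub>m q" unfolding V_def by (rule gram) (use W' Y P in auto)
  define F where "F = P * W"
  define E where "E = transpose_mat W' * P'"
  have F: "F \<in> carrier_mat d r" and E: "E \<in> carrier_mat r' d'" using W W' P by (auto simp: F_def E_def)
  \<comment> \<open>Transposing the whitening identity puts \<open>P * W\<close> at the left end of
    \<open>C\<close>; \<open>BE\<close> puts \<open>transpose_mat W' * P'\<close> at its right
    end.\<close>
  have At: "transpose_mat A = F * (transpose_mat W * transpose_mat A)"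
  proof -
    have "transpose_mat A = transpose_mat (A * (W * (transpose_mat W * P)))" using W(3) by simp
    also have "\<dots> = transpose_mat (transpose_mat W * P) * transpose_mat W * transpose_mat A"
      using A W(1) P transpose_mult[of A n d "W * (transpose_mat W * P)" d] transpose_mult[of W d r "transpose_mat W * P" d]
      by (simp del: assoc_mult_mat)
    also have "transpose_mat (transpose_mat W * P) = F"
      using W(1) P sym transpose_mult[of "transpose_mat W" r d P d] by (simp add: F_def)
    finally show ?thesis using assoc_mult_mat[of F d r "transpose_mat W" d "transpose_mat A" n] F W A by simp
  qed
  have BE: "B = B * W' * E" using W'(1,3) B E by (simp add: E_def assoc_mult_mat[of B n d' W' r' E d'])
  have "C = F * (transpose_mat W * transpose_mat A) * (B * W' * E)" unfolding C_def using At BE by simp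
  also have "\<dots> = F * M * E"
  proof -
    define Z where "Z = transpose_mat W * transpose_mat A"
    have Z: "Z \<in> carrier_mat r n" using W A by (simp add: Z_def)
    have BW: "B * W' \<in> carrier_mat n r'" using B W' by simp
    have "M = Z * (B * W')"
      using W W' A B assoc_mult_mat[of "transpose_mat W" r d "transpose_mat A" n B d']
        assoc_mult_mat[of Z r n B d' W' r'] Z by (simp add: M_def C_def Z_def del: assoc_mult_mat)
    moreover have "F * Z * (B * W' * E) = F * (Z * (B * W')) * E"
      using F Z BW E assoc_mult_mat[of "F * Z" d n "B * W'" r' E d'] assoc_mult_mat[of F d r Z n "B * W'" r']
      by (simp del: assoc_mult_mat)
    ultimately show ?thesis by (simp add: Z_def)
  qed
  also have "\<dots> = (F * X) * D * (transpose_mat Y * E)"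
    unfolding MXY D_def[symmetric]
    using F X Y D E assoc_mult_mat[of F d r "X * D" q "transpose_mat Y" r'] assoc_mult_mat[of F d r X q D q]
      assoc_mult_mat[of "F * X * D" d q "transpose_mat Y" r' E d'] by (simp del: assoc_mult_mat)
  also have "F * X = P * U" using P W X by (simp add: F_def U_def)
  also have "transpose_mat Y * E = transpose_mat V * P'"
    using P W' Y transpose_mult[OF W'(1) Y(1)] assoc_mult_mat[of "transpose_mat Y" q r' "transpose_mat W'" d' P' d']
    by (simp add: E_def V_def del: assoc_mult_mat)
  finally have "cca_svd d d' q P P' C s U V"
    using U V s UPU VPV by (simp add: cca_svd_def D_def)
  moreover have "q = cca_dim lam1 lam2 A B" by (simp add: q_def r_def r'_def P_def P'_def cca_dim_def)
  ultimately show thesis using that s(2) by (simp add: P_def P'_def C_def)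
qed

text \<open>\<open>cca_svd_exists\<close> supplies one decomposition, and its trace is the sum of
  its \<open>s0\<close>. Every decomposition attains an upper bound for all feasible traces, and
  every maximizer reaches at least the sum of \<open>s0\<close>, which is the hypothesis of
  \<open>cca_svdI_maximal\<close>.\<close>

lemma is_cca_iff:
  assumes A: "A \<in> carrier_mat n d" and B: "B \<in> carrier_mat n d'" and lam: "0 \<le> lam1" "0 \<le> lam2"
  shows "is_cca lam1 lam2 A B s U V \<longleftrightarrow>
    cca_svd d d' (cca_dim lam1 lam2 A B) (reg_gram lam1 A) (reg_gram lam2 B) (transpose_mat A * B) s U V \<and> nonincreasing s"
proof -
  define P where "P = reg_gram lam1 A"
  define P' where "P' = reg_gram lam2 B"
  define q where "q = cca_dim lam1 lam2 A B"
  define C where "C = transpose_mat A * B"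
  have psd: "psd d P" "psd d' P'" using psd_reg_gram A B lam by (auto simp: P_def P'_def)
  have feas: "cca_feasible lam1 lam2 A B s U V \<longleftrightarrow> s \<in> carrier_vec q \<and> nonincreasing s \<and>
        U \<in> carrier_mat d q \<and> V \<in> carrier_mat d' q \<and> transpose_mat U * P * U = 1\<^sub>m q \<and>
        transpose_mat V * P' * V = 1\<^sub>m q \<and> transpose_mat U * C * V = mat_diag q (\<lambda>i. s $ i)" for s U V
    using A B by (simp add: cca_feasible_def Let_def P_def P'_def q_def C_def)
  have svd_feas: "cca_feasible lam1 lam2 A B s U V" "mat_trace (transpose_mat U * C * V) = (\<Sum>i<q. s $ i)"
    if svd: "cca_svd d d' q P P' C s U V" and mono: "nonincreasing s" for s U V
  proof -
    have U: "U \<in> carrier_mat d q" and V: "V \<in> carrier_mat d' q" and s: "s \<in> carrier_vec q"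
      and UPU: "transpose_mat U * P * U = 1\<^sub>m q" and VPV: "transpose_mat V * P' * V = 1\<^sub>m q"
      using svd by (auto simp: cca_svd_def)
    have D: "mat_diag q (\<lambda>i. s $ i) \<in> carrier_mat q q" by (simp add: mat_diag_dim)
    have UCV: "transpose_mat U * C * V = mat_diag q (\<lambda>i. s $ i)"
      using cca_svd_trace_le(1)[OF psd svd U V UPU VPV] D by (simp add: UPU VPV)
    then show "cca_feasible lam1 lam2 A B s U V" using feas mono U V s UPU VPV by blast
    show "mat_trace (transpose_mat U * C * V) = (\<Sum>i<q. s $ i)"
      unfolding UCV mat_trace_eq_sum[OF D] by (simp add: mat_diag_def)
  qed
  have bound: "mat_trace (transpose_mat U' * C * V') \<le> (\<Sum>i<q. s $ i)"
    if svd: "cca_svd d d' q P P' C s U V" and f: "cca_feasible lam1 lam2 A B s' U' V'" for s U V s' U' V'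
  proof -
    have U': "U' \<in> carrier_mat d q" and V': "V' \<in> carrier_mat d' q"
      and UPU: "transpose_mat U' * P * U' = 1\<^sub>m q" and VPV: "transpose_mat V' * P' * V' = 1\<^sub>m q"
      using f feas by blast+
    have s0: "0 \<le> s $ i" if "i < q" for i using svd that by (simp add: cca_svd_def)
    define a where "a = transpose_mat U * P * U'"
    define b where "b = transpose_mat V * P' * V'"
    note tr = cca_svd_trace_le[OF psd svd U' V' UPU VPV, folded a_def b_def]
    have "Matrix.row a i \<bullet> Matrix.row b i \<le> 1" if i: "i < q" for i
    proof -
      have dims: "dim_col a = q" "dim_col b = q" using U' V' by (auto simp: a_def b_def)
      have "Matrix.row a i \<bullet> Matrix.row b i \<le> (Matrix.row a i \<bullet> Matrix.row a i + Matrix.row b i \<bullet> Matrix.row b i) / 2"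
        by (rule scalar_prod_le_mean[of _ q]) (use dims in \<open>auto intro: carrier_vecI\<close>)
      then show ?thesis using tr(3,4)[OF i] by simp
    qed
    then show ?thesis unfolding tr(2) using s0 by (intro sum_mono) (auto intro!: mult_left_le)
  qed
  obtain s0 U0 V0 where svd0: "cca_svd d d' q P P' C s0 U0 V0" "nonincreasing s0"
    using cca_svd_exists[OF A B lam] by (auto simp: P_def P'_def q_def C_def)
  have "is_cca lam1 lam2 A B s U V \<longleftrightarrow> cca_svd d d' q P P' C s U V \<and> nonincreasing s"
  proof
    assume cca: "is_cca lam1 lam2 A B s U V"
    then have f: "cca_feasible lam1 lam2 A B s U V" by (simp add: is_cca_def)
    have "mat_trace (transpose_mat U0 * C * V0) \<le> mat_trace (transpose_mat U * C * V)"
      using cca svd_feas(1)[OF svd0] unfolding is_cca_def C_def by blast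
    then have "(\<Sum>i<q. s0 $ i) \<le> mat_trace (transpose_mat U * C * V)" using svd_feas(2)[OF svd0] by simp
    with f show "cca_svd d d' q P P' C s U V \<and> nonincreasing s"
      using cca_svdI_maximal[OF psd svd0(1)] feas by blast
  next
    assume svd: "cca_svd d d' q P P' C s U V \<and> nonincreasing s"
    then show "is_cca lam1 lam2 A B s U V"
      using svd_feas[of s U V] bound[of s U V] unfolding is_cca_def C_def by auto
  qed
  then show ?thesis by (simp add: P_def P'_def q_def C_def)
qed

section \<open>Second moment of CountSketch\<close>

text \<open>Outside the \<open>n\<close> columns the functions take the default
  \<open>(0, 1)\<close>, as in \<open>sparse_embedding_pmf\<close>. This keeps the set finite, so
  that for \<open>0 < m\<close> expectations are averages over it.\<close>

definition sketch_choices :: "nat \<Rightarrow> nat \<Rightarrow> (nat \<Rightarrow> nat \<times> real) set" where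
  "sketch_choices m n = PiE_dflt {..<n} (0, 1) (\<lambda>_. {..<m} \<times> {-1, 1})"

definition sketch_mat :: "nat \<Rightarrow> nat \<Rightarrow> (nat \<Rightarrow> nat \<times> real) \<Rightarrow> real mat" where
  "sketch_mat m n f = Matrix.mat m n (\<lambda>(i, j). if i = fst (f j) then snd (f j) else 0)"

lemma finite_sketch_choices: "finite (sketch_choices m n)"
  unfolding sketch_choices_def by (intro finite_PiE_dflt) auto

lemma sketch_choices_nonempty: "0 < m \<Longrightarrow> sketch_choices m n \<noteq> {}"
  unfolding sketch_choices_def by (subst PiE_dflt_empty_iff) auto

lemma sketch_choicesD:
  assumes "f \<in> sketch_choices m n" "j < n"
  shows "fst (f j) < m" "snd (f j) = -1 \<or> snd (f j) = 1" "snd (f j) * snd (f j) = 1"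
  using assms by (auto simp: sketch_choices_def PiE_dflt_def mem_Times_iff)

lemma sparse_embedding_pmf_eq:
  assumes "0 < m"
  shows "sparse_embedding_pmf m n = map_pmf (sketch_mat m n) (pmf_of_set (sketch_choices m n))"
  using assms unfolding sparse_embedding_pmf_def sketch_choices_def sketch_mat_def
  by (subst Pi_pmf_of_set) auto

definition sketch_mean :: "nat \<Rightarrow> nat \<Rightarrow> ((nat \<Rightarrow> nat \<times> real) \<Rightarrow> real) \<Rightarrow> real" where
  "sketch_mean m n g = measure_pmf.expectation (pmf_of_set (sketch_choices m n)) g"

lemma sketch_mean_eq:
  assumes "0 < m"
  shows "sketch_mean m n g = (\<Sum>f\<in>sketch_choices m n. g f) / card (sketch_choices m n)"
  unfolding sketch_mean_def
  by (rule integral_pmf_of_set[OF sketch_choices_nonempty[OF assms] finite_sketch_choices])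

lemma sketch_mean_linear:
  assumes "0 < m"
  shows "sketch_mean m n (\<lambda>f. \<Sum>i\<in>I. c i * g i f) = (\<Sum>i\<in>I. c i * sketch_mean m n (g i))"
  unfolding sketch_mean_eq[OF assms]
  by (subst sum.swap) (simp add: sum_divide_distrib[of _ I] flip: sum_distrib_left)

lemma sketch_mean_sum:
  assumes "0 < m"
  shows "sketch_mean m n (\<lambda>f. \<Sum>i\<in>I. g i f) = (\<Sum>i\<in>I. sketch_mean m n (g i))"
  using sketch_mean_linear[OF assms, where c = "\<lambda>_. 1" and g = g and I = I] by simp

text \<open>This is entry \<open>p\<close> of \<open>transpose_mat S * S\<close> for the sketch
  \<open>S\<close>: two columns interact only if their nonzero entries share a row.\<close>

definition pair_sign :: "(nat \<Rightarrow> nat \<times> real) \<Rightarrow> nat \<times> nat \<Rightarrow> real" where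
  "pair_sign f p = (if fst (f (fst p)) = fst (f (snd p)) then snd (f (fst p)) * snd (f (snd p)) else 0)"

text \<open>Flipping the sign of column \<open>j\<close> permutes the sample space.\<close>
lemma sketch_mean_odd:
  assumes m: "0 < m" and j: "j < n"
    and odd: "\<And>f. f \<in> sketch_choices m n \<Longrightarrow> g (f(j := (fst (f j), - snd (f j)))) = - g f"
  shows "sketch_mean m n g = 0"
proof -
  define T where "T f = f(j := (fst (f j), - snd (f j)))" for f :: "nat \<Rightarrow> nat \<times> real"
  have TT: "T (T f) = f" for f by (simp add: T_def fun_eq_iff)
  have Tin: "T f \<in> sketch_choices m n" if "f \<in> sketch_choices m n" for f
    using that j by (auto simp: T_def sketch_choices_def PiE_dflt_def mem_Times_iff)
  have "(\<Sum>f\<in>sketch_choices m n. g f) = (\<Sum>f\<in>sketch_choices m n. g (T f))"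
    by (rule sum.reindex_bij_witness[of _ T T]) (auto simp: TT Tin)
  also have "\<dots> = - (\<Sum>f\<in>sketch_choices m n. g f)"
    using odd by (simp add: T_def sum_negf)
  finally show ?thesis unfolding sketch_mean_eq[OF m] by simp
qed

text \<open>Cyclic shifts of the row of column \<open>j\<close> permute the sample space, and
  exactly one of the \<open>m\<close> shifts moves it to the row of column \<open>l\<close>.
  Averaging over the shifts gives \<open>1 / m\<close>.\<close>

lemma sketch_mean_collision:
  assumes m: "0 < m" and j: "j < n" "l < n" "j \<noteq> l"
  shows "sketch_mean m n (\<lambda>f. if fst (f j) = fst (f l) then 1 else 0) = 1 / m"
proof -
  define T where "T t f = f(j := ((fst (f j) + t) mod m, snd (f j)))" for t and f :: "nat \<Rightarrow> nat \<times> real"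
  define I where "I f = (if fst (f j) = fst (f l) then 1 else 0 :: real)" for f :: "nat \<Rightarrow> nat \<times> real"
  have Tin: "T t f \<in> sketch_choices m n" if "f \<in> sketch_choices m n" for t f
    using that j m by (auto simp: T_def sketch_choices_def PiE_dflt_def mem_Times_iff)
  have inv: "T t (T u f) = f" if "f \<in> sketch_choices m n" "(t + u) mod m = 0" for t u f
  proof -
    have h: "fst (f j) < m" using sketch_choicesD(1)[OF that(1) j(1)] .
    have "((fst (f j) + u) mod m + t) mod m = (fst (f j) + (t + u)) mod m"
      by (metis mod_add_left_eq add.assoc add.commute)
    also have "\<dots> = fst (f j)" using h that(2) by (metis mod_add_right_eq add.right_neutral mod_less)
    finally show ?thesis by (simp add: T_def)
  qed
  have shift: "(\<Sum>f\<in>sketch_choices m n. I f) = (\<Sum>f\<in>sketch_choices m n. I (T t f))" if "t < m" for t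
  proof (rule sum.reindex_bij_witness[of _ "T t" "T (m - t)"])
    fix f assume f: "f \<in> sketch_choices m n"
    show "T (m - t) f \<in> sketch_choices m n" "T t f \<in> sketch_choices m n" using f by (auto intro: Tin)
    show "T t (T (m - t) f) = f" "T (m - t) (T t f) = f" using f that by (auto intro!: inv)
    then show "I (T t (T (m - t) f)) = I f" by simp
  qed
  have one: "(\<Sum>t<m. I (T t f)) = 1" if f: "f \<in> sketch_choices m n" for f
  proof -
    define a where "a = fst (f j)"
    define b where "b = fst (f l)"
    have ab: "a < m" "b < m" using sketch_choicesD(1)[OF f] j by (auto simp: a_def b_def)
    \<comment> \<open>\<open>b + (m - a)\<close> is the difference modulo \<open>m\<close>, arranged
      so that natural subtraction does not truncate.\<close>
    have "(a + t) mod m = b \<longleftrightarrow> t = (b + (m - a)) mod m" if "t < m" for t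
    proof
      assume "(a + t) mod m = b"
      then have "(b + (m - a)) mod m = ((a + t) + (m - a)) mod m" by (metis mod_add_left_eq)
      also have "\<dots> = (t + m) mod m" using ab by simp
      finally show "t = (b + (m - a)) mod m" using that by simp
    next
      assume "t = (b + (m - a)) mod m"
      then have "(a + t) mod m = (a + (b + (m - a))) mod m" by (metis mod_add_right_eq)
      also have "\<dots> = (b + m) mod m" using ab by simp
      finally show "(a + t) mod m = b" using ab by simp
    qed
    then have "(\<Sum>t<m. I (T t f)) = (\<Sum>t<m. if t = (b + (m - a)) mod m then 1 else 0)"
      using j by (intro sum.cong) (auto simp: I_def T_def a_def b_def)
    also have "\<dots> = 1" using m by (subst sum.delta) auto
    finally show ?thesis .
  qed
  have "m * (\<Sum>f\<in>sketch_choices m n. I f) = (\<Sum>t<m. \<Sum>f\<in>sketch_choices m n. I f)" by simp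
  also have "\<dots> = (\<Sum>t<m. \<Sum>f\<in>sketch_choices m n. I (T t f))" by (rule sum.cong[OF refl], rule shift) simp
  also have "\<dots> = (\<Sum>f\<in>sketch_choices m n. \<Sum>t<m. I (T t f))" by (rule sum.swap)
  also have "\<dots> = card (sketch_choices m n)" using one by simp
  finally have "m * (\<Sum>f\<in>sketch_choices m n. I f) = card (sketch_choices m n)" .
  moreover have "card (sketch_choices m n) > 0"
    using sketch_choices_nonempty[OF m] finite_sketch_choices by (simp add: card_gt_0_iff)
  ultimately show ?thesis using m unfolding sketch_mean_eq[OF m] I_def[symmetric]
    by (simp add: field_simps)
qed

text \<open>For equal unordered pairs the signs cancel and the collision probability remains.
  Otherwise some column occurs in exactly one of the pairs, and flipping its sign negates the
  product.\<close>

lemma sketch_mean_pair_sign: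
  assumes m: "0 < m" and p: "fst p < n" "snd p < n" "fst p \<noteq> snd p"
    and r: "fst r < n" "snd r < n" "fst r \<noteq> snd r"
  shows "sketch_mean m n (\<lambda>f. pair_sign f p * pair_sign f r) = (if r = p \<or> r = prod.swap p then 1 / m else 0)"
proof (cases "r = p \<or> r = prod.swap p")
  case True
  have "pair_sign f p * pair_sign f r = (if fst (f (fst p)) = fst (f (snd p)) then 1 else 0)"
    if f: "f \<in> sketch_choices m n" for f
    using True sketch_choicesD(2)[OF f p(1)] sketch_choicesD(2)[OF f p(2)] by (auto simp: pair_sign_def)
  then have "sketch_mean m n (\<lambda>f. pair_sign f p * pair_sign f r)
      = sketch_mean m n (\<lambda>f. if fst (f (fst p)) = fst (f (snd p)) then 1 else 0)"
    unfolding sketch_mean_eq[OF m] by simp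
  then show ?thesis using sketch_mean_collision[OF m p] True by simp
next
  case False
  have "{fst p, snd p} \<noteq> {fst r, snd r}"
    using False by (cases p; cases r) (auto simp: doubleton_eq_iff)
  then obtain j where "(j \<in> {fst p, snd p}) \<noteq> (j \<in> {fst r, snd r})" by blast
  then have j: "j < n" "(j = fst p \<or> j = snd p) \<noteq> (j = fst r \<or> j = snd r)" using p r by auto
  have "sketch_mean m n (\<lambda>f. pair_sign f p * pair_sign f r) = 0"
    by (rule sketch_mean_odd[OF m j(1)]) (use j(2) p(3) r(3) in \<open>auto simp: pair_sign_def\<close>)
  then show ?thesis using False by simp
qed

text \<open>In the expanded square, \<open>p\<close> correlates only with itself and with its swap.
  Bounding the product of the two coefficients by the mean of their squares gives the factor
  2.\<close>

lemma sketch_mean_square: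
  fixes c :: "nat \<times> nat \<Rightarrow> real" and n :: nat
  assumes m: "0 < m"
  defines "D \<equiv> {p :: nat \<times> nat. fst p < n \<and> snd p < n \<and> fst p \<noteq> snd p}"
  shows "sketch_mean m n (\<lambda>f. (\<Sum>p\<in>D. c p * pair_sign f p)\<^sup>2) \<le> 2 / m * (\<Sum>p\<in>D. (c p)\<^sup>2)"
proof -
  have fin: "finite D" by (rule finite_subset[of _ "{..<n} \<times> {..<n}"]) (auto simp: D_def mem_Times_iff)
  have sw: "prod.swap p \<in> D \<longleftrightarrow> p \<in> D" for p by (auto simp: D_def)
  have "sketch_mean m n (\<lambda>f. (\<Sum>p\<in>D. c p * pair_sign f p)\<^sup>2)
      = sketch_mean m n (\<lambda>f. \<Sum>p\<in>D. c p * (\<Sum>r\<in>D. c r * (pair_sign f p * pair_sign f r)))"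
    by (simp add: power2_eq_square sum_product sum_distrib_left mult_ac)
  also have "\<dots> = (\<Sum>p\<in>D. c p * (\<Sum>r\<in>D. c r * sketch_mean m n (\<lambda>f. pair_sign f p * pair_sign f r)))"
    by (simp add: sketch_mean_linear[OF m])
  also have "\<dots> = (\<Sum>p\<in>D. c p * ((c p + c (prod.swap p)) / m))"
  proof (rule sum.cong[OF refl])
    fix p assume p: "p \<in> D"
    then have ne: "p \<noteq> prod.swap p" by (cases p) (auto simp: D_def)
    have "(\<Sum>r\<in>D. c r * sketch_mean m n (\<lambda>f. pair_sign f p * pair_sign f r))
        = (\<Sum>r\<in>D. if r = p \<or> r = prod.swap p then c r / m else 0)"
      using p by (intro sum.cong) (auto simp: D_def sketch_mean_pair_sign[OF m])
    also have "\<dots> = (\<Sum>r\<in>{p, prod.swap p}. c r / m)"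
      using p sw[of p] by (intro sum.mono_neutral_cong_right[OF fin]) auto
    also have "\<dots> = (c p + c (prod.swap p)) / m" using ne by (simp add: add_divide_distrib)
    finally show "c p * (\<Sum>r\<in>D. c r * sketch_mean m n (\<lambda>f. pair_sign f p * pair_sign f r))
        = c p * ((c p + c (prod.swap p)) / m)" by simp
  qed
  \<comment> \<open>This is one square plus half of both squares. The swapped squares have the same
    total, so the factor becomes 3/2 + 1/2 = 2.\<close>
  also have "\<dots> \<le> (\<Sum>p\<in>D. ((3 * (c p)\<^sup>2 + (c (prod.swap p))\<^sup>2) / 2) / m)"
  proof (rule sum_mono)
    fix p
    have "c p * (c p + c (prod.swap p)) \<le> (3 * (c p)\<^sup>2 + (c (prod.swap p))\<^sup>2) / 2"
      using sum_squares_bound[of "c p" "c (prod.swap p)"] by (simp add: power2_eq_square algebra_simps)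
    then show "c p * ((c p + c (prod.swap p)) / m) \<le> ((3 * (c p)\<^sup>2 + (c (prod.swap p))\<^sup>2) / 2) / m"
      by (metis divide_right_mono of_nat_0_le_iff times_divide_eq_right)
  qed
  also have "\<dots> = (3 * (\<Sum>p\<in>D. (c p)\<^sup>2) + (\<Sum>p\<in>D. (c (prod.swap p))\<^sup>2)) / 2 / m"
    by (simp add: sum_divide_distrib[symmetric] sum.distrib sum_distrib_left)
  also have "(\<Sum>p\<in>D. (c (prod.swap p))\<^sup>2) = (\<Sum>p\<in>D. (c p)\<^sup>2)"
    by (rule sum.reindex_bij_witness[of _ prod.swap prod.swap]) (auto simp: sw)
  finally show ?thesis by simp
qed

text \<open>Each column of the sketch has a single entry 1 or -1, so the diagonal of its Gram matrix
  is exactly 1. Subtracting the unsketched product removes the diagonal and leaves pairs of distinct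
  columns.\<close>

lemma sketch_gram_entry:
  assumes f: "f \<in> sketch_choices m n" and G: "G \<in> carrier_mat n r" and H: "H \<in> carrier_mat n r'"
    and ab: "a < r" "b < r'"
  defines "S \<equiv> sketch_mat m n f"
  shows "(transpose_mat (S * G) * (S * H) - transpose_mat G * H) $$ (a, b)
    = (\<Sum>p\<in>{p. fst p < n \<and> snd p < n \<and> fst p \<noteq> snd p}. G $$ (fst p, a) * H $$ (snd p, b) * pair_sign f p)"
proof -
  define D where "D = {p :: nat \<times> nat. fst p < n \<and> snd p < n \<and> fst p \<noteq> snd p}"
  have S: "S \<in> carrier_mat m n" by (simp add: S_def sketch_mat_def)
  have SS: "(\<Sum>i<m. S $$ (i, j) * S $$ (i, l)) = pair_sign f (j, l)" if jl: "j < n" "l < n" for j l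
  proof -
    have "(\<Sum>i<m. S $$ (i, j) * S $$ (i, l))
        = (\<Sum>i<m. if i = fst (f j) then (if i = fst (f l) then snd (f j) * snd (f l) else 0) else 0)"
      using jl by (intro sum.cong) (auto simp: S_def sketch_mat_def)
    also have "\<dots> = pair_sign f (j, l)"
      using sketch_choicesD(1)[OF f jl(1)] by (subst sum.delta) (auto simp: pair_sign_def)
    finally show ?thesis .
  qed
  have "(transpose_mat (S * G) * (S * H)) $$ (a, b) = (\<Sum>i<m. (\<Sum>j<n. S $$ (i, j) * G $$ (j, a)) * (\<Sum>l<n. S $$ (i, l) * H $$ (l, b)))"
    using S G H ab by (auto simp: scalar_prod_def lessThan_atLeast0 intro!: sum.cong)
  also have "\<dots> = (\<Sum>i<m. \<Sum>j<n. \<Sum>l<n. G $$ (j, a) * H $$ (l, b) * (S $$ (i, j) * S $$ (i, l)))"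
    by (simp add: sum_product mult_ac)
  also have "\<dots> = (\<Sum>j<n. \<Sum>l<n. \<Sum>i<m. G $$ (j, a) * H $$ (l, b) * (S $$ (i, j) * S $$ (i, l)))"
    by (subst sum.swap) (intro sum.cong refl sum.swap)
  also have "\<dots> = (\<Sum>j<n. \<Sum>l<n. G $$ (j, a) * H $$ (l, b) * pair_sign f (j, l))"
    by (intro sum.cong refl) (simp add: SS flip: sum_distrib_left)
  also have "\<dots> = (\<Sum>p\<in>{..<n}\<times>{..<n}. G $$ (fst p, a) * H $$ (snd p, b) * pair_sign f p)"
    by (simp add: sum.cartesian_product case_prod_beta)
  also have "\<dots> = (\<Sum>p\<in>D. G $$ (fst p, a) * H $$ (snd p, b) * pair_sign f p)
      + (\<Sum>p\<in>(\<lambda>j. (j, j)) ` {..<n}. G $$ (fst p, a) * H $$ (snd p, b) * pair_sign f p)"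
  proof (subst sum.union_disjoint[symmetric])
    show "finite D" by (rule finite_subset[of _ "{..<n} \<times> {..<n}"]) (auto simp: D_def mem_Times_iff)
    show "D \<inter> (\<lambda>j. (j, j)) ` {..<n} = {}" by (auto simp: D_def)
    have "{..<n} \<times> {..<n} = D \<union> (\<lambda>j. (j, j)) ` {..<n}" by (auto simp: D_def)
    then show "(\<Sum>p\<in>{..<n}\<times>{..<n}. G $$ (fst p, a) * H $$ (snd p, b) * pair_sign f p) =
      (\<Sum>p\<in>D \<union> (\<lambda>j. (j, j)) ` {..<n}. G $$ (fst p, a) * H $$ (snd p, b) * pair_sign f p)" by simp
  qed simp
  also have "(\<Sum>p\<in>(\<lambda>j. (j, j)) ` {..<n}. G $$ (fst p, a) * H $$ (snd p, b) * pair_sign f p)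
      = (\<Sum>j<n. G $$ (j, a) * H $$ (j, b))"
    by (subst sum.reindex) (auto simp: inj_on_def pair_sign_def sketch_choicesD(3)[OF f] intro!: sum.cong)
  also have "\<dots> = (transpose_mat G * H) $$ (a, b)"
    using G H ab by (auto simp: scalar_prod_def lessThan_atLeast0 intro!: sum.cong)
  finally show ?thesis using S G H ab by (simp add: D_def)
qed

text \<open>Each entry of the error is a sum of pair signs with product coefficients. After
  \<open>sketch_mean_square\<close>, the squared coefficients summed over all entries factor into
  two squared Frobenius norms.\<close>

lemma approx_matrix_multiplication:
  assumes m: "0 < m" and G: "G \<in> carrier_mat n r" and H: "H \<in> carrier_mat n r'"
  shows "sketch_mean m n (\<lambda>f. \<Sum>a<r. \<Sum>b<r'.
      ((transpose_mat (sketch_mat m n f * G) * (sketch_mat m n f * H) - transpose_mat G * H) $$ (a, b))\<^sup>2)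
    \<le> 2 / m * (\<Sum>j<n. \<Sum>a<r. (G $$ (j, a))\<^sup>2) * (\<Sum>j<n. \<Sum>b<r'. (H $$ (j, b))\<^sup>2)"
proof -
  define D where "D = {p :: nat \<times> nat. fst p < n \<and> snd p < n \<and> fst p \<noteq> snd p}"
  define c where "c a b p = G $$ (fst p, a) * H $$ (snd p, b)" for a b p
  have "sketch_mean m n (\<lambda>f. \<Sum>a<r. \<Sum>b<r'.
      ((transpose_mat (sketch_mat m n f * G) * (sketch_mat m n f * H) - transpose_mat G * H) $$ (a, b))\<^sup>2)
    = sketch_mean m n (\<lambda>f. \<Sum>a<r. \<Sum>b<r'. (\<Sum>p\<in>D. c a b p * pair_sign f p)\<^sup>2)"
    unfolding sketch_mean_eq[OF m] by (simp add: sketch_gram_entry[OF _ G H] D_def c_def)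
  also have "\<dots> = (\<Sum>a<r. \<Sum>b<r'. sketch_mean m n (\<lambda>f. (\<Sum>p\<in>D. c a b p * pair_sign f p)\<^sup>2))"
    by (simp only: sketch_mean_sum[OF m])
  also have "\<dots> \<le> (\<Sum>a<r. \<Sum>b<r'. 2 / m * (\<Sum>p\<in>D. (c a b p)\<^sup>2))"
    unfolding D_def by (intro sum_mono sketch_mean_square[OF m])
  \<comment> \<open>Adding the diagonal pairs makes the index set a product, over which the sum
    factors.\<close>
  also have "\<dots> \<le> (\<Sum>a<r. \<Sum>b<r'. 2 / m * (\<Sum>p\<in>{..<n}\<times>{..<n}. (c a b p)\<^sup>2))"
    by (intro sum_mono mult_left_mono sum_mono2) (auto simp: D_def mem_Times_iff)
  also have "\<dots> = (\<Sum>a<r. \<Sum>b<r'. 2 / m * ((\<Sum>j<n. (G $$ (j, a))\<^sup>2) * (\<Sum>l<n. (H $$ (l, b))\<^sup>2)))"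
    by (simp add: c_def sum_product sum.cartesian_product case_prod_beta power_mult_distrib)
  also have "\<dots> = 2 / m * ((\<Sum>a<r. \<Sum>j<n. (G $$ (j, a))\<^sup>2) * (\<Sum>b<r'. \<Sum>l<n. (H $$ (l, b))\<^sup>2))"
  proof -
    have "(\<Sum>a<r. \<Sum>b<r'. k * (g a * h b)) = k * ((\<Sum>a<r. g a) * (\<Sum>b<r'. h b))" for k :: real and g h
      unfolding sum_product by (simp add: sum_distrib_left)
    then show ?thesis by this
  qed
  also have "(\<Sum>a<r. \<Sum>j<n. (G $$ (j, a))\<^sup>2) = (\<Sum>j<n. \<Sum>a<r. (G $$ (j, a))\<^sup>2)" by (rule sum.swap)
  also have "(\<Sum>b<r'. \<Sum>l<n. (H $$ (l, b))\<^sup>2) = (\<Sum>l<n. \<Sum>b<r'. (H $$ (l, b))\<^sup>2)" by (rule sum.swap)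
  finally show ?thesis by (simp add: mult.assoc)
qed

lemma sketch_markov:
  assumes m: "0 < m" and g: "\<And>f. 0 \<le> g f" and t: "0 < t"
  shows "measure_pmf.prob (pmf_of_set (sketch_choices m n)) {f. t \<le> g f} \<le> sketch_mean m n g / t"
proof -
  have "finite (set_pmf (pmf_of_set (sketch_choices m n)))"
    using finite_sketch_choices sketch_choices_nonempty[OF m] by simp
  then have "integrable (measure_pmf (pmf_of_set (sketch_choices m n))) g"
    by (rule integrable_measure_pmf_finite)
  from integral_Markov_inequality_measure[OF this, of "{}" t] show ?thesis
    using g t by (simp add: sketch_mean_def)
qed

section \<open>Perturbation of canonical correlations\<close>

lemma gram_form:
  fixes A B :: "real mat"
  assumes A: "A \<in> carrier_mat n d" and B: "B \<in> carrier_mat n d'"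
    and x: "x \<in> carrier_vec d" and y: "y \<in> carrier_vec d'"
  shows "x \<bullet> ((transpose_mat A * B) *\<^sub>v y) = (A *\<^sub>v x) \<bullet> (B *\<^sub>v y)"
proof -
  have "x \<bullet> ((transpose_mat A * B) *\<^sub>v y) = x \<bullet> (transpose_mat A *\<^sub>v (B *\<^sub>v y))"
    using A B y by (simp add: assoc_mult_mat_vec[of _ d n])
  also have "\<dots> = (transpose_mat A *\<^sub>v (B *\<^sub>v y)) \<bullet> x"
    using A B x y by (intro comm_scalar_prod[of _ d]) auto
  also have "\<dots> = (B *\<^sub>v y) \<bullet> (A *\<^sub>v x)" using A B x y by (intro transpose_vec_mult_scalar) auto
  also have "\<dots> = (A *\<^sub>v x) \<bullet> (B *\<^sub>v y)" using A B x y by (intro comm_scalar_prod[of _ n]) auto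
  finally show ?thesis .
qed

lemma mat_entry_form:
  fixes C :: "real mat"
  assumes "C \<in> carrier_mat d d'" "U \<in> carrier_mat d q" "V \<in> carrier_mat d' q" "i < q" "j < q"
  shows "(transpose_mat U * C * V) $$ (i, j) = col U i \<bullet> (C *\<^sub>v col V j)"
proof -
  have "(transpose_mat U * C * V) $$ (i, j) = (transpose_mat U * (C * V)) $$ (i, j)"
    using assms by (simp add: assoc_mult_mat[of _ q d C d' V q])
  also have "\<dots> = col U i \<bullet> (C *\<^sub>v col V j)" using assms by (simp add: mult_mat_vec_def)
  finally show ?thesis .
qed

text \<open>The regularization terms are nonnegative, so normalized weights have images of squared
  length at most 1 under \<open>A\<close> and \<open>B\<close>. The bound turns the multiplicative
  errors of \<open>cca_weyl\<close> into additive ones.\<close>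

lemma cca_feasible_le_1:
  assumes A: "A \<in> carrier_mat n d" and B: "B \<in> carrier_mat n d'" and lam: "0 \<le> lam1" "0 \<le> lam2"
    and feas: "cca_feasible lam1 lam2 A B s U V" and i: "i < cca_dim lam1 lam2 A B"
  shows "s $ i \<le> 1"
proof -
  define q where "q = cca_dim lam1 lam2 A B"
  have U: "U \<in> carrier_mat d q" and V: "V \<in> carrier_mat d' q" and s: "s \<in> carrier_vec q"
    and UPU: "transpose_mat U * reg_gram lam1 A * U = 1\<^sub>m q"
    and VPV: "transpose_mat V * reg_gram lam2 B * V = 1\<^sub>m q"
    and UCV: "transpose_mat U * (transpose_mat A * B) * V = mat_diag q (\<lambda>i. s $ i)"
    using feas A B by (auto simp: cca_feasible_def Let_def q_def)
  have i: "i < q" using i by (simp add: q_def)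
  have u: "col U i \<in> carrier_vec d" and v: "col V i \<in> carrier_vec d'" using U V by (auto intro: carrier_vecI)
  have C: "transpose_mat A * B \<in> carrier_mat d d'" using A B by simp
  have "s $ i = (A *\<^sub>v col U i) \<bullet> (B *\<^sub>v col V i)"
    using mat_entry_form[OF C U V i i] gram_form[OF A B u v] i by (simp add: UCV mat_diag_def)
  also have "\<dots> \<le> ((A *\<^sub>v col U i) \<bullet> (A *\<^sub>v col U i) + (B *\<^sub>v col V i) \<bullet> (B *\<^sub>v col V i)) / 2"
    using A B u v by (intro scalar_prod_le_mean[of _ n]) auto
  also have "\<dots> \<le> (col U i \<bullet> (reg_gram lam1 A *\<^sub>v col U i) + col V i \<bullet> (reg_gram lam2 B *\<^sub>v col V i)) / 2"
    using lam by (simp add: reg_gram_form[OF A u u] reg_gram_form[OF B v v] add_mono)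
  also have "\<dots> = 1"
    using mat_entry_form[OF reg_gram_carrier[OF A, of lam1] U U i i]
      mat_entry_form[OF reg_gram_carrier[OF B, of lam2] V V i i] i
    unfolding UPU VPV by simp
  finally show ?thesis .
qed

text \<open>The deterministic part. The regularization terms cancel in the differences of the forms,
  and errors relative to \<open>p\<close> and \<open>p'\<close> keep the two problems comparable
  even where the forms are singular.\<close>

lemma is_approx_cca_of_perturbation:
  assumes A: "A \<in> carrier_mat n d" and B: "B \<in> carrier_mat n d'"
    and A2: "A2 \<in> carrier_mat m d" and B2: "B2 \<in> carrier_mat m d'"
    and lam: "0 \<le> lam1" "0 \<le> lam2" and eps: "0 \<le> \<epsilon>" "\<epsilon> \<le> 1"
  defines "p \<equiv> \<lambda>x. sqrt (x \<bullet> (reg_gram lam1 A *\<^sub>v x))" and "p' \<equiv> \<lambda>y. sqrt (y \<bullet> (reg_gram lam2 B *\<^sub>v y))"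
  assumes AA: "\<And>x y. x \<in> carrier_vec d \<Longrightarrow> y \<in> carrier_vec d \<Longrightarrow>
      \<bar>(A2 *\<^sub>v x) \<bullet> (A2 *\<^sub>v y) - (A *\<^sub>v x) \<bullet> (A *\<^sub>v y)\<bar> \<le> \<epsilon> / 4 * (p x * p y)"
    and BB: "\<And>x y. x \<in> carrier_vec d' \<Longrightarrow> y \<in> carrier_vec d' \<Longrightarrow>
      \<bar>(B2 *\<^sub>v x) \<bullet> (B2 *\<^sub>v y) - (B *\<^sub>v x) \<bullet> (B *\<^sub>v y)\<bar> \<le> \<epsilon> / 4 * (p' x * p' y)"
    and AB: "\<And>x y. x \<in> carrier_vec d \<Longrightarrow> y \<in> carrier_vec d' \<Longrightarrow>
      \<bar>(A2 *\<^sub>v x) \<bullet> (B2 *\<^sub>v y) - (A *\<^sub>v x) \<bullet> (B *\<^sub>v y)\<bar> \<le> \<epsilon> / 4 * (p x * p' y)"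
    and cca2: "is_cca lam1 lam2 A2 B2 s2 U2 V2"
  shows "is_approx_cca \<epsilon> lam1 lam2 A B s2 U2 V2"
proof -
  define P where "P = reg_gram lam1 A"
  define P' where "P' = reg_gram lam2 B"
  define Q where "Q = reg_gram lam1 A2"
  define Q' where "Q' = reg_gram lam2 B2"
  define C where "C = transpose_mat A * B"
  define C2 where "C2 = transpose_mat A2 * B2"
  define q where "q = cca_dim lam1 lam2 A B"
  have psd: "psd d P" "psd d' P'" "psd d Q" "psd d' Q'"
    using psd_reg_gram A B A2 B2 lam by (auto simp: P_def P'_def Q_def Q'_def)
  have carr: "P \<in> carrier_mat d d" "P' \<in> carrier_mat d' d'" "Q \<in> carrier_mat d d" "Q' \<in> carrier_mat d' d'"
    "C \<in> carrier_mat d d'" "C2 \<in> carrier_mat d d'"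
    using A B A2 B2 by (auto simp: P_def P'_def Q_def Q'_def C_def C2_def)
  have P0: "0 \<le> x \<bullet> (P *\<^sub>v x)" "p x * p x = x \<bullet> (P *\<^sub>v x)" if "x \<in> carrier_vec d" for x
    using psd(1) that by (auto simp: psd_def p_def P_def)
  have P0': "0 \<le> y \<bullet> (P' *\<^sub>v y)" "p' y * p' y = y \<bullet> (P' *\<^sub>v y)" if "y \<in> carrier_vec d'" for y
    using psd(2) that by (auto simp: psd_def p'_def P'_def)
  have Q0: "0 \<le> x \<bullet> (Q *\<^sub>v x)" if "x \<in> carrier_vec d" for x using psd(3) that by (simp add: psd_def)
  have Q0': "0 \<le> y \<bullet> (Q' *\<^sub>v y)" if "y \<in> carrier_vec d'" for y using psd(4) that by (simp add: psd_def)
  have PQ_form: "\<bar>x \<bullet> (Q *\<^sub>v y) - x \<bullet> (P *\<^sub>v y)\<bar> \<le> \<epsilon> / 4 * (p x * p y)"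
    if "x \<in> carrier_vec d" "y \<in> carrier_vec d" for x y
    using AA[OF that] by (simp add: P_def Q_def reg_gram_form[OF A that] reg_gram_form[OF A2 that])
  have PQ_form': "\<bar>x \<bullet> (Q' *\<^sub>v y) - x \<bullet> (P' *\<^sub>v y)\<bar> \<le> \<epsilon> / 4 * (p' x * p' y)"
    if "x \<in> carrier_vec d'" "y \<in> carrier_vec d'" for x y
    using BB[OF that] by (simp add: P'_def Q'_def reg_gram_form[OF B that] reg_gram_form[OF B2 that])
  have CC_form: "\<bar>x \<bullet> (C2 *\<^sub>v y) - x \<bullet> (C *\<^sub>v y)\<bar> \<le> \<epsilon> / 4 * (p x * p' y)"
    if "x \<in> carrier_vec d" "y \<in> carrier_vec d'" for x y
    using AB[OF that] by (simp add: C_def C2_def gram_form[OF A B that] gram_form[OF A2 B2 that])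
  \<comment> \<open>\<open>K\<close> inverts the lower bound of the sketched form by
    \<open>1 - \<epsilon> / 4\<close> times the original one. As \<open>\<epsilon> \<le> 1\<close>
    gives \<open>K \<le> 4 / 3\<close>, an error \<open>\<epsilon> / 4 * K\<close> is at most
    \<open>\<epsilon> / 3\<close>.\<close>
  define K where "K = 1 / (1 - \<epsilon> / 4)"
  have K: "1 \<le> K" "K \<le> 4 / 3" "K - 1 = \<epsilon> / 4 * K" "K * (1 - \<epsilon> / 4) = 1"
    using eps by (auto simp: K_def field_simps)
  have up: "a' \<le> (1 + \<epsilon> / 4) * a" "a \<le> K * a'" if "\<bar>a' - a\<bar> \<le> \<epsilon> / 4 * a" for a a' :: real
  proof -
    have "a' - a \<le> \<epsilon> / 4 * a" "a - a' \<le> \<epsilon> / 4 * a" using that by linarith+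
    then show "a' \<le> (1 + \<epsilon> / 4) * a" by (simp add: algebra_simps)
    have "(1 - \<epsilon> / 4) * a \<le> a'" using \<open>a - a' \<le> \<epsilon> / 4 * a\<close> by (simp add: algebra_simps)
    then have "K * ((1 - \<epsilon> / 4) * a) \<le> K * a'" using K(1) by (intro mult_left_mono) auto
    then show "a \<le> K * a'" using K(4) by (simp flip: mult.assoc)
  qed
  have QP: "x \<bullet> (Q *\<^sub>v x) \<le> (1 + \<epsilon> / 4) * (x \<bullet> (P *\<^sub>v x))" "x \<bullet> (P *\<^sub>v x) \<le> K * (x \<bullet> (Q *\<^sub>v x))"
    if "x \<in> carrier_vec d" for x
    using up PQ_form[OF that that] P0(2)[OF that] by auto
  have QP': "y \<bullet> (Q' *\<^sub>v y) \<le> (1 + \<epsilon> / 4) * (y \<bullet> (P' *\<^sub>v y))" "y \<bullet> (P' *\<^sub>v y) \<le> K * (y \<bullet> (Q' *\<^sub>v y))"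
    if "y \<in> carrier_vec d'" for y
    using up PQ_form'[OF that that] P0'(2)[OF that] by auto
  have zero: "x \<bullet> (P *\<^sub>v x) = 0 \<longleftrightarrow> x \<bullet> (Q *\<^sub>v x) = 0" if "x \<in> carrier_vec d" for x
    using QP[OF that] P0(1)[OF that] Q0[OF that] by auto
  have zero': "y \<bullet> (P' *\<^sub>v y) = 0 \<longleftrightarrow> y \<bullet> (Q' *\<^sub>v y) = 0" if "y \<in> carrier_vec d'" for y
    using QP'[OF that] P0'(1)[OF that] Q0'[OF that] by auto
  have "mat_rank P = mat_rank Q" unfolding P_def Q_def
    by (rule order.antisym[OF mat_rank_le_of_form_zero[OF A lam(1) A2 lam(1)] mat_rank_le_of_form_zero[OF A2 lam(1) A lam(1)]])
      (use zero in \<open>auto simp: P_def Q_def\<close>)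
  moreover have "mat_rank P' = mat_rank Q'" unfolding P'_def Q'_def
    by (rule order.antisym[OF mat_rank_le_of_form_zero[OF B lam(2) B2 lam(2)] mat_rank_le_of_form_zero[OF B2 lam(2) B lam(2)]])
      (use zero' in \<open>auto simp: P'_def Q'_def\<close>)
  ultimately have q2: "cca_dim lam1 lam2 A2 B2 = q" by (simp add: q_def cca_dim_def P_def P'_def Q_def Q'_def)
  have svd2: "cca_svd d d' q Q Q' C2 s2 U2 V2" and mono2: "nonincreasing s2"
    using cca2 is_cca_iff[OF A2 B2 lam] by (auto simp: q2 Q_def Q'_def C2_def)
  have U2: "U2 \<in> carrier_mat d q" and V2: "V2 \<in> carrier_mat d' q" and s2: "s2 \<in> carrier_vec q"
    and UQU: "transpose_mat U2 * Q * U2 = 1\<^sub>m q" and VQV: "transpose_mat V2 * Q' * V2 = 1\<^sub>m q"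
    and s2_nonneg: "\<forall>i<q. 0 \<le> s2 $ i"
    using svd2 by (auto simp: cca_svd_def)
  have feas2: "cca_feasible lam1 lam2 A2 B2 s2 U2 V2" using cca2 by (simp add: is_cca_def)
  then have UCV: "transpose_mat U2 * C2 * V2 = mat_diag q (\<lambda>i. s2 $ i)"
    using q2 by (simp add: cca_feasible_def Let_def C2_def)
  have s2_le: "s2 $ i \<le> 1" if "i < q" for i using cca_feasible_le_1[OF A2 B2 lam feas2] that q2 by simp
  have u: "col U2 i \<in> carrier_vec d" and v: "col V2 i \<in> carrier_vec d'" for i
    using U2 V2 by (auto intro: carrier_vecI)
  have uQu: "col U2 i \<bullet> (Q *\<^sub>v col U2 j) = (if i = j then 1 else 0)" if "i < q" "j < q" for i j
    using mat_entry_form[OF carr(3) U2 U2 that] that by (simp add: UQU)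
  have vQv: "col V2 i \<bullet> (Q' *\<^sub>v col V2 j) = (if i = j then 1 else 0)" if "i < q" "j < q" for i j
    using mat_entry_form[OF carr(4) V2 V2 that] that by (simp add: VQV)
  \<comment> \<open>The columns of \<open>U2\<close> are normalized for \<open>Q\<close>; measured
    by \<open>P\<close> they may be longer by a factor \<open>sqrt K\<close>.\<close>
  have pu: "p (col U2 i) \<le> sqrt K" "0 \<le> p (col U2 i)" if "i < q" for i
    using QP(2)[OF u, of i] uQu[OF that that] P0(1)[OF u] by (auto simp: p_def P_def)
  have pv: "p' (col V2 i) \<le> sqrt K" "0 \<le> p' (col V2 i)" if "i < q" for i
    using QP'(2)[OF v, of i] vQv[OF that that] P0'(1)[OF v] by (auto simp: p'_def P'_def)
  have eK: "\<epsilon> / 4 * (a * b) \<le> \<epsilon> / 4 * K" if "0 \<le> a" "a \<le> sqrt K" "0 \<le> b" "b \<le> sqrt K" for a b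
  proof -
    have "a * b \<le> sqrt K * sqrt K" using that K(1) by (intro mult_mono) auto
    then show ?thesis using K eps by (intro mult_left_mono) auto
  qed
  have eK3: "\<epsilon> / 4 * K \<le> \<epsilon> / 3" using K(2) eps mult_left_mono[of K "4/3" "\<epsilon> / 4"] by simp
  have gram: "\<bar>(transpose_mat U2 * P * U2 - 1\<^sub>m q) $$ (i, j)\<bar> \<le> \<epsilon>" if ij: "i < q" "j < q" for i j
  proof -
    have "(transpose_mat U2 * P * U2 - 1\<^sub>m q) $$ (i, j) = col U2 i \<bullet> (P *\<^sub>v col U2 j) - col U2 i \<bullet> (Q *\<^sub>v col U2 j)"
      using mat_entry_form[OF carr(1) U2 U2 ij] ij U2 carr uQu[OF ij] by simp
    then show ?thesis using PQ_form[OF u u, of i j] eK[of "p (col U2 i)" "p (col U2 j)"] pu[OF ij(1)] pu[OF ij(2)] eK3 eps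
      by (simp add: abs_minus_commute)
  qed
  have gram': "\<bar>(transpose_mat V2 * P' * V2 - 1\<^sub>m q) $$ (i, j)\<bar> \<le> \<epsilon>" if ij: "i < q" "j < q" for i j
  proof -
    have "(transpose_mat V2 * P' * V2 - 1\<^sub>m q) $$ (i, j) = col V2 i \<bullet> (P' *\<^sub>v col V2 j) - col V2 i \<bullet> (Q' *\<^sub>v col V2 j)"
      using mat_entry_form[OF carr(2) V2 V2 ij] ij V2 carr vQv[OF ij] by simp
    then show ?thesis using PQ_form'[OF v v, of i j] eK[of "p' (col V2 i)" "p' (col V2 j)"] pv[OF ij(1)] pv[OF ij(2)] eK3 eps
      by (simp add: abs_minus_commute)
  qed
  have corr: "\<bar>s2 $ i - s $ i\<bar> \<le> \<epsilon> \<and> \<bar>col U2 i \<bullet> (C *\<^sub>v col V2 i) - s $ i\<bar> \<le> \<epsilon>"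
    if s: "is_canonical_correlations lam1 lam2 A B s" and i: "i < q" for s i
  proof -
    obtain U V where cca: "is_cca lam1 lam2 A B s U V" using s by (auto simp: is_canonical_correlations_def)
    then have svd: "cca_svd d d' q P P' C s U V" and mono: "nonincreasing s"
      using is_cca_iff[OF A B lam] by (auto simp: q_def P_def P'_def C_def)
    have feas: "cca_feasible lam1 lam2 A B s U V" using cca by (simp add: is_cca_def)
    have U: "U \<in> carrier_mat d q" and V: "V \<in> carrier_mat d' q" and sc: "s \<in> carrier_vec q"
      and UPU: "transpose_mat U * P * U = 1\<^sub>m q" and VPV: "transpose_mat V * P' * V = 1\<^sub>m q"
      using svd by (auto simp: cca_svd_def)
    have UCV1: "transpose_mat U * C * V = mat_diag q (\<lambda>i. s $ i)"
      using feas by (simp add: cca_feasible_def Let_def C_def q_def)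
    have s_le: "s $ i \<le> 1" using cca_feasible_le_1[OF A B lam feas] i by (simp add: q_def)
    \<comment> \<open>Here the test vectors come from the sketched problem, so lengths are taken in
      \<open>Q\<close> and \<open>Q'\<close>, and the passage from \<open>P\<close> and
      \<open>P'\<close> costs the factor \<open>K\<close>.\<close>
    have "s2 $ i \<le> K * s $ i + \<epsilon> / 4 * K"
    proof (rule cca_weyl[OF psd(1,2) svd mono carr(3,4,6) U2 V2 s2 UQU VQV UCV mono2 _ QP(2) QP'(2) _ i])
      fix x y :: "real Matrix.vec"
      assume x: "x \<in> carrier_vec d" and y: "y \<in> carrier_vec d'"
      have "p x \<le> sqrt K * sqrt (x \<bullet> (Q *\<^sub>v x))" "p' y \<le> sqrt K * sqrt (y \<bullet> (Q' *\<^sub>v y))"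
        using QP(2)[OF x] QP'(2)[OF y] by (auto simp: p_def p'_def P_def P'_def simp flip: real_sqrt_mult)
      then have "p x * p' y \<le> (sqrt K * sqrt (x \<bullet> (Q *\<^sub>v x))) * (sqrt K * sqrt (y \<bullet> (Q' *\<^sub>v y)))"
        using K(1) Q0[OF x] Q0'[OF y] P0(1)[OF x] P0'(1)[OF y]
        by (intro mult_mono) (auto simp: p_def p'_def P_def P'_def)
      also have "\<dots> = K * (sqrt (x \<bullet> (Q *\<^sub>v x)) * sqrt (y \<bullet> (Q' *\<^sub>v y)))"
        using K(1) by simp
      finally have "\<epsilon> / 4 * (p x * p' y) \<le> \<epsilon> / 4 * (K * (sqrt (x \<bullet> (Q *\<^sub>v x)) * sqrt (y \<bullet> (Q' *\<^sub>v y))))"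
        using eps by (intro mult_left_mono) auto
      then have "x \<bullet> (C2 *\<^sub>v y) \<le> x \<bullet> (C *\<^sub>v y) + \<epsilon> / 4 * (K * (sqrt (x \<bullet> (Q *\<^sub>v x)) * sqrt (y \<bullet> (Q' *\<^sub>v y))))"
        using CC_form[OF x y] by linarith
      then show "x \<bullet> (C2 *\<^sub>v y) \<le> x \<bullet> (C *\<^sub>v y) + \<epsilon> / 4 * K * sqrt (x \<bullet> (Q *\<^sub>v x)) * sqrt (y \<bullet> (Q' *\<^sub>v y))"
        by (simp only: mult.assoc)
    qed (use K in auto)
    moreover have "K * s $ i - s $ i \<le> \<epsilon> / 4 * K"
    proof -
      have "K * s $ i - s $ i = (K - 1) * s $ i" by (simp add: algebra_simps)
      also have "\<dots> \<le> (K - 1) * 1" using s_le K(1) by (intro mult_left_mono) auto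
      finally show ?thesis using K(3) by simp
    qed
    ultimately have d1: "s2 $ i - s $ i \<le> 2 * \<epsilon> / 3" using eK3 by simp
    \<comment> \<open>The same comparison with the problems exchanged: lengths are now taken in
      \<open>P\<close> and \<open>P'\<close>, so the factor is \<open>1 + \<epsilon> / 4\<close> and
      the additive error stays \<open>\<epsilon> / 4\<close>.\<close>
    have "s $ i \<le> (1 + \<epsilon> / 4) * s2 $ i + \<epsilon> / 4"
    proof (rule cca_weyl[OF psd(3,4) svd2 mono2 carr(1,2,5) U V sc UPU VPV UCV1 mono _ QP(1) QP'(1) _ i])
      fix x y :: "real Matrix.vec"
      assume x: "x \<in> carrier_vec d" and y: "y \<in> carrier_vec d'"
      have "x \<bullet> (C *\<^sub>v y) \<le> x \<bullet> (C2 *\<^sub>v y) + \<epsilon> / 4 * (p x * p' y)" using CC_form[OF x y] by linarith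
      then show "x \<bullet> (C *\<^sub>v y) \<le> x \<bullet> (C2 *\<^sub>v y) + \<epsilon> / 4 * sqrt (x \<bullet> (P *\<^sub>v x)) * sqrt (y \<bullet> (P' *\<^sub>v y))"
        by (simp only: mult.assoc p_def p'_def P_def P'_def)
    qed (use eps in auto)
    moreover have "(1 + \<epsilon> / 4) * s2 $ i \<le> s2 $ i + \<epsilon> / 4"
      using s2_le[OF i] eps mult_left_mono[of "s2 $ i" 1 "\<epsilon> / 4"] by (simp add: algebra_simps)
    ultimately have d2: "s $ i - s2 $ i \<le> 2 * \<epsilon> / 3" using eps by simp
    have "col U2 i \<bullet> (C2 *\<^sub>v col V2 i) = s2 $ i"
      using mat_entry_form[OF carr(6) U2 V2 i i] i by (simp add: UCV mat_diag_def)
    then have d3: "\<bar>col U2 i \<bullet> (C *\<^sub>v col V2 i) - s2 $ i\<bar> \<le> \<epsilon> / 3"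
      using CC_form[OF u v, of i i] eK[of "p (col U2 i)" "p' (col V2 i)"] pu[OF i] pv[OF i] eK3
      by (simp add: abs_minus_commute)
    \<comment> \<open>By the triangle inequality through \<open>s2 $ i\<close>, the errors
      \<open>2 * \<epsilon> / 3\<close> and \<open>\<epsilon> / 3\<close> add up to
      \<open>\<epsilon>\<close>.\<close>
    show ?thesis using d1 d2 d3 eps by (intro conjI) linarith+
  qed
  obtain s U V where "cca_svd d d' q P P' C s U V" "nonincreasing s"
    using cca_svd_exists[OF A B lam] by (auto simp: q_def P_def P'_def C_def)
  then have "is_cca lam1 lam2 A B s U V" using is_cca_iff[OF A B lam] by (simp add: q_def P_def P'_def C_def)
  then have "\<exists>s. is_canonical_correlations lam1 lam2 A B s" by (auto simp: is_canonical_correlations_def)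
  then show ?thesis
    unfolding is_approx_cca_def Let_def q_def[symmetric]
    using s2 mono2 s2_nonneg U2 V2 A B gram gram' corr by (auto simp: P_def P'_def C_def)
qed

section \<open>From the second moment bound to the forms\<close>

text \<open>Cauchy-Schwarz for \<open>E\<close> against the outer product of \<open>a\<close> and
  \<open>b\<close>, both read as families indexed by pairs.\<close>

lemma frobenius_form_bound:
  fixes E :: "real mat"
  assumes E: "E \<in> carrier_mat r r'" and a: "a \<in> carrier_vec r" and b: "b \<in> carrier_vec r'"
  shows "\<bar>a \<bullet> (E *\<^sub>v b)\<bar> \<le> sqrt (\<Sum>i<r. \<Sum>j<r'. (E $$ (i, j))\<^sup>2) * (sqrt (a \<bullet> a) * sqrt (b \<bullet> b))"
proof -
  let ?I = "{..<r} \<times> {..<r'}"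
  have "a \<bullet> (E *\<^sub>v b) = (\<Sum>i<r. \<Sum>j<r'. E $$ (i, j) * (a $ i * b $ j))"
    using assms by (auto simp: scalar_prod_def lessThan_atLeast0 sum_distrib_left mult_ac intro!: sum.cong)
  also have "\<dots> = (\<Sum>p\<in>?I. E $$ p * (a $ fst p * b $ snd p))"
    by (simp add: sum.cartesian_product case_prod_beta)
  finally have "(a \<bullet> (E *\<^sub>v b))\<^sup>2 \<le> (\<Sum>p\<in>?I. (E $$ p)\<^sup>2) * (\<Sum>p\<in>?I. (a $ fst p * b $ snd p)\<^sup>2)"
    using Cauchy_Schwarz_ineq_sum[of "\<lambda>p. E $$ p" "\<lambda>p. a $ fst p * b $ snd p" ?I] by simp
  also have "(\<Sum>p\<in>?I. (E $$ p)\<^sup>2) = (\<Sum>i<r. \<Sum>j<r'. (E $$ (i, j))\<^sup>2)"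
    by (simp add: sum.cartesian_product case_prod_beta)
  also have "(\<Sum>p\<in>?I. (a $ fst p * b $ snd p)\<^sup>2) = (a \<bullet> a) * (b \<bullet> b)"
    using a b by (simp add: scalar_prod_self sum_product sum.cartesian_product case_prod_beta power_mult_distrib)
  finally have "\<bar>a \<bullet> (E *\<^sub>v b)\<bar> \<le> sqrt ((\<Sum>i<r. \<Sum>j<r'. (E $$ (i, j))\<^sup>2) * ((a \<bullet> a) * (b \<bullet> b)))"
    by (metis real_sqrt_abs real_sqrt_le_mono)
  then show ?thesis by (simp add: real_sqrt_mult)
qed

text \<open>By whitening, \<open>A *\<^sub>v x = (A * W) *\<^sub>v a\<close> with \<open>a\<close>
  the coordinates of \<open>x\<close>, and the same holds after sketching. The error is therefore
  the form of the Gram error of \<open>A * W\<close> and \<open>B * W'\<close> at \<open>a\<close>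
  and \<open>b\<close>, whose lengths Bessel bounds by \<open>P\<close> and
  \<open>P'\<close>.\<close>

lemma sketch_form_bound:
  assumes A: "A \<in> carrier_mat n d" and B: "B \<in> carrier_mat n d'" and S: "S \<in> carrier_mat m n"
    and P: "psd d P" "psd d' P'" and W: "W \<in> carrier_mat d r" "W' \<in> carrier_mat d' r'"
    and WPW: "transpose_mat W * P * W = 1\<^sub>m r" "transpose_mat W' * P' * W' = 1\<^sub>m r'"
    and AW: "A * (W * (transpose_mat W * P)) = A" "B * (W' * (transpose_mat W' * P')) = B"
    and e: "(\<Sum>i<r. \<Sum>j<r'. ((transpose_mat (S * (A * W)) * (S * (B * W')) - transpose_mat (A * W) * (B * W')) $$ (i, j))\<^sup>2) \<le> e\<^sup>2"
      "0 \<le> e"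
    and x: "x \<in> carrier_vec d" and y: "y \<in> carrier_vec d'"
  shows "\<bar>((S * A) *\<^sub>v x) \<bullet> ((S * B) *\<^sub>v y) - (A *\<^sub>v x) \<bullet> (B *\<^sub>v y)\<bar>
    \<le> e * (sqrt (x \<bullet> (P *\<^sub>v x)) * sqrt (y \<bullet> (P' *\<^sub>v y)))"
proof -
  have Pc: "P \<in> carrier_mat d d" "P' \<in> carrier_mat d' d'" using P by (auto simp: psd_def)
  define G where "G = A * W"
  define H where "H = B * W'"
  have G: "G \<in> carrier_mat n r" and H: "H \<in> carrier_mat n r'" using A B W by (auto simp: G_def H_def)
  define a where "a = transpose_mat W *\<^sub>v (P *\<^sub>v x)"
  define b where "b = transpose_mat W' *\<^sub>v (P' *\<^sub>v y)"
  have a: "a \<in> carrier_vec r" and b: "b \<in> carrier_vec r'" using W Pc x y by (auto simp: a_def b_def)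
  have red: "X *\<^sub>v z = (X * W0) *\<^sub>v (transpose_mat W0 *\<^sub>v (R *\<^sub>v z))"
    if "X \<in> carrier_mat n k" "W0 \<in> carrier_mat k l" "R \<in> carrier_mat k k" "z \<in> carrier_vec k"
      "X * (W0 * (transpose_mat W0 * R)) = X" for X W0 R :: "real mat" and z k l
  proof -
    have c: "transpose_mat W0 * R \<in> carrier_mat l k" "X * W0 \<in> carrier_mat n l" "transpose_mat W0 \<in> carrier_mat l k"
      using that by auto
    have "X *\<^sub>v z = (X * W0 * (transpose_mat W0 * R)) *\<^sub>v z"
      using that(5) assoc_mult_mat[OF that(1,2) c(1)] by simp
    also have "\<dots> = (X * W0) *\<^sub>v ((transpose_mat W0 * R) *\<^sub>v z)" by (rule assoc_mult_mat_vec[OF c(2,1) that(4)])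
    also have "(transpose_mat W0 * R) *\<^sub>v z = transpose_mat W0 *\<^sub>v (R *\<^sub>v z)"
      by (rule assoc_mult_mat_vec[OF c(3) that(3,4)])
    finally show ?thesis .
  qed
  have Ax: "A *\<^sub>v x = G *\<^sub>v a" unfolding G_def a_def by (rule red[OF A W(1) Pc(1) x AW(1)])
  have By: "B *\<^sub>v y = H *\<^sub>v b" unfolding H_def b_def by (rule red[OF B W(2) Pc(2) y AW(2)])
  have SAx: "(S * A) *\<^sub>v x = (S * G) *\<^sub>v a"
    using assoc_mult_mat_vec[OF S A x] assoc_mult_mat_vec[OF S G a] by (simp only: Ax)
  have SBy: "(S * B) *\<^sub>v y = (S * H) *\<^sub>v b"
    using assoc_mult_mat_vec[OF S B y] assoc_mult_mat_vec[OF S H b] by (simp only: By)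
  define E where "E = transpose_mat (S * G) * (S * H) - transpose_mat G * H"
  have SG: "S * G \<in> carrier_mat m r" and SH: "S * H \<in> carrier_mat m r'" using S G H by auto
  have c: "transpose_mat (S * G) * (S * H) \<in> carrier_mat r r'" "transpose_mat G * H \<in> carrier_mat r r'"
    using SG SH G H by auto
  have E: "E \<in> carrier_mat r r'" unfolding E_def by (rule minus_carrier_mat[OF c(2)])
  have "((S * A) *\<^sub>v x) \<bullet> ((S * B) *\<^sub>v y) - (A *\<^sub>v x) \<bullet> (B *\<^sub>v y) = a \<bullet> (E *\<^sub>v b)"
  proof -
    have "E *\<^sub>v b = (transpose_mat (S * G) * (S * H)) *\<^sub>v b - (transpose_mat G * H) *\<^sub>v b"
      unfolding E_def by (rule minus_mult_distrib_mat_vec[OF c b])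
    then have "a \<bullet> (E *\<^sub>v b) = a \<bullet> ((transpose_mat (S * G) * (S * H)) *\<^sub>v b) - a \<bullet> ((transpose_mat G * H) *\<^sub>v b)"
      using scalar_prod_minus_distrib[OF a mult_mat_vec_carrier[OF c(1) b] mult_mat_vec_carrier[OF c(2) b]] by (simp only:)
    then show ?thesis by (simp only: Ax By SAx SBy gram_form[OF SG SH a b] gram_form[OF G H a b])
  qed
  then have "\<bar>((S * A) *\<^sub>v x) \<bullet> ((S * B) *\<^sub>v y) - (A *\<^sub>v x) \<bullet> (B *\<^sub>v y)\<bar>
      \<le> sqrt (\<Sum>i<r. \<Sum>j<r'. (E $$ (i, j))\<^sup>2) * (sqrt (a \<bullet> a) * sqrt (b \<bullet> b))"
    using frobenius_form_bound[OF E a b] by simp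
  also have "\<dots> \<le> e * (sqrt (x \<bullet> (P *\<^sub>v x)) * sqrt (y \<bullet> (P' *\<^sub>v y)))"
  proof (intro mult_mono)
    show "sqrt (\<Sum>i<r. \<Sum>j<r'. (E $$ (i, j))\<^sup>2) \<le> e"
      using e by (intro real_le_lsqrt) (auto simp: E_def G_def H_def sum_nonneg)
    show "sqrt (a \<bullet> a) \<le> sqrt (x \<bullet> (P *\<^sub>v x))" "sqrt (b \<bullet> b) \<le> sqrt (y \<bullet> (P' *\<^sub>v y))"
      using bessel(2)[OF P(1) W(1) WPW(1) x] bessel(2)[OF P(2) W(2) WPW(2) y] by (simp_all add: a_def b_def)
  qed (use e P x y in \<open>auto simp: psd_def\<close>)
  finally show ?thesis .
qed

theorem theorem4p8:
  fixes \<delta> :: real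
  assumes "0 < \<delta>" and "\<delta> < 1"
  shows "\<exists>C>0. \<forall>(n::nat) (d::nat) (d'::nat) (m::nat) (A::real mat) (B::real mat)
           (lam1::real) (lam2::real) (\<epsilon>::real).
           A \<in> carrier_mat n d \<longrightarrow> B \<in> carrier_mat n d' \<longrightarrow>
           0 \<le> lam1 \<longrightarrow> 0 \<le> lam2 \<longrightarrow> 0 < \<epsilon> \<longrightarrow> \<epsilon> \<le> 1 \<longrightarrow> 0 < m \<longrightarrow>
           real m \<ge> C * (max (stat_dim lam1 A) (stat_dim lam2 B))\<^sup>2 / \<epsilon>\<^sup>2 \<longrightarrow>
           measure_pmf.prob (sparse_embedding_pmf m n)
             {S. (\<exists>s U V. is_cca lam1 lam2 (S * A) (S * B) s U V) \<and>
                 (\<forall>s U V. is_cca lam1 lam2 (S * A) (S * B) s U V \<longrightarrow>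
                    is_approx_cca \<epsilon> lam1 lam2 A B s U V)} \<ge> 1 - \<delta>"
proof (intro exI[of _ "96 / \<delta>"] conjI allI impI)
  \<comment> \<open>Three failure events are allowed \<open>\<delta> / 3\<close> each. The second
    moment bound \<open>2 * D\<^sup>2 / m\<close>, divided by the squared tolerance
    \<open>(\<epsilon> / 4)\<^sup>2\<close>, is
    \<open>32 * D\<^sup>2 / (m * \<epsilon>\<^sup>2)\<close>, and 96 is 3 times 32.\<close>
  show "0 < 96 / \<delta>" using assms by simp
  fix n d d' m :: nat and A B :: "real mat" and lam1 lam2 \<epsilon> :: real
  assume A: "A \<in> carrier_mat n d" and B: "B \<in> carrier_mat n d'" and lam: "0 \<le> lam1" "0 \<le> lam2"
    and eps: "0 < \<epsilon>" "\<epsilon> \<le> 1" and m: "0 < m"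
    and m_ge: "real m \<ge> 96 / \<delta> * (max (stat_dim lam1 A) (stat_dim lam2 B))\<^sup>2 / \<epsilon>\<^sup>2"
  define D where "D = max (stat_dim lam1 A) (stat_dim lam2 B)"
  define P where "P = reg_gram lam1 A"
  define P' where "P' = reg_gram lam2 B"
  define r where "r = mat_rank P"
  define r' where "r' = mat_rank P'"
  have psd: "psd d P" "psd d' P'" using psd_reg_gram A B lam by (auto simp: P_def P'_def)
  obtain W where W: "W \<in> carrier_mat d r" "transpose_mat W * P * W = 1\<^sub>m r" "A * (W * (transpose_mat W * P)) = A"
    and sdA: "(\<Sum>i<n. \<Sum>j<r. ((A * W) $$ (i, j))\<^sup>2) = stat_dim lam1 A"
    using whitening[OF A lam(1)] by (metis P_def r_def)
  obtain W' where W': "W' \<in> carrier_mat d' r'" "transpose_mat W' * P' * W' = 1\<^sub>m r'" "B * (W' * (transpose_mat W' * P')) = B"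
    and sdB: "(\<Sum>i<n. \<Sum>j<r'. ((B * W') $$ (i, j))\<^sup>2) = stat_dim lam2 B"
    using whitening[OF B lam(2)] by (metis P'_def r'_def)
  define err where "err G H k l f = (\<Sum>i<k. \<Sum>j<l.
      ((transpose_mat (sketch_mat m n f * G) * (sketch_mat m n f * H) - transpose_mat G * H) $$ (i, j))\<^sup>2)"
    for G H :: "real mat" and k l :: nat and f
  define \<mu> where "\<mu> = pmf_of_set (sketch_choices m n)"
  define bad where "bad G H k l = {f. (\<epsilon> / 4)\<^sup>2 \<le> err G H k l f}" for G H k l
  have bad_prob: "measure_pmf.prob \<mu> (bad G H k l) \<le> \<delta> / 3"
    if G: "G \<in> carrier_mat n k" "(\<Sum>i<n. \<Sum>j<k. (G $$ (i, j))\<^sup>2) \<le> D"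
      and H: "H \<in> carrier_mat n l" "(\<Sum>i<n. \<Sum>j<l. (H $$ (i, j))\<^sup>2) \<le> D" for G H k l
  proof -
    have "measure_pmf.prob \<mu> (bad G H k l) \<le> sketch_mean m n (err G H k l) / (\<epsilon> / 4)\<^sup>2"
      unfolding \<mu>_def bad_def using eps by (intro sketch_markov[OF m]) (auto simp: err_def intro!: sum_nonneg)
    also have "sketch_mean m n (err G H k l) \<le> 2 / m * (\<Sum>i<n. \<Sum>j<k. (G $$ (i, j))\<^sup>2) * (\<Sum>i<n. \<Sum>j<l. (H $$ (i, j))\<^sup>2)"
      unfolding err_def by (rule approx_matrix_multiplication[OF m G(1) H(1)])
    also have "\<dots> \<le> 2 / m * D * D"
    proof -
      have "0 \<le> D" using G(2) by (rule order.trans[rotated]) (auto intro!: sum_nonneg)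
      then show ?thesis using G(2) H(2) by (intro mult_mono) (auto intro!: sum_nonneg)
    qed
    also have "2 / m * D * D / (\<epsilon> / 4)\<^sup>2 = (32 * D\<^sup>2 / \<epsilon>\<^sup>2) / m" by (simp add: power2_eq_square)
    also have "\<dots> \<le> \<delta> / 3"
    proof -
      have "\<delta> * (96 / \<delta> * D\<^sup>2 / \<epsilon>\<^sup>2) \<le> \<delta> * real m"
        using m_ge assms(1) by (intro mult_left_mono) (auto simp: D_def)
      then have "32 * D\<^sup>2 / \<epsilon>\<^sup>2 \<le> \<delta> / 3 * real m" using assms(1) by simp
      then show ?thesis using m by (subst pos_divide_le_eq) auto
    qed
    finally show ?thesis by (simp add: divide_right_mono)
  qed
  define G where "G = A * W"
  define H where "H = B * W'"
  have G: "G \<in> carrier_mat n r" "(\<Sum>i<n. \<Sum>j<r. (G $$ (i, j))\<^sup>2) \<le> D"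
    and H: "H \<in> carrier_mat n r'" "(\<Sum>i<n. \<Sum>j<r'. (H $$ (i, j))\<^sup>2) \<le> D"
    using A B W W' sdA sdB by (auto simp: G_def H_def D_def)
  \<comment> \<open>One event for each of the comparisons \<open>AA\<close>, \<open>BB\<close> and
    \<open>AB\<close> that \<open>is_approx_cca_of_perturbation\<close> requires.\<close>
  define Bad where "Bad = bad G G r r \<union> bad H H r' r' \<union> bad G H r r'"
  have "measure_pmf.prob \<mu> Bad \<le> measure_pmf.prob \<mu> (bad G G r r) + measure_pmf.prob \<mu> (bad H H r' r') + measure_pmf.prob \<mu> (bad G H r r')"
    unfolding Bad_def by (intro order.trans[OF measure_Un_le] add_mono measure_Un_le) auto
  also have "\<dots> \<le> \<delta>"
    using bad_prob[OF G G] bad_prob[OF H H] bad_prob[OF G H] by simp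
  finally have Bad: "measure_pmf.prob \<mu> Bad \<le> \<delta>" .
  define good where "good = {S. (\<exists>s U V. is_cca lam1 lam2 (S * A) (S * B) s U V) \<and>
      (\<forall>s U V. is_cca lam1 lam2 (S * A) (S * B) s U V \<longrightarrow> is_approx_cca \<epsilon> lam1 lam2 A B s U V)}"
  \<comment> \<open>Outside \<open>Bad\<close> nothing is random any more: a maximizer exists for
    any sketch, and every maximizer satisfies the perturbation bound.\<close>
  have "sketch_mat m n f \<in> good" if f: "f \<notin> Bad" for f
  proof -
    define S where "S = sketch_mat m n f"
    have S: "S \<in> carrier_mat m n" by (simp add: S_def sketch_mat_def)
    have SA: "S * A \<in> carrier_mat m d" and SB: "S * B \<in> carrier_mat m d'" using S A B by auto
    have err: "err G G r r f \<le> (\<epsilon> / 4)\<^sup>2" "err H H r' r' f \<le> (\<epsilon> / 4)\<^sup>2" "err G H r r' f \<le> (\<epsilon> / 4)\<^sup>2"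
      using f by (auto simp: Bad_def bad_def not_le less_imp_le)
    note err = err[unfolded err_def G_def H_def S_def[symmetric]]
    have e0: "0 \<le> \<epsilon> / 4" using eps by simp
    obtain s U V where "is_cca lam1 lam2 (S * A) (S * B) s U V"
      by (rule cca_svd_exists[OF SA SB lam]) (simp add: is_cca_iff[OF SA SB lam])
    moreover have "is_approx_cca \<epsilon> lam1 lam2 A B s U V" if "is_cca lam1 lam2 (S * A) (S * B) s U V" for s U V
    proof (rule is_approx_cca_of_perturbation[OF A B SA SB lam _ eps(2) _ _ _ that])
      show "0 \<le> \<epsilon>" using eps by simp
      show "\<bar>((S * A) *\<^sub>v x) \<bullet> ((S * A) *\<^sub>v y) - (A *\<^sub>v x) \<bullet> (A *\<^sub>v y)\<bar>
          \<le> \<epsilon> / 4 * (sqrt (x \<bullet> (reg_gram lam1 A *\<^sub>v x)) * sqrt (y \<bullet> (reg_gram lam1 A *\<^sub>v y)))"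
        if "x \<in> carrier_vec d" "y \<in> carrier_vec d" for x y
        using sketch_form_bound[OF A A S psd(1,1) W(1) W(1) W(2) W(2) W(3) W(3) err(1) e0 that] unfolding P_def P'_def .
      show "\<bar>((S * B) *\<^sub>v x) \<bullet> ((S * B) *\<^sub>v y) - (B *\<^sub>v x) \<bullet> (B *\<^sub>v y)\<bar>
          \<le> \<epsilon> / 4 * (sqrt (x \<bullet> (reg_gram lam2 B *\<^sub>v x)) * sqrt (y \<bullet> (reg_gram lam2 B *\<^sub>v y)))"
        if "x \<in> carrier_vec d'" "y \<in> carrier_vec d'" for x y
        using sketch_form_bound[OF B B S psd(2,2) W'(1) W'(1) W'(2) W'(2) W'(3) W'(3) err(2) e0 that] unfolding P_def P'_def .
      show "\<bar>((S * A) *\<^sub>v x) \<bullet> ((S * B) *\<^sub>v y) - (A *\<^sub>v x) \<bullet> (B *\<^sub>v y)\<bar>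
          \<le> \<epsilon> / 4 * (sqrt (x \<bullet> (reg_gram lam1 A *\<^sub>v x)) * sqrt (y \<bullet> (reg_gram lam2 B *\<^sub>v y)))"
        if "x \<in> carrier_vec d" "y \<in> carrier_vec d'" for x y
        using sketch_form_bound[OF A B S psd W(1) W'(1) W(2) W'(2) W(3) W'(3) err(3) e0 that] unfolding P_def P'_def .
    qed
    ultimately show ?thesis by (auto simp: good_def S_def)
  qed
  then have "- (sketch_mat m n -` good) \<subseteq> Bad" by auto
  then have "measure_pmf.prob \<mu> (- (sketch_mat m n -` good)) \<le> \<delta>"
    using Bad measure_pmf.finite_measure_mono[of "- (sketch_mat m n -` good)" Bad \<mu>] by simp
  then have "measure_pmf.prob \<mu> (sketch_mat m n -` good) \<ge> 1 - \<delta>"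
    using measure_pmf.prob_compl[of "sketch_mat m n -` good" \<mu>] by (simp add: Compl_eq_Diff_UNIV)
  then show "measure_pmf.prob (sparse_embedding_pmf m n)
             {S. (\<exists>s U V. is_cca lam1 lam2 (S * A) (S * B) s U V) \<and>
                 (\<forall>s U V. is_cca lam1 lam2 (S * A) (S * B) s U V \<longrightarrow>
                    is_approx_cca \<epsilon> lam1 lam2 A B s U V)} \<ge> 1 - \<delta>"
    unfolding good_def[symmetric] sparse_embedding_pmf_eq[OF m] \<mu>_def by simp
qed

end
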